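(* Let $R$ be a hyperbolic Bessel process of index $\alpha\ge-\frac12$ starting from $x=0$, and let $t>0$. Let $A^{(2\alpha+1)}_{s}=\int_0^{s}e^{2(B_u+(2\alpha+1)u)}\,du$ with $B$ a standard Brownian motion. (a) The density function of $\cosh(R_t)$ on $[1,\infty)$ is $$\mathbb{P}(\cosh(R_t)\in dz)=\frac{1}{4^{\alpha+1}}\,\frac{(z-1)^{\alpha}}{\Gamma(\alpha+1)}\,\mathbb{E}\Bigl[e^{-(z-1)/(4A_{t/4}^{(2\alpha+1)})}\frac{1}{\bigl(A_{t/4}^{(2\alpha+1)}\bigr)^{\alpha+1}}\Bigr]\,dz.$$ (b) The density function of $R_t$ on $[0,\infty)$ is $$\mathbb{P}(R_t\in dz)=\frac{1}{4^{\alpha+1}}\,\frac{(\cosh(z)-1)^{\alpha}\sinh(z)}{\Gamma(\alpha+1)}\,\mathbb{E}\Bigl[e^{-(\cosh(z)-1)/(4A_{t/4}^{(2\alpha+1)})}\frac{1}{\bigl(A_{t/4}^{(2\alpha+1)}\bigr)^{\alpha+1}}\Bigr]\,dz.$$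
   Context: $\Gamma$ is the Euler gamma function. Hyperbolic Bessel process. On a filtered probability space satisfying the usual conditions and carrying a standard Brownian motion $B$, a hyperbolic Bessel process of index $\alpha$ starting from $x\ge 0$ is defined as follows. For $\alpha\in(-\frac12,\infty)$ it is the nonnegative diffusion $R$ with $R_t=x+B_t+(\alpha+\frac12)\int_0^t\coth R_u\,du$; for $\alpha\in(-\frac12,0)$ the point $0$ is instantaneously reflecting and the equation is understood as $dR_t=dB_t+(\alpha+\frac12)\mathbf{1}_{\{R_t\ne0\}}\coth R_t\,dt$, $R_0=x$. For $\alpha=-\frac12$ it is $R_t=|x+B_t|$. *)

theory Defs
  imports "HOL-Probability.Probability"
begin

text \<open>Time is indexed by type real; only times \<open>t \<ge> 0\<close> are constrained or used.\<close>

definition usual_conditions :: "'a measure \<Rightarrow> (real \<Rightarrow> 'a measure) \<Rightarrow> bool" where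
  "usual_conditions M F \<longleftrightarrow>
     prob_space M \<and> complete_measure M \<and>
     (\<forall>t\<ge>0. subalgebra M (F t)) \<and>
     (\<forall>s\<ge>0. \<forall>t\<ge>s. sets (F s) \<subseteq> sets (F t)) \<and>
     (\<forall>t\<ge>0. sets (F t) = (\<Inter>s\<in>{t<..}. sets (F s))) \<and>
     null_sets M \<subseteq> sets (F 0)"

definition standard_brownian_motion :: "'a measure \<Rightarrow> (real \<Rightarrow> 'a \<Rightarrow> real) \<Rightarrow> bool" where
  "standard_brownian_motion M B \<longleftrightarrow>
     prob_space M \<and>
     (\<forall>t\<ge>0. B t \<in> borel_measurable M) \<and>
     (AE \<omega> in M. B 0 \<omega> = 0 \<and> continuous_on {0..} (\<lambda>t. B t \<omega>)) \<and>
     (\<forall>s\<ge>0. \<forall>t>s. distributed M lborel (\<lambda>\<omega>. B t \<omega> - B s \<omega>) (normal_density 0 (sqrt (t - s)))) \<and>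
     (\<forall>(\<tau>::nat \<Rightarrow> real) n. 0 \<le> \<tau> 0 \<and> mono \<tau> \<longrightarrow>
        prob_space.indep_vars M (\<lambda>_. borel) (\<lambda>i \<omega>. B (\<tau> (Suc i)) \<omega> - B (\<tau> i) \<omega>) {..<n})"

definition brownian_motion_wrt ::
    "'a measure \<Rightarrow> (real \<Rightarrow> 'a measure) \<Rightarrow> (real \<Rightarrow> 'a \<Rightarrow> real) \<Rightarrow> bool" where
  "brownian_motion_wrt M F B \<longleftrightarrow>
     standard_brownian_motion M B \<and>
     (\<forall>t\<ge>0. B t \<in> borel_measurable (F t)) \<and>
     (\<forall>s\<ge>0. \<forall>t>s. prob_space.indep_set M (sets (F s))
        {(\<lambda>\<omega>. B t \<omega> - B s \<omega>) -` S \<inter> space M | S. S \<in> sets borel})"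

text \<open>The value at \<open>0\<close> is \<open>0\<close>, by division by zero, so that
  \<open>coth r\<close> is also \<open>indicator (- {0}) r * coth r\<close>.\<close>

definition coth :: "real \<Rightarrow> real" where
  "coth r = cosh r / sinh r"

text \<open>The noise is additive, so the equation is a pathwise one and needs no stochastic integral.
  The zero set of the path is required to be Lebesgue-null. For \<open>\<alpha> < 0\<close> this is the
  instantaneous reflection at \<open>0\<close>; for \<open>\<alpha> \<ge> 0\<close> it is what the integral of
  \<open>coth (R u)\<close> needs in order to make sense, the true value of \<open>coth\<close> at \<open>0\<close> being
  \<open>\<infinity>\<close>.\<close>

definition hyperbolic_bessel_process ::
    "'a measure \<Rightarrow> (real \<Rightarrow> 'a measure) \<Rightarrow> (real \<Rightarrow> 'a \<Rightarrow> real) \<Rightarrow>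
     real \<Rightarrow> real \<Rightarrow> (real \<Rightarrow> 'a \<Rightarrow> real) \<Rightarrow> bool" where
  "hyperbolic_bessel_process M F B \<alpha> x R \<longleftrightarrow>
     usual_conditions M F \<and> brownian_motion_wrt M F B \<and> \<alpha> \<ge> - 1 / 2 \<and> x \<ge> 0 \<and>
     (\<forall>t\<ge>0. R t \<in> borel_measurable (F t)) \<and>
     (AE \<omega> in M. continuous_on {0..} (\<lambda>t. R t \<omega>) \<and> (\<forall>t\<ge>0. R t \<omega> \<ge> 0)) \<and>
     (if \<alpha> = - 1 / 2 then (AE \<omega> in M. \<forall>t\<ge>0. R t \<omega> = \<bar>x + B t \<omega>\<bar>)
      else (AE \<omega> in M.
              (AE u in lborel. u \<ge> 0 \<longrightarrow> R u \<omega> \<noteq> 0) \<and>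
              (\<forall>t\<ge>0. set_integrable lborel {0..t} (\<lambda>u. coth (R u \<omega>)) \<and>
                R t \<omega> = x + B t \<omega> + (\<alpha> + 1 / 2) * (LBINT u:{0..t}. coth (R u \<omega>)))))"

definition exp_functional :: "(real \<Rightarrow> 'a \<Rightarrow> real) \<Rightarrow> real \<Rightarrow> real \<Rightarrow> 'a \<Rightarrow> real" where
  "exp_functional B \<mu> s \<omega> = (LBINT u:{0..s}. exp (2 * (B u \<omega> + \<mu> * u)))"

end

theory Submission
  imports Defs
begin

text \<open>
  Put \<open>Z = cosh R - 1\<close>, \<open>X r = 2 W (r/4) + (\<alpha> + 1/2) r\<close> and \<open>a r = \<integral> exp (X u) du\<close> over
  \<open>0 \<le> u \<le> r\<close>. By Brownian scaling \<open>a t\<close> is four times the exponential functional at time \<open>t/4\<close>,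
  and by the Gamma integral the density in (a) is that of \<open>1 + a t \<cdot> \<gamma>\<close>, where \<open>\<gamma>\<close> has the Gamma law of
  parameter \<open>\<alpha> + 1\<close> and is independent of \<open>a t\<close>. The Laplace transform of \<open>a t \<cdot> \<gamma>\<close> is
  \<open>E (1 + l a t) powr - (\<alpha> + 1)\<close>, so (a) says that
  \<open>E exp (- l Z t) = E (1 + l a t) powr - (\<alpha> + 1)\<close> for all \<open>l > 0\<close>, by
  \<open>laplace_transform_unique\<close>; (b) is (a) after a change of variables, \<open>distributed_of_cosh\<close>.

  The identity is a duality between two diffusions. The generator of \<open>Z\<close> is
  \<open>z (z + 2) \<partial>\<^sup>2 / 2 + (\<alpha> + 1) (z + 1) \<partial>\<close>. Let \<open>\<Lambda> r = l exp (X r) / (1 + l a r)\<close> and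
  \<open>K r = (1 + l a r) powr - (\<alpha> + 1)\<close>. Since \<open>ln (1 + l a)\<close> is the time integral of \<open>\<Lambda>\<close>, the process \<open>\<Lambda>\<close>
  is a stochastic logistic diffusion started at \<open>l\<close>, and \<open>K\<close> describes killing it at rate
  \<open>(\<alpha> + 1) \<Lambda>\<close>. The generator with killing is
  \<open>x\<^sup>2 \<partial>\<^sup>2 / 2 + ((\<alpha> + 1) x - x\<^sup>2) \<partial> - (\<alpha> + 1) x\<close>. Applied to \<open>exp (- x z)\<close>, as a
  function of \<open>z\<close> and of \<open>x\<close> respectively, the two generators give the same function
  \<open>laplace_generator \<alpha> z x\<close>. So for independent copies \<open>G s r = E (K r exp (- \<Lambda> r Z s))\<close>
  has equal derivatives in \<open>s\<close> and in \<open>r\<close>, and is constant on \<open>s + r = t\<close>. As \<open>\<Lambda> 0 = l\<close>, \<open>K 0 = 1\<close>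
  and \<open>Z 0 = 0\<close>, its values at \<open>(t, 0)\<close> and \<open>(0, t)\<close> are the two sides of the identity. This is
  \<open>laplace_duality\<close>.

  The two evolution equations, \<open>bessel_laplace_equation\<close> and
  \<open>exponential_functional_equation\<close>, are instances of one Dynkin formula, \<open>dynkin\<close>. It applies
  because both \<open>R\<close>, for \<open>\<alpha> > - 1/2\<close>, and \<open>ln \<Lambda>\<close> are a Brownian motion with drift plus or minus an increasing absolutely
  continuous process: the integral of \<open>(\<alpha> + 1/2) coth R\<close> in one case, \<open>ln (1 + l a)\<close> in the other.
  For such processes the formula is elementary: telescope over a partition, treat the increasing
  process path by path, and treat the Brownian increments by a Taylor expansion under the expectation.
\<close>

section \<open>Sums over partitions and integrals along paths\<close>

lemma set_integral_singleton:
  fixes f :: "real \<Rightarrow> real"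
  shows "(LBINT u:{c}. f u) = 0"
proof -
  have "AE u in lborel. u \<noteq> c" by (rule AE_lborel_singleton)
  thus ?thesis unfolding set_lebesgue_integral_def
    by (intro integral_eq_zero_AE) (auto elim!: eventually_mono)
qed

lemma set_integral_Icc_split:
  fixes f :: "real \<Rightarrow> real"
  assumes "set_integrable lborel {a..b} f" "a \<le> c" "c \<le> b"
  shows "(LBINT u:{a..b}. f u) = (LBINT u:{a..c}. f u) + (LBINT u:{c..b}. f u)"
proof -
  have *: "{a..b} = {a..c} \<union> {c..b}" using assms by auto
  have "AE u in lborel. u \<noteq> c" by (rule AE_lborel_singleton)
  hence "AE u in lborel. \<not> (u \<in> {a..c} \<and> u \<in> {c..b})" by eventually_elim auto
  thus ?thesis unfolding *
    by (intro set_integral_Un_AE) (use assms in \<open>auto intro!: set_integrable_subset[OF assms(1)]\<close>)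
qed

text \<open>The partition with index \<open>n\<close> has \<open>n + 1\<close> steps, so that \<open>n = 0\<close> is not an exception.\<close>

definition grid :: "real \<Rightarrow> nat \<Rightarrow> nat \<Rightarrow> real" where
  "grid t n i = t * real i / real (Suc n)"

lemma grid_0 [simp]: "grid t n 0 = 0"
  by (simp add: grid_def)

lemma grid_last [simp]: "grid t n (Suc n) = t"
proof -
  have "real (Suc n) \<noteq> 0" by simp
  thus ?thesis unfolding grid_def by (rule nonzero_mult_div_cancel_right)
qed

lemma grid_step: "grid t n (Suc i) - grid t n i = t / real (Suc n)"
  unfolding grid_def diff_divide_distrib[symmetric] right_diff_distrib[symmetric] by simp

lemma grid_mono: "t \<ge> 0 \<Longrightarrow> i \<le> j \<Longrightarrow> grid t n i \<le> grid t n j"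
  by (simp add: grid_def divide_right_mono mult_left_mono)

lemma grid_nonneg: "t \<ge> 0 \<Longrightarrow> grid t n i \<ge> 0"
  by (simp add: grid_def)

lemma grid_le: "t \<ge> 0 \<Longrightarrow> i \<le> Suc n \<Longrightarrow> grid t n i \<le> t"
  using grid_mono[of t i "Suc n" n] by simp

lemma grid_step_tendsto: "(\<lambda>n. t / real (Suc n)) \<longlonglongrightarrow> 0"
  using tendsto_mult_right_zero[OF lim_inverse_n', of t]
  by (subst filterlim_sequentially_Suc) (simp add: divide_inverse)

lemma sum_set_integral_grid:
  fixes f :: "real \<Rightarrow> real"
  assumes f: "set_integrable lborel {0..t} f" and t: "t \<ge> 0"
  shows "(\<Sum>i\<le>n. LBINT u:{grid t n i..grid t n (Suc i)}. f u) = (LBINT u:{0..t}. f u)"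
proof -
  have "k \<le> Suc n \<Longrightarrow> (\<Sum>i<k. LBINT u:{grid t n i..grid t n (Suc i)}. f u) = (LBINT u:{0..grid t n k}. f u)" for k
  proof (induction k)
    case 0
    show ?case by (simp add: set_integral_singleton)
  next
    case (Suc k)
    have "(LBINT u:{0..grid t n (Suc k)}. f u) = (LBINT u:{0..grid t n k}. f u) + (LBINT u:{grid t n k..grid t n (Suc k)}. f u)"
      using Suc.prems t grid_le[of t "Suc k" n]
      by (intro set_integral_Icc_split set_integrable_subset[OF f]) (auto intro: grid_nonneg grid_mono)
    with Suc show ?case by simp
  qed
  from this[of "Suc n"] show ?thesis by (simp add: lessThan_Suc_atMost)
qed

text \<open>The error of a step is measured by an increment of \<open>m\<close>, so the errors telescope to
at most \<open>e (m t - m 0)\<close>. Below \<open>m\<close> is the identity or the increasing process.\<close>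

lemma step_approx_tendsto:
  fixes f m :: "real \<Rightarrow> real" and D :: "nat \<Rightarrow> nat \<Rightarrow> real"
  assumes f: "set_integrable lborel {0..t} f" and t: "t \<ge> 0"
    and D: "\<And>e. e > 0 \<Longrightarrow> \<forall>\<^sub>F n in sequentially. \<forall>i\<le>n.
        \<bar>D n i - (LBINT u:{grid t n i..grid t n (Suc i)}. f u)\<bar> \<le> e * (m (grid t n (Suc i)) - m (grid t n i))"
  shows "(\<lambda>n. \<Sum>i\<le>n. D n i) \<longlonglongrightarrow> (LBINT u:{0..t}. f u)"
proof (rule tendstoI)
  fix e :: real assume e: "e > 0"
  define C where "C = \<bar>m t - m 0\<bar> + 1"
  have C: "C > 0" by (simp add: C_def)
  from D[of "e / C"] e C have "\<forall>\<^sub>F n in sequentially. \<forall>i\<le>n.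
        \<bar>D n i - (LBINT u:{grid t n i..grid t n (Suc i)}. f u)\<bar> \<le> e / C * (m (grid t n (Suc i)) - m (grid t n i))"
    by simp
  thus "\<forall>\<^sub>F n in sequentially. dist (\<Sum>i\<le>n. D n i) (LBINT u:{0..t}. f u) < e"
  proof eventually_elim
    case (elim n)
    have "dist (\<Sum>i\<le>n. D n i) (LBINT u:{0..t}. f u) = \<bar>\<Sum>i\<le>n. D n i - (LBINT u:{grid t n i..grid t n (Suc i)}. f u)\<bar>"
      by (simp add: dist_real_def sum_subtractf sum_set_integral_grid[OF f t])
    also have "\<dots> \<le> (\<Sum>i\<le>n. e / C * (m (grid t n (Suc i)) - m (grid t n i)))"
      by (rule order.trans[OF sum_abs]) (use elim in \<open>auto intro: sum_mono\<close>)
    also have "\<dots> = e / C * (m t - m 0)"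
      using sum_lessThan_telescope[of "\<lambda>i. m (grid t n i)" "Suc n"]
      by (simp add: sum_distrib_left[symmetric] lessThan_Suc_atMost del: times_divide_eq_left)
    also have "\<dots> < e / C * C"
      by (rule mult_strict_left_mono) (use e C in \<open>auto simp: C_def\<close>)
    finally show ?case using C by simp
  qed
qed

lemma set_integral_abs_le_const_mult:
  fixes f b :: "real \<Rightarrow> real"
  assumes f: "set_integrable lborel A f" and b: "set_integrable lborel A b" and A: "A \<in> sets lborel"
    and le: "\<And>u. u \<in> A \<Longrightarrow> \<bar>f u\<bar> \<le> e * b u"
  shows "\<bar>LBINT u:A. f u\<bar> \<le> e * (LBINT u:A. b u)"
proof -
  have "\<bar>LBINT u:A. f u\<bar> \<le> (LBINT u:A. \<bar>f u\<bar>)"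
    using set_integral_norm_bound[OF f] by simp
  also have "\<dots> \<le> (LBINT u:A. e * b u)"
    by (rule set_integral_mono) (use f b le in \<open>auto intro: set_integrable_abs\<close>)
  finally show ?thesis by simp
qed

lemma uniform_grid_modulus:
  fixes X :: "real \<Rightarrow> real"
  assumes X: "continuous_on {0..t} X" and t: "t \<ge> 0" and d: "d > 0"
  shows "\<forall>\<^sub>F n in sequentially. \<forall>i\<le>n. \<forall>u\<in>{grid t n i..grid t n (Suc i)}. \<forall>w\<in>{grid t n i..grid t n (Suc i)}. \<bar>X u - X w\<bar> < d"
proof -
  have "uniformly_continuous_on {0..t} X"
    by (rule compact_uniformly_continuous[OF X]) simp
  then obtain r where r: "r > 0" "\<And>u w. u \<in> {0..t} \<Longrightarrow> w \<in> {0..t} \<Longrightarrow> \<bar>u - w\<bar> < r \<Longrightarrow> \<bar>X u - X w\<bar> < d"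
    unfolding uniformly_continuous_on_def dist_real_def using d by (metis abs_minus_commute)
  have "\<forall>\<^sub>F n in sequentially. t / real (Suc n) < r"
    using order_tendstoD(2)[OF grid_step_tendsto r(1)] by auto
  thus ?thesis
  proof eventually_elim
    case (elim n)
    show ?case
    proof (intro allI impI ballI)
      fix i u w assume i: "i \<le> n" and u: "u \<in> {grid t n i..grid t n (Suc i)}" and w: "w \<in> {grid t n i..grid t n (Suc i)}"
      have "grid t n i \<ge> 0" "grid t n (Suc i) \<le> t" using t i by (auto intro: grid_nonneg grid_le)
      moreover have "\<bar>u - w\<bar> < r" using u w elim grid_step[of t n i] by auto
      ultimately show "\<bar>X u - X w\<bar> < d" using u w by (intro r(2)) auto
    qed
  qed
qed

lemma riemann_sum_tendsto:
  fixes g :: "real \<Rightarrow> real"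
  assumes g: "continuous_on {0..t} g" and t: "t \<ge> 0"
  shows "(\<lambda>n. \<Sum>i\<le>n. g (grid t n i) * (t / real (Suc n))) \<longlonglongrightarrow> (LBINT u:{0..t}. g u)"
proof (rule step_approx_tendsto[where m = "\<lambda>x. x"])
  show int: "set_integrable lborel {0..t} g" by (rule borel_integrable_atLeastAtMost'[OF g])
  fix e :: real assume e: "e > 0"
  from uniform_grid_modulus[OF g t e]
  show "\<forall>\<^sub>F n in sequentially. \<forall>i\<le>n. \<bar>g (grid t n i) * (t / real (Suc n)) - (LBINT u:{grid t n i..grid t n (Suc i)}. g u)\<bar>
          \<le> e * (grid t n (Suc i) - grid t n i)"
  proof eventually_elim
    case (elim n)
    show ?case
    proof (intro allI impI)
      fix i assume i: "i \<le> n"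
      let ?A = "{grid t n i..grid t n (Suc i)}"
      have le: "grid t n i \<le> grid t n (Suc i)" using t by (intro grid_mono) auto
      have A: "set_integrable lborel ?A g"
        by (rule set_integrable_subset[OF int]) (use grid_le[OF t, of "Suc i" n] grid_nonneg[OF t, of n i] i in auto)
      have c: "set_integrable lborel ?A (\<lambda>_. c)" for c :: real
        by (rule borel_integrable_atLeastAtMost') auto
      have ic: "(LBINT u:?A. c) = c * (grid t n (Suc i) - grid t n i)" for c :: real
        using le by (simp add: set_lebesgue_integral_def)
      have "g (grid t n i) * (t / real (Suc n)) - (LBINT u:?A. g u) = (LBINT u:?A. g (grid t n i) - g u)"
        using A c by (simp add: ic grid_step)
      also have "\<bar>\<dots>\<bar> \<le> e * (LBINT u:?A. 1)"
        by (rule set_integral_abs_le_const_mult) (use A c elim[rule_format, OF i, of "grid t n i"] le in \<open>auto intro: less_imp_le\<close>)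
      finally show "\<bar>g (grid t n i) * (t / real (Suc n)) - (LBINT u:?A. g u)\<bar> \<le> e * (grid t n (Suc i) - grid t n i)"
        by (simp add: ic)
    qed
  qed
qed (rule t)


text \<open>A chain rule along \<open>V\<close> in which the second argument \<open>X\<close> is merely continuous and is
evaluated at the end of the step. As \<open>V\<close> is given only as an integral, derivatives are taken of \<open>\<Psi>\<close>
alone: on each step the mean value theorem is applied to \<open>\<Psi>\<close> in \<open>v\<close>, the increment of \<open>V\<close> is written as the
integral of \<open>b\<close>, and uniform continuity of \<open>\<Psi>'\<close> on a compact set bounds the error of the
step by \<open>e\<close> times the increment of \<open>V\<close>.\<close>

lemma fv_sum_tendsto:
  fixes V X b :: "real \<Rightarrow> real" and \<Psi> \<Psi>' :: "real \<Rightarrow> real \<Rightarrow> real"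
  assumes t: "t \<ge> 0" and b: "set_integrable lborel {0..t} b" and b0: "\<And>u. u \<in> {0..t} \<Longrightarrow> b u \<ge> 0"
    and V: "\<And>s. s \<in> {0..t} \<Longrightarrow> V s = (LBINT u:{0..s}. b u)"
    and contV: "continuous_on {0..t} V" and contX: "continuous_on {0..t} X"
    and deriv: "\<And>v x. ((\<lambda>v. \<Psi> v x) has_real_derivative \<Psi>' v x) (at v)"
    and cont: "continuous_on UNIV (\<lambda>p. \<Psi>' (fst p) (snd p))"
  shows "(\<lambda>n. \<Sum>i\<le>n. \<Psi> (V (grid t n (Suc i))) (X (grid t n (Suc i))) - \<Psi> (V (grid t n i)) (X (grid t n (Suc i))))
            \<longlonglongrightarrow> (LBINT u:{0..t}. \<Psi>' (V u) (X u) * b u)"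
    and "set_integrable lborel {0..t} (\<lambda>u. \<Psi>' (V u) (X u) * b u)"
proof -
  have Vdiff: "V d - V c = (LBINT u:{c..d}. b u)" if "0 \<le> c" "c \<le> d" "d \<le> t" for c d
  proof -
    have "(LBINT u:{0..d}. b u) = (LBINT u:{0..c}. b u) + (LBINT u:{c..d}. b u)"
      by (rule set_integral_Icc_split) (use that in \<open>auto intro!: set_integrable_subset[OF b]\<close>)
    thus ?thesis using that by (simp add: V)
  qed
  have Vmono: "V c \<le> V d" if "0 \<le> c" "c \<le> d" "d \<le> t" for c d
  proof -
    have "0 \<le> (LBINT u:{c..d}. b u)"
      unfolding set_lebesgue_integral_def
      by (rule integral_nonneg_AE) (use that b0 in \<open>auto simp: indicator_def\<close>)
    thus ?thesis using Vdiff[OF that] by simp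
  qed
  define K where "K = V ` {0..t} \<times> X ` {0..t}"
  have K: "compact K" unfolding K_def
    by (intro compact_Times compact_continuous_image contV contX) auto
  have contK: "continuous_on K (\<lambda>p. \<Psi>' (fst p) (snd p))"
    by (rule continuous_on_subset[OF cont]) simp
  have contg: "continuous_on {0..t} (\<lambda>u. \<Psi>' (V u) (X u))"
    using continuous_on_compose2[OF cont, of "{0..t}" "\<lambda>u. (V u, X u)"] contV contX
    by (auto intro: continuous_on_Pair)
  have "bounded ((\<lambda>u. \<Psi>' (V u) (X u)) ` {0..t})"
    by (rule compact_imp_bounded, rule compact_continuous_image[OF contg]) simp
  then obtain C where C: "\<And>u. u \<in> {0..t} \<Longrightarrow> \<bar>\<Psi>' (V u) (X u)\<bar> \<le> C"
    unfolding bounded_iff by (metis imageI real_norm_def)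
  have meas: "set_borel_measurable lborel {0..t} (\<lambda>u. \<Psi>' (V u) (X u))"
    using borel_integrable_atLeastAtMost'[OF contg] unfolding set_integrable_def set_borel_measurable_def by auto
  show int: "set_integrable lborel {0..t} (\<lambda>u. \<Psi>' (V u) (X u) * b u)"
  proof -
    have "integrable lborel (\<lambda>u. (indicator {0..t} u * \<Psi>' (V u) (X u)) * (indicator {0..t} u * b u))"
    proof (rule Bochner_Integration.integrable_bound[where f = "\<lambda>u. C * (indicator {0..t} u * b u)"])
      show "integrable lborel (\<lambda>u. C * (indicator {0..t} u * b u))"
        using b by (auto simp: set_integrable_def)
      show "(\<lambda>u. indicator {0..t} u * \<Psi>' (V u) (X u) * (indicator {0..t} u * b u)) \<in> borel_measurable lborel"
        using meas b unfolding set_integrable_def set_borel_measurable_def by auto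
      show "AE u in lborel. norm (indicator {0..t} u * \<Psi>' (V u) (X u) * (indicator {0..t} u * b u)) \<le> norm (C * (indicator {0..t} u * b u))"
      proof (rule AE_I2)
        fix u :: real
        show "norm (indicator {0..t} u * \<Psi>' (V u) (X u) * (indicator {0..t} u * b u)) \<le> norm (C * (indicator {0..t} u * b u))"
          using C[of u] by (auto simp: indicator_def abs_mult intro!: mult_right_mono)
      qed
    qed
    also have "(\<lambda>u. (indicator {0..t} u * \<Psi>' (V u) (X u)) * (indicator {0..t} u * b u)) = (\<lambda>u. indicator {0..t} u *\<^sub>R (\<Psi>' (V u) (X u) * b u))"
      by (auto simp: indicator_def)
    finally show ?thesis by (simp add: set_integrable_def)
  qed
  show "(\<lambda>n. \<Sum>i\<le>n. \<Psi> (V (grid t n (Suc i))) (X (grid t n (Suc i))) - \<Psi> (V (grid t n i)) (X (grid t n (Suc i))))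
            \<longlonglongrightarrow> (LBINT u:{0..t}. \<Psi>' (V u) (X u) * b u)"
  proof (rule step_approx_tendsto[where m = V, OF int])
    fix e :: real assume e: "e > 0"
    obtain d where d: "d > 0" "\<And>p q. p \<in> K \<Longrightarrow> q \<in> K \<Longrightarrow> dist p q < d \<Longrightarrow> \<bar>\<Psi>' (fst p) (snd p) - \<Psi>' (fst q) (snd q)\<bar> < e"
      using compact_uniformly_continuous[OF contK K] e
      unfolding uniformly_continuous_on_def dist_real_def by (metis dist_commute)
    have "d / 2 > 0" using d by simp
    from uniform_grid_modulus[OF contV t this] uniform_grid_modulus[OF contX t this]
    show "\<forall>\<^sub>F n in sequentially. \<forall>i\<le>n. \<bar>\<Psi> (V (grid t n (Suc i))) (X (grid t n (Suc i))) - \<Psi> (V (grid t n i)) (X (grid t n (Suc i)))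
           - (LBINT u:{grid t n i..grid t n (Suc i)}. \<Psi>' (V u) (X u) * b u)\<bar> \<le> e * (V (grid t n (Suc i)) - V (grid t n i))"
    proof eventually_elim
      case (elim n)
      show ?case
      proof (intro allI impI)
        fix i assume i: "i \<le> n"
        let ?c = "grid t n i" and ?d = "grid t n (Suc i)"
        let ?A = "{?c..?d}"
        have cd: "0 \<le> ?c" "?c \<le> ?d" "?d \<le> t"
          using grid_nonneg[OF t] grid_mono[OF t, of i "Suc i"] grid_le[OF t, of "Suc i"] i by auto
        have sub: "?A \<subseteq> {0..t}" using cd by auto
        (* the mean value is attained at a time of the step, because V is continuous *)
        obtain w where w: "w \<in> ?A" "\<Psi> (V ?d) (X ?d) - \<Psi> (V ?c) (X ?d) = \<Psi>' (V w) (X ?d) * (V ?d - V ?c)"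
        proof (cases "V ?c = V ?d")
          case True
          thus ?thesis using cd by (intro that[of ?c]) auto
        next
          case False
          hence lt: "V ?c < V ?d" using Vmono[OF cd] by simp
          obtain z where z: "V ?c < z" "z < V ?d" "\<Psi> (V ?d) (X ?d) - \<Psi> (V ?c) (X ?d) = (V ?d - V ?c) * \<Psi>' z (X ?d)"
            using MVT2[OF lt, of "\<lambda>v. \<Psi> v (X ?d)" "\<lambda>v. \<Psi>' v (X ?d)"] deriv by blast
          obtain w where "?c \<le> w" "w \<le> ?d" "V w = z"
            using IVT'[of V ?c z ?d] z cd continuous_on_subset[OF contV sub] by auto
          thus ?thesis using z by (intro that[of w]) (auto simp: mult.commute)
        qed
        have intA: "set_integrable lborel ?A (\<lambda>u. \<Psi>' (V u) (X u) * b u)" "set_integrable lborel ?A b"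
          using sub by (auto intro!: set_integrable_subset[OF int] set_integrable_subset[OF b])
        have "\<Psi> (V ?d) (X ?d) - \<Psi> (V ?c) (X ?d) - (LBINT u:?A. \<Psi>' (V u) (X u) * b u)
                = (LBINT u:?A. \<Psi>' (V w) (X ?d) * b u - \<Psi>' (V u) (X u) * b u)"
          using intA by (simp add: w(2) Vdiff[OF cd])
        also have "\<bar>\<dots>\<bar> \<le> e * (LBINT u:?A. b u)"
        proof (rule set_integral_abs_le_const_mult)
          fix u assume u: "u \<in> ?A"
          have "dist (V w, X ?d) (V u, X u) \<le> \<bar>V w - V u\<bar> + \<bar>X ?d - X u\<bar>"
            using sqrt_sum_squares_le_sum_abs[of "V w - V u" "X ?d - X u"] by (simp add: dist_Pair_Pair dist_real_def)
          also have "\<dots> < d / 2 + d / 2"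
            by (intro add_strict_mono) (use elim i u w cd in auto)
          finally have "\<bar>\<Psi>' (V w) (X ?d) - \<Psi>' (V u) (X u)\<bar> < e"
            using d(2)[of "(V w, X ?d)" "(V u, X u)"] sub u w cd by (auto simp: K_def)
          hence "\<bar>\<Psi>' (V w) (X ?d) - \<Psi>' (V u) (X u)\<bar> * b u \<le> e * b u"
            using b0[of u] u sub by (intro mult_right_mono) auto
          thus "\<bar>\<Psi>' (V w) (X ?d) * b u - \<Psi>' (V u) (X u) * b u\<bar> \<le> e * b u"
            using b0[of u] u sub by (simp add: left_diff_distrib[symmetric] abs_mult)
        qed (use intA in auto)
        finally show "\<bar>\<Psi> (V ?d) (X ?d) - \<Psi> (V ?c) (X ?d) - (LBINT u:?A. \<Psi>' (V u) (X u) * b u)\<bar> \<le> e * (V ?d - V ?c)"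
          by (simp add: Vdiff[OF cd])
      qed
    qed
  qed (rule t)
qed

section \<open>A Dynkin formula for Brownian motion plus an increasing process\<close>

lemma taylor2_bound:
  fixes h h1 h2 h3 :: "real \<Rightarrow> real"
  assumes d: "\<And>x. (h has_real_derivative h1 x) (at x)" "\<And>x. (h1 has_real_derivative h2 x) (at x)"
      "\<And>x. (h2 has_real_derivative h3 x) (at x)"
    and C: "\<And>x. \<bar>h3 x\<bar> \<le> C"
  shows "\<bar>h (y + z) - h y - h1 y * z - h2 y * z\<^sup>2 / 2\<bar> \<le> C * \<bar>z\<bar> ^ 3"
proof (cases "z = 0")
  case False
  define D where "D m = (if m = 0 then h else if m = 1 then h1 else if m = 2 then h2 else h3)" for m :: nat
  have DD: "DERIV (D m) x :> D (Suc m) x" if "m < 3" for m x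
    using d[of x] that by (cases "m = 0"; cases "m = 1"; cases "m = 2") (auto simp: D_def)
  have "\<exists>t. (if y + z < y then y + z < t \<and> t < y else y < t \<and> t < y + z) \<and>
     h (y + z) = (\<Sum>m<3. D m y / fact m * (y + z - y) ^ m) + D 3 t / fact 3 * (y + z - y) ^ 3"
    by (rule Taylor[where a = "min y (y + z)" and b = "max y (y + z)"]) (use DD False in \<open>auto simp: D_def\<close>)
  then obtain t where "h (y + z) = (\<Sum>m<3. D m y / fact m * (y + z - y) ^ m) + D 3 t / fact 3 * (y + z - y) ^ 3"
    by blast
  hence "h (y + z) - h y - h1 y * z - h2 y * z\<^sup>2 / 2 = h3 t / 6 * z ^ 3"
    by (simp add: D_def eval_nat_numeral fact_numeral)
  also have "\<bar>\<dots>\<bar> \<le> C * \<bar>z\<bar> ^ 3"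
    unfolding abs_mult power_abs using C[of t] by (intro mult_right_mono) auto
  finally show ?thesis .
qed simp

lemma abs_add_cube_le: "\<bar>a + b\<bar> ^ 3 \<le> 4 * (\<bar>a\<bar> ^ 3 + \<bar>b\<bar> ^ 3)" for a b :: real
proof -
  have "\<bar>a + b\<bar> ^ 3 \<le> (\<bar>a\<bar> + \<bar>b\<bar>) ^ 3" by (intro power_mono) auto
  moreover have "4 * (p ^ 3 + q ^ 3) - (p + q) ^ 3 = 3 * (p + q) * (p - q)\<^sup>2" for p q :: real
    by (simp add: power2_eq_square power3_eq_cube algebra_simps)
  moreover have "3 * (\<bar>a\<bar> + \<bar>b\<bar>) * (\<bar>a\<bar> - \<bar>b\<bar>)\<^sup>2 \<ge> 0" by (intro mult_nonneg_nonneg) auto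
  ultimately have "(\<bar>a\<bar> + \<bar>b\<bar>) ^ 3 \<le> 4 * (\<bar>a\<bar> ^ 3 + \<bar>b\<bar> ^ 3)" by (metis diff_ge_0_iff_ge)
  with \<open>\<bar>a + b\<bar> ^ 3 \<le> (\<bar>a\<bar> + \<bar>b\<bar>) ^ 3\<close> show ?thesis by (rule order_trans)
qed

text \<open>Independence of Brownian increments is recorded only by its consequences for first and
second moments, tested against bounded continuous functions of \<open>(V s, B s)\<close>. In this form it is
stable under limits and under changes on null sets, so it can be verified both for a process adapted to a
given filtration and for a functional of the Brownian path that is a limit of functions of finitely many
increments. All paths are required to be good, not only almost all; this keeps pathwise limits of measurable
functions measurable on spaces that are not complete.\<close>

locale brownian_with_increasing = prob_space M for M :: "'a measure" +
  fixes B V b :: "real \<Rightarrow> 'a \<Rightarrow> real" and c3 :: real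
  assumes B_meas [measurable]: "\<And>t. B t \<in> borel_measurable M"
    and V_meas [measurable]: "\<And>t. V t \<in> borel_measurable M"
    and B_cont: "\<And>w. w \<in> space M \<Longrightarrow> continuous_on UNIV (\<lambda>t. B t w)"
    and V_cont: "\<And>w. w \<in> space M \<Longrightarrow> continuous_on UNIV (\<lambda>t. V t w)"
    and b_int: "\<And>w t. w \<in> space M \<Longrightarrow> t \<ge> 0 \<Longrightarrow> set_integrable lborel {0..t} (\<lambda>u. b u w)"
    and b_nonneg: "\<And>w u. w \<in> space M \<Longrightarrow> u \<ge> 0 \<Longrightarrow> b u w \<ge> 0"
    and V_eq: "\<And>w t. w \<in> space M \<Longrightarrow> t \<ge> 0 \<Longrightarrow> V t w = (LBINT u:{0..t}. b u w)"
    and incr3_int: "\<And>s t. 0 \<le> s \<Longrightarrow> s < t \<Longrightarrow> integrable M (\<lambda>w. \<bar>B t w - B s w\<bar> ^ 3)"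
    and incr3: "\<And>s t. 0 \<le> s \<Longrightarrow> s < t \<Longrightarrow> (\<integral>w. \<bar>B t w - B s w\<bar> ^ 3 \<partial>M) \<le> c3 * sqrt (t - s) ^ 3"
    and incr1: "\<And>s t g. 0 \<le> s \<Longrightarrow> s < t \<Longrightarrow> continuous_on UNIV g \<Longrightarrow> bounded (range g) \<Longrightarrow>
        (\<integral>w. g (V s w, B s w) * (B t w - B s w) \<partial>M) = 0"
    and incr2: "\<And>s t g. 0 \<le> s \<Longrightarrow> s < t \<Longrightarrow> continuous_on UNIV g \<Longrightarrow> bounded (range g) \<Longrightarrow>
        (\<integral>w. g (V s w, B s w) * (B t w - B s w)\<^sup>2 \<partial>M) = (t - s) * (\<integral>w. g (V s w, B s w) \<partial>M)"
begin

lemma V_mono: "w \<in> space M \<Longrightarrow> 0 \<le> s \<Longrightarrow> s \<le> t \<Longrightarrow> V s w \<le> V t w"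
proof -
  assume *: "w \<in> space M" "0 \<le> s" "s \<le> t"
  have "(LBINT u:{0..t}. b u w) = (LBINT u:{0..s}. b u w) + (LBINT u:{s..t}. b u w)"
    by (rule set_integral_Icc_split[OF b_int]) (use * in auto)
  moreover have "0 \<le> (LBINT u:{s..t}. b u w)"
    unfolding set_lebesgue_integral_def
    by (rule integral_nonneg_AE) (use * b_nonneg[OF *(1)] in \<open>auto simp: indicator_def\<close>)
  moreover have "V s w = (LBINT u:{0..s}. b u w)" "V t w = (LBINT u:{0..t}. b u w)"
    using * by (intro V_eq; simp)+
  ultimately show ?thesis by linarith
qed

lemma V_0: "w \<in> space M \<Longrightarrow> V 0 w = 0"
  using V_eq[of w 0] by (simp add: set_integral_singleton)

lemma V_nonneg: "w \<in> space M \<Longrightarrow> 0 \<le> t \<Longrightarrow> 0 \<le> V t w"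
  using V_mono[of w 0 t] V_0[of w] by simp

text \<open>The chain rule for \<open>exp (- \<epsilon> V)\<close>. It bounds the integral of \<open>exp (- \<epsilon> V) b\<close> by
\<open>1 / \<epsilon>\<close>, uniformly in the path, whereas the integral \<open>V t\<close> of \<open>b\<close> may have infinite expectation.\<close>

lemma integral_exp_V:
  assumes w: "w \<in> space M" and t: "t \<ge> 0"
  shows "set_integrable lborel {0..t} (\<lambda>u. \<epsilon> * exp (- \<epsilon> * V u w) * b u w)"
    and "(LBINT u:{0..t}. \<epsilon> * exp (- \<epsilon> * V u w) * b u w) = 1 - exp (- \<epsilon> * V t w)"
proof -
  have bn: "b u w \<ge> 0" if "u \<in> {0..t}" for u using b_nonneg[OF w] that by simp
  have Ve: "V s w = (LBINT u:{0..s}. b u w)" if "s \<in> {0..t}" for s using V_eq[OF w] that by simp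
  have c: "continuous_on {0..t} (\<lambda>u. V u w)" by (rule continuous_on_subset[OF V_cont[OF w]]) simp
  have d: "((\<lambda>v. - exp (- \<epsilon> * v)) has_real_derivative \<epsilon> * exp (- \<epsilon> * v)) (at v)" for v
    by (rule derivative_eq_intros refl | simp)+
  have c': "continuous_on UNIV (\<lambda>p::real \<times> real. \<epsilon> * exp (- \<epsilon> * fst p))" by (intro continuous_intros)
  have c0: "continuous_on {0..t} (\<lambda>_. 0::real)" by simp
  note * = fv_sum_tendsto[of t "\<lambda>u. b u w" "\<lambda>u. V u w" "\<lambda>_. 0" "\<lambda>v x. - exp (- \<epsilon> * v)" "\<lambda>v x. \<epsilon> * exp (- \<epsilon> * v)",
      OF t b_int[OF w t] bn Ve c c0 d c']
  show "set_integrable lborel {0..t} (\<lambda>u. \<epsilon> * exp (- \<epsilon> * V u w) * b u w)" using *(2) by auto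
  have "(\<Sum>i\<le>n. - exp (- \<epsilon> * V (grid t n (Suc i)) w) - - exp (- \<epsilon> * V (grid t n i) w)) = 1 - exp (- \<epsilon> * V t w)" for n
    using sum_lessThan_telescope[of "\<lambda>i. - exp (- \<epsilon> * V (grid t n i) w)" "Suc n"] V_0[OF w]
    unfolding lessThan_Suc_atMost by simp
  hence "(\<lambda>n::nat. 1 - exp (- \<epsilon> * V t w)) \<longlonglongrightarrow> (LBINT u:{0..t}. \<epsilon> * exp (- \<epsilon> * V u w) * b u w)"
    using *(1) by simp
  thus "(LBINT u:{0..t}. \<epsilon> * exp (- \<epsilon> * V u w) * b u w) = 1 - exp (- \<epsilon> * V t w)"
    using LIMSEQ_unique[OF tendsto_const] by fastforce
qed

lemma integrable_incr_power:
  assumes "0 \<le> s" "s < t" "k \<le> 3"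
  shows "integrable M (\<lambda>w. (B t w - B s w) ^ k)"
proof (rule Bochner_Integration.integrable_bound)
  show "integrable M (\<lambda>w. 1 + \<bar>B t w - B s w\<bar> ^ 3)"
    using incr3_int[OF assms(1,2)] by simp
  have "\<bar>x\<bar> ^ k \<le> 1 + \<bar>x\<bar> ^ 3" for x :: real
  proof (cases "\<bar>x\<bar> \<le> 1")
    case True
    thus ?thesis using power_le_one[of "\<bar>x\<bar>" k] by (simp add: add_increasing2)
  next
    case False
    hence "\<bar>x\<bar> ^ k \<le> \<bar>x\<bar> ^ 3" using assms(3) by (intro power_increasing) auto
    thus ?thesis by linarith
  qed
  thus "AE w in M. norm ((B t w - B s w) ^ k) \<le> norm (1 + \<bar>B t w - B s w\<bar> ^ 3)"
    by (auto simp: power_abs)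
qed measurable

lemma integrable_mult_incr:
  assumes "0 \<le> s" "s < t" "k \<le> 3" and [measurable]: "G \<in> borel_measurable M" and G: "\<And>w. w \<in> space M \<Longrightarrow> \<bar>G w\<bar> \<le> C"
  shows "integrable M (\<lambda>w. G w * (B t w - B s w) ^ k)"
proof (rule Bochner_Integration.integrable_bound)
  show "integrable M (\<lambda>w. C * (B t w - B s w) ^ k)"
    using integrable_incr_power[OF assms(1-3)] by simp
  show "AE w in M. norm (G w * (B t w - B s w) ^ k) \<le> norm (C * (B t w - B s w) ^ k)"
    using order_trans[OF G abs_ge_self] by (auto simp: abs_mult intro!: mult_right_mono)
qed measurable

context
  fixes h h1 h2 h3 :: "real \<Rightarrow> real" and C \<mu> \<sigma> \<epsilon> :: real
  assumes dh: "\<And>x. (h has_real_derivative h1 x) (at x)"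
    and dh1: "\<And>x. (h1 has_real_derivative h2 x) (at x)"
    and dh2: "\<And>x. (h2 has_real_derivative h3 x) (at x)"
    and bh: "\<And>x. \<bar>h x\<bar> \<le> C" and bh1: "\<And>x. \<bar>h1 x\<bar> \<le> C"
    and bh2: "\<And>x. \<bar>h2 x\<bar> \<le> C" and bh3: "\<And>x. \<bar>h3 x\<bar> \<le> C"
    and \<epsilon>: "\<epsilon> > 0"
begin

lemma C_nonneg: "0 \<le> C" using bh[of 0] by linarith

lemma cont_h: "continuous_on UNIV h" "continuous_on UNIV h1" "continuous_on UNIV h2"
  by (rule DERIV_continuous_on, rule has_field_derivative_at_within, rule dh dh1 dh2)+

lemma meas_h [measurable]: "h \<in> borel_measurable borel" "h1 \<in> borel_measurable borel" "h2 \<in> borel_measurable borel"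
  by (rule borel_measurable_continuous_onI, rule cont_h)+

text \<open>With \<open>V\<close> frozen at time \<open>s\<close> the step is a second order Taylor expansion in the Brownian increment,
whose coefficients are functions of \<open>(V s, B s)\<close>. The error is of order \<open>\<tau> powr (3/2)\<close>, which is
negligible after summation over \<open>t / \<tau>\<close> steps.\<close>

lemma one_step:
  assumes st: "0 \<le> s" "s < t"
  defines "\<tau> \<equiv> t - s"
  defines "Y \<equiv> \<lambda>w. B s w + \<mu> * s + \<sigma> * V s w"
  defines "K \<equiv> \<lambda>w. exp (- \<epsilon> * V s w)"
  shows "\<bar>(\<integral>w. K w * h (B t w + \<mu> * t + \<sigma> * V s w) \<partial>M) - (\<integral>w. K w * h (Y w) \<partial>M)
            - \<tau> * (\<integral>w. K w * (\<mu> * h1 (Y w) + h2 (Y w) / 2) \<partial>M)\<bar>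
        \<le> C * \<mu>\<^sup>2 * \<tau>\<^sup>2 + 4 * C * (c3 * sqrt \<tau> ^ 3 + \<bar>\<mu>\<bar> ^ 3 * \<tau> ^ 3)"
proof -
  have \<tau>: "\<tau> > 0" using st by (simp add: \<tau>_def)
  define \<Delta> where "\<Delta> w = B t w - B s w" for w
  have [measurable]: "\<Delta> \<in> borel_measurable M" "Y \<in> borel_measurable M" "K \<in> borel_measurable M"
    unfolding \<Delta>_def Y_def K_def by measurable
  have K01: "0 \<le> K w" "K w \<le> 1" if "w \<in> space M" for w
    using V_nonneg[OF that st(1)] \<epsilon> by (auto simp: K_def)
  have bK: "\<bar>K w * f (Y w)\<bar> \<le> C" if "w \<in> space M" "\<And>x. \<bar>f x\<bar> \<le> C" for w and f :: "real \<Rightarrow> real"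
    using mult_mono[OF K01(2)[OF that(1)] that(2)[of "Y w"]] K01[OF that(1)] by (simp add: abs_mult)
  have I: "integrable M (\<lambda>w. K w * f (Y w) * \<Delta> w ^ k)"
    if "k \<le> 3" "f \<in> borel_measurable borel" "\<And>x. \<bar>f x\<bar> \<le> C" for k and f :: "real \<Rightarrow> real"
    unfolding \<Delta>_def by (rule integrable_mult_incr[where C = C]) (use st that bK[OF _ that(3)] in auto)
  have moments: "(\<integral>w. K w * f (Y w) * \<Delta> w \<partial>M) = 0"
      "(\<integral>w. K w * f (Y w) * (\<Delta> w)\<^sup>2 \<partial>M) = \<tau> * (\<integral>w. K w * f (Y w) \<partial>M)"
    if f: "continuous_on UNIV f" "\<And>x. \<bar>f x\<bar> \<le> C" for f :: "real \<Rightarrow> real"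
  proof -
    define g where "g p = exp (- \<epsilon> * max 0 (fst p)) * f (snd p + \<mu> * s + \<sigma> * max 0 (fst p))" for p :: "real \<times> real"
    have "continuous_on UNIV g" unfolding g_def
      by (intro continuous_intros continuous_on_compose2[OF f(1)]) auto
    moreover have "bounded (range g)"
    proof (rule boundedI)
      fix y assume "y \<in> range g"
      then obtain p where y: "y = g p" by auto
      have "exp (- \<epsilon> * max 0 (fst p)) \<le> 1" using \<epsilon> by simp
      from mult_mono[OF this f(2)[of "snd p + \<mu> * s + \<sigma> * max 0 (fst p)"]]
      show "norm y \<le> C" by (simp add: y g_def abs_mult)
    qed
    ultimately have *: "(\<integral>w. g (V s w, B s w) * (B t w - B s w) \<partial>M) = 0"
      "(\<integral>w. g (V s w, B s w) * (B t w - B s w)\<^sup>2 \<partial>M) = (t - s) * (\<integral>w. g (V s w, B s w) \<partial>M)"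
      using incr1[OF st] incr2[OF st] by blast+
    have g: "g (V s w, B s w) = K w * f (Y w)" if "w \<in> space M" for w
      using V_nonneg[OF that st(1)] by (simp add: g_def K_def Y_def max_def)
    show "(\<integral>w. K w * f (Y w) * \<Delta> w \<partial>M) = 0"
      using *(1) by (simp add: g \<Delta>_def cong: Bochner_Integration.integral_cong)
    show "(\<integral>w. K w * f (Y w) * (\<Delta> w)\<^sup>2 \<partial>M) = \<tau> * (\<integral>w. K w * f (Y w) \<partial>M)"
      using *(2) by (simp add: g \<Delta>_def \<tau>_def cong: Bochner_Integration.integral_cong)
  qed
  note I0 = I[of 0, simplified] and I1 = I[of 1, simplified] and I2 = I[of 2, simplified]
  note m1 = moments[OF cont_h(2) bh1] and m2 = moments[OF cont_h(3) bh2]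
  have X: "B t w + \<mu> * t + \<sigma> * V s w = Y w + (\<Delta> w + \<mu> * \<tau>)" for w
    by (simp add: \<Delta>_def Y_def \<tau>_def algebra_simps)
  define L where "L w = K w * h (Y w) + \<tau> * (K w * (\<mu> * h1 (Y w) + h2 (Y w) / 2))" for w
  define Q where "Q w = K w * h1 (Y w) * \<Delta> w + (K w * h2 (Y w) * (\<Delta> w)\<^sup>2 - \<tau> * (K w * h2 (Y w))) / 2
      + \<mu> * \<tau> * (K w * h2 (Y w) * \<Delta> w) + (\<mu> * \<tau>)\<^sup>2 * (K w * h2 (Y w)) / 2" for w
  define R where "R w = K w * (h (Y w + (\<Delta> w + \<mu> * \<tau>)) - h (Y w) - h1 (Y w) * (\<Delta> w + \<mu> * \<tau>) - h2 (Y w) * (\<Delta> w + \<mu> * \<tau>)\<^sup>2 / 2)" for w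
  have split: "K w * h (B t w + \<mu> * t + \<sigma> * V s w) = L w + Q w + R w" for w
    unfolding X L_def Q_def R_def by (simp add: field_simps power2_eq_square)
  have iL: "integrable M (\<lambda>w. K w * (\<mu> * h1 (Y w) + h2 (Y w) / 2))"
  proof -
    have "integrable M (\<lambda>w. \<mu> * (K w * h1 (Y w)) + (K w * h2 (Y w)) / 2)"
      using I0[OF meas_h(2) bh1] I0[OF meas_h(3) bh2] by simp
    thus ?thesis by (simp add: algebra_simps)
  qed
  have LI: "integrable M L" unfolding L_def
    using I0[OF meas_h(1) bh] iL by simp
  have QI: "integrable M Q" unfolding Q_def
    using I0[OF meas_h(3) bh2] I1[OF meas_h(2) bh1] I1[OF meas_h(3) bh2] I2[OF meas_h(3) bh2] by simp
  have iD: "integrable M (\<lambda>w. \<bar>\<Delta> w\<bar> ^ 3)" using incr3_int[OF st] by (simp add: \<Delta>_def)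
  have Rb: "\<bar>R w\<bar> \<le> 4 * C * (\<bar>\<Delta> w\<bar> ^ 3 + \<bar>\<mu>\<bar> ^ 3 * \<tau> ^ 3)" if "w \<in> space M" for w
  proof -
    have "\<bar>R w\<bar> \<le> 1 * (C * \<bar>\<Delta> w + \<mu> * \<tau>\<bar> ^ 3)"
      unfolding R_def abs_mult by (intro mult_mono taylor2_bound[OF dh dh1 dh2 bh3]) (use K01[OF that] C_nonneg in auto)
    also have "\<dots> \<le> C * (4 * (\<bar>\<Delta> w\<bar> ^ 3 + \<bar>\<mu> * \<tau>\<bar> ^ 3))"
      using abs_add_cube_le C_nonneg by (simp add: mult_left_mono)
    finally show ?thesis using \<tau> by (simp add: abs_mult power_mult_distrib algebra_simps)
  qed
  have iRb: "integrable M (\<lambda>w. 4 * C * (\<bar>\<Delta> w\<bar> ^ 3 + \<bar>\<mu>\<bar> ^ 3 * \<tau> ^ 3))"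
    using iD by simp
  have [measurable]: "R \<in> borel_measurable M" unfolding R_def by measurable
  have RI: "integrable M R"
    by (rule Bochner_Integration.integrable_bound[OF iRb]) (use order_trans[OF Rb abs_ge_self] in auto)
  have "\<bar>\<integral>w. R w \<partial>M\<bar> \<le> (\<integral>w. \<bar>R w\<bar> \<partial>M)" by (rule integral_abs_bound)
  also have "\<dots> \<le> (\<integral>w. 4 * C * (\<bar>\<Delta> w\<bar> ^ 3 + \<bar>\<mu>\<bar> ^ 3 * \<tau> ^ 3) \<partial>M)"
    by (rule integral_mono) (use RI iRb Rb in auto)
  also have "\<dots> = 4 * C * ((\<integral>w. \<bar>\<Delta> w\<bar> ^ 3 \<partial>M) + \<bar>\<mu>\<bar> ^ 3 * \<tau> ^ 3)"
    using iD by (simp add: prob_space)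
  also have "\<dots> \<le> 4 * C * (c3 * sqrt \<tau> ^ 3 + \<bar>\<mu>\<bar> ^ 3 * \<tau> ^ 3)"
    using incr3[OF st] C_nonneg by (intro mult_left_mono) (auto simp: \<Delta>_def \<tau>_def)
  finally have R': "\<bar>\<integral>w. R w \<partial>M\<bar> \<le> 4 * C * (c3 * sqrt \<tau> ^ 3 + \<bar>\<mu>\<bar> ^ 3 * \<tau> ^ 3)" .
  have "(\<integral>w. Q w \<partial>M) = (\<mu> * \<tau>)\<^sup>2 * (\<integral>w. K w * h2 (Y w) \<partial>M) / 2"
    unfolding Q_def
    using I0[OF meas_h(3) bh2] I1[OF meas_h(2) bh1] I1[OF meas_h(3) bh2] I2[OF meas_h(3) bh2]
    by (simp add: m1 m2)
  moreover have "\<bar>\<integral>w. K w * h2 (Y w) \<partial>M\<bar> \<le> C"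
  proof -
    have "\<bar>\<integral>w. K w * h2 (Y w) \<partial>M\<bar> \<le> (\<integral>w. \<bar>K w * h2 (Y w)\<bar> \<partial>M)" by (rule integral_abs_bound)
    also have "\<dots> \<le> (\<integral>w. C \<partial>M)"
      by (rule integral_mono) (use I0[OF meas_h(3) bh2] bK[OF _ bh2] in auto)
    finally show ?thesis by (simp add: prob_space)
  qed
  ultimately have Q': "\<bar>\<integral>w. Q w \<partial>M\<bar> \<le> C * \<mu>\<^sup>2 * \<tau>\<^sup>2"
  proof -
    assume a: "(\<integral>w. Q w \<partial>M) = (\<mu> * \<tau>)\<^sup>2 * (\<integral>w. K w * h2 (Y w) \<partial>M) / 2" and c: "\<bar>\<integral>w. K w * h2 (Y w) \<partial>M\<bar> \<le> C"
    have "\<bar>\<integral>w. Q w \<partial>M\<bar> = (\<mu> * \<tau>)\<^sup>2 * \<bar>\<integral>w. K w * h2 (Y w) \<partial>M\<bar> / 2"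
      by (simp add: a abs_mult)
    also have "\<dots> \<le> (\<mu> * \<tau>)\<^sup>2 * C / 2"
      using c by (intro divide_right_mono mult_left_mono) auto
    also have "\<dots> \<le> (\<mu> * \<tau>)\<^sup>2 * C" using C_nonneg by simp
    finally show ?thesis by (simp add: power_mult_distrib algebra_simps)
  qed
  have "(\<integral>w. K w * h (B t w + \<mu> * t + \<sigma> * V s w) \<partial>M) = (\<integral>w. L w \<partial>M) + (\<integral>w. Q w \<partial>M) + (\<integral>w. R w \<partial>M)"
    unfolding split using LI QI RI by simp
  moreover have "(\<integral>w. L w \<partial>M) = (\<integral>w. K w * h (Y w) \<partial>M) + \<tau> * (\<integral>w. K w * (\<mu> * h1 (Y w) + h2 (Y w) / 2) \<partial>M)"
    unfolding L_def using I0[OF meas_h(1) bh] iL by simp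
  ultimately show ?thesis using Q' R' by linarith
qed


text \<open>Each step of the partition is split into a move of \<open>V\<close> at the new value of the Brownian motion
and a move of the Brownian motion at the old value of \<open>V\<close>. The sum of the former converges path by
path, by \<open>fv_sum_tendsto\<close>; the expectation of the latter is given by \<open>one_step\<close>. The factor
\<open>exp (- \<epsilon> V)\<close> dominates the first sum by a constant, also when \<open>V\<close> has infinite expectation.\<close>

lemma dynkin:
  assumes t: "t > 0"
  defines "K \<equiv> \<lambda>u w. exp (- \<epsilon> * V u w)"
  defines "Y \<equiv> \<lambda>u w. B u w + \<mu> * u + \<sigma> * V u w"
  defines "P \<equiv> \<lambda>w. (LBINT u:{0..t}. K u w * (\<sigma> * h1 (Y u w) - \<epsilon> * h (Y u w)) * b u w)
                   + (LBINT u:{0..t}. K u w * (\<mu> * h1 (Y u w) + h2 (Y u w) / 2))"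
  shows "integrable M P"
    and "(\<integral>w. P w \<partial>M) = (\<integral>w. K t w * h (Y t w) \<partial>M) - (\<integral>w. h (B 0 w) \<partial>M)"
    and "\<And>w. w \<in> space M \<Longrightarrow> set_integrable lborel {0..t} (\<lambda>u. K u w * (\<sigma> * h1 (Y u w) - \<epsilon> * h (Y u w)) * b u w)"
proof -
  have t0: "t \<ge> 0" using t by simp
  define \<Psi> where "\<Psi> v x = exp (- \<epsilon> * v) * h (x + \<sigma> * v)" for v x
  define \<Psi>' where "\<Psi>' v x = exp (- \<epsilon> * v) * (\<sigma> * h1 (x + \<sigma> * v) - \<epsilon> * h (x + \<sigma> * v))" for v x
  define X where "X u w = B u w + \<mu> * u" for u w
  define G where "G u w = K u w * (\<mu> * h1 (Y u w) + h2 (Y u w) / 2)" for u w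
  have [measurable]: "K u \<in> borel_measurable M" "Y u \<in> borel_measurable M" "X u \<in> borel_measurable M" "G u \<in> borel_measurable M" for u
    unfolding K_def Y_def X_def G_def by measurable
  define D where "D n i w = \<Psi> (V (grid t n (Suc i)) w) (X (grid t n (Suc i)) w) - \<Psi> (V (grid t n i) w) (X (grid t n (Suc i)) w)" for n i w
  define E where "E n i w = \<Psi> (V (grid t n i) w) (X (grid t n (Suc i)) w) - \<Psi> (V (grid t n i) w) (X (grid t n i) w)" for n i w
  define S where "S n w = (\<Sum>i\<le>n. D n i w)" for n w
  define U where "U n w = (\<Sum>i\<le>n. G (grid t n i) w * (t / real (Suc n)))" for n w
  have d\<Psi>: "((\<lambda>v. \<Psi> v x) has_real_derivative \<Psi>' v x) (at v)" for v x
    unfolding \<Psi>_def \<Psi>'_def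
    by (rule derivative_eq_intros DERIV_chain2[OF dh] refl | simp add: algebra_simps)+
  have cont\<Psi>': "continuous_on UNIV (\<lambda>p. \<Psi>' (fst p) (snd p))" unfolding \<Psi>'_def
    by (intro continuous_intros continuous_on_compose2[OF cont_h(1)] continuous_on_compose2[OF cont_h(2)]) auto
  have cont_paths: "continuous_on A (\<lambda>u. V u w)" "continuous_on A (\<lambda>u. X u w)" "continuous_on A (\<lambda>u. G u w)"
    if "w \<in> space M" for w A
  proof -
    note c = continuous_on_subset[OF V_cont[OF that], of A] continuous_on_subset[OF B_cont[OF that], of A]
    show "continuous_on A (\<lambda>u. V u w)" "continuous_on A (\<lambda>u. X u w)" using c
      unfolding X_def by (auto intro!: continuous_intros)
    show "continuous_on A (\<lambda>u. G u w)" unfolding G_def K_def Y_def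
      by (intro continuous_intros continuous_on_compose2[OF cont_h(3)] continuous_on_compose2[OF cont_h(2)] c subset_UNIV) auto
  qed
  have \<Psi>'_eq: "\<Psi>' (V u w) (X u w) * b u w = K u w * (\<sigma> * h1 (Y u w) - \<epsilon> * h (Y u w)) * b u w" for u w
    by (simp add: \<Psi>'_def K_def Y_def X_def)
  have Slim: "(\<lambda>n. S n w) \<longlonglongrightarrow> (LBINT u:{0..t}. K u w * (\<sigma> * h1 (Y u w) - \<epsilon> * h (Y u w)) * b u w)"
    and Sint: "set_integrable lborel {0..t} (\<lambda>u. K u w * (\<sigma> * h1 (Y u w) - \<epsilon> * h (Y u w)) * b u w)"
    if w: "w \<in> space M" for w
  proof -
    have bn: "b u w \<ge> 0" if "u \<in> {0..t}" for u using b_nonneg[OF w] that by simp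
    have Ve: "V s w = (LBINT u:{0..s}. b u w)" if "s \<in> {0..t}" for s using V_eq[OF w] that by simp
    from fv_sum_tendsto[of t "\<lambda>u. b u w" "\<lambda>u. V u w" "\<lambda>u. X u w" \<Psi> \<Psi>', OF t0 b_int[OF w t0] bn Ve cont_paths(1,2)[OF w] d\<Psi> cont\<Psi>']
    show "(\<lambda>n. S n w) \<longlonglongrightarrow> (LBINT u:{0..t}. K u w * (\<sigma> * h1 (Y u w) - \<epsilon> * h (Y u w)) * b u w)"
      "set_integrable lborel {0..t} (\<lambda>u. K u w * (\<sigma> * h1 (Y u w) - \<epsilon> * h (Y u w)) * b u w)"
      unfolding \<Psi>'_eq S_def D_def by auto
  qed
  show "\<And>w. w \<in> space M \<Longrightarrow> set_integrable lborel {0..t} (\<lambda>u. K u w * (\<sigma> * h1 (Y u w) - \<epsilon> * h (Y u w)) * b u w)"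
    by (rule Sint)
  have Ulim: "(\<lambda>n. U n w) \<longlonglongrightarrow> (LBINT u:{0..t}. G u w)" if w: "w \<in> space M" for w
    unfolding U_def by (rule riemann_sum_tendsto[OF cont_paths(3)[OF w] t0])
  define C' where "C' = (\<bar>\<sigma>\<bar> * C + \<epsilon> * C) / \<epsilon>"
  (* exp (- eps v) dominates the derivative in v, so the variation of Psi along V is controlled *)
  have \<Psi>diff: "\<bar>\<Psi> d x - \<Psi> c x\<bar> \<le> C' * (exp (- \<epsilon> * c) - exp (- \<epsilon> * d))" if cd: "c \<le> d" for c d x
  proof -
    have b': "\<bar>\<Psi>' v x\<bar> \<le> C' * (\<epsilon> * exp (- \<epsilon> * v))" for v
    proof -
      have "\<bar>\<sigma> * h1 (x + \<sigma> * v) - \<epsilon> * h (x + \<sigma> * v)\<bar> \<le> \<bar>\<sigma>\<bar> * C + \<epsilon> * C"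
        using mult_left_mono[OF bh1[of "x + \<sigma> * v"], of "\<bar>\<sigma>\<bar>"] mult_left_mono[OF bh[of "x + \<sigma> * v"], of \<epsilon>] \<epsilon>
        by (intro order.trans[OF abs_triangle_ineq4] add_mono) (auto simp: abs_mult)
      from mult_left_mono[OF this, of "exp (- \<epsilon> * v)"] show ?thesis
        using \<epsilon> by (simp add: \<Psi>'_def abs_mult C'_def mult.commute)
    qed
    have "((\<lambda>v. \<Psi> v x + C' * exp (- \<epsilon> * v)) has_real_derivative (\<Psi>' v x - C' * (\<epsilon> * exp (- \<epsilon> * v)))) (at v)" for v
      by (rule derivative_eq_intros d\<Psi> refl | simp)+
    moreover have "\<Psi>' v x - C' * (\<epsilon> * exp (- \<epsilon> * v)) \<le> 0" for v using b'[of v] by linarith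
    ultimately have 1: "\<Psi> d x + C' * exp (- \<epsilon> * d) \<le> \<Psi> c x + C' * exp (- \<epsilon> * c)"
      by (intro DERIV_nonpos_imp_nonincreasing[OF cd]) blast
    have "((\<lambda>v. \<Psi> v x - C' * exp (- \<epsilon> * v)) has_real_derivative (\<Psi>' v x + C' * (\<epsilon> * exp (- \<epsilon> * v)))) (at v)" for v
      by (rule derivative_eq_intros d\<Psi> refl | simp)+
    moreover have "\<Psi>' v x + C' * (\<epsilon> * exp (- \<epsilon> * v)) \<ge> 0" for v using b'[of v] by linarith
    ultimately have 2: "\<Psi> c x - C' * exp (- \<epsilon> * c) \<le> \<Psi> d x - C' * exp (- \<epsilon> * d)"
      by (intro DERIV_nonneg_imp_nondecreasing[OF cd]) blast
    show ?thesis using 1 2 by (simp add: algebra_simps abs_le_iff)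
  qed
  have C': "C' \<ge> 0" using \<epsilon> C_nonneg by (auto simp: C'_def)
  have g0: "0 \<le> grid t n i" and gm: "grid t n i < grid t n (Suc i)" for n i
  proof -
    show "0 \<le> grid t n i" using t0 by (rule grid_nonneg)
    have "t / real (Suc n) > 0" using t by (intro divide_pos_pos) auto
    thus "grid t n i < grid t n (Suc i)" using grid_step[of t n i] by linarith
  qed
  have K01: "0 \<le> K u w" "K u w \<le> 1" if "w \<in> space M" "u \<ge> 0" for u w
    using V_nonneg[OF that] \<epsilon> by (auto simp: K_def)
  have Sb: "\<bar>S n w\<bar> \<le> C'" if w: "w \<in> space M" for n w
  proof -
    have "\<bar>S n w\<bar> \<le> (\<Sum>i\<le>n. C' * (exp (- \<epsilon> * V (grid t n i) w) - exp (- \<epsilon> * V (grid t n (Suc i)) w)))"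
      unfolding S_def D_def by (intro order.trans[OF sum_abs] sum_mono \<Psi>diff V_mono[OF w] g0 less_imp_le[OF gm])
    also have "\<dots> = C' * (exp (- \<epsilon> * V 0 w) - exp (- \<epsilon> * V t w))"
      unfolding sum_distrib_left[symmetric]
      using sum_lessThan_telescope'[of "\<lambda>i. exp (- \<epsilon> * V (grid t n i) w)" "Suc n"]
      by (simp add: lessThan_Suc_atMost)
    also have "\<dots> \<le> C' * 1" using V_0[OF w] C' by (intro mult_left_mono) auto
    finally show ?thesis by simp
  qed
  define CG where "CG = \<bar>\<mu>\<bar> * C + C"
  have Gb: "\<bar>G u w\<bar> \<le> CG" if "w \<in> space M" "u \<ge> 0" for u w
  proof -
    have "\<bar>\<mu> * h1 (Y u w) + h2 (Y u w) / 2\<bar> \<le> \<bar>\<mu>\<bar> * C + C"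
      using mult_left_mono[OF bh1[of "Y u w"], of "\<bar>\<mu>\<bar>"] bh2[of "Y u w"] C_nonneg
      by (intro order.trans[OF abs_triangle_ineq] add_mono) (auto simp: abs_mult)
    from mult_mono[OF K01(2)[OF that] this] show ?thesis
      using K01[OF that] by (simp add: G_def CG_def abs_mult)
  qed
  have Ub: "\<bar>U n w\<bar> \<le> CG * t" if w: "w \<in> space M" for n w
  proof -
    have "\<bar>U n w\<bar> \<le> (\<Sum>i\<le>n. CG * (t / real (Suc n)))"
      unfolding U_def using Gb[OF w g0] t
      by (intro order.trans[OF sum_abs] sum_mono) (auto simp: abs_mult intro!: mult_right_mono divide_right_mono)
    also have "\<dots> = CG * t" by (simp del: of_nat_Suc)
    finally show ?thesis .
  qed
  have [measurable]: "(\<lambda>w. \<Psi> (V u w) (X s w)) \<in> borel_measurable M" for u s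
    unfolding \<Psi>_def by measurable
  have [measurable]: "S n \<in> borel_measurable M" "U n \<in> borel_measurable M" for n
    unfolding S_def U_def D_def by measurable
  have Plim: "(\<lambda>n. S n w + U n w) \<longlonglongrightarrow> P w" if "w \<in> space M" for w
    unfolding P_def using tendsto_add[OF Slim[OF that] Ulim[OF that]] by (simp add: G_def)
  have Pm: "P \<in> borel_measurable M"
    by (rule borel_measurable_LIMSEQ_real[OF Plim]) auto
  have bound: "AE w in M. norm (S n w + U n w) \<le> C' + CG * t" for n
  proof (rule AE_I2)
    fix w assume "w \<in> space M"
    from Sb[OF this, of n] Ub[OF this, of n] show "norm (S n w + U n w) \<le> C' + CG * t" by simp
  qed
  have ci: "integrable M (\<lambda>_. C' + CG * t)" by simp
  have ae: "AE w in M. (\<lambda>n. S n w + U n w) \<longlonglongrightarrow> P w" by (rule AE_I2[OF Plim])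
  have sm: "(\<lambda>w. S n w + U n w) \<in> borel_measurable M" for n by measurable
  show "integrable M P"
    by (rule integrable_dominated_convergence[OF Pm sm ci ae bound])
  have lim: "(\<lambda>n. \<integral>w. S n w + U n w \<partial>M) \<longlonglongrightarrow> (\<integral>w. P w \<partial>M)"
    by (rule integral_dominated_convergence[OF Pm sm ci ae bound])
  define tot where "tot = (\<integral>w. K t w * h (Y t w) \<partial>M) - (\<integral>w. h (B 0 w) \<partial>M)"
  define err where "err \<tau> = C * \<mu>\<^sup>2 * \<tau>\<^sup>2 + 4 * C * (c3 * sqrt \<tau> ^ 3 + \<bar>\<mu>\<bar> ^ 3 * \<tau> ^ 3)" for \<tau> :: real
  have \<Psi>int: "integrable M (\<lambda>w. \<Psi> (V u w) (X s w))" if "u \<ge> 0" for u s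
  proof (rule integrable_const_bound[where B = C])
    show "AE w in M. norm (\<Psi> (V u w) (X s w)) \<le> C"
    proof (rule AE_I2)
      fix w assume "w \<in> space M"
      from mult_mono[OF K01(2)[OF this that] bh[of "X s w + \<sigma> * V u w"]]
      show "norm (\<Psi> (V u w) (X s w)) \<le> C" by (simp add: \<Psi>_def K_def abs_mult)
    qed
  qed measurable
  have Gint: "integrable M (G u)" if "u \<ge> 0" for u
    by (rule integrable_const_bound[where B = CG]) (use Gb[OF _ that] in auto)
  have step: "\<bar>(\<integral>w. E n i w - G (grid t n i) w * (t / real (Suc n)) \<partial>M)\<bar> \<le> err (t / real (Suc n))" for n i
  proof -
    have "(\<integral>w. E n i w - G (grid t n i) w * (t / real (Suc n)) \<partial>M)
        = (\<integral>w. \<Psi> (V (grid t n i) w) (X (grid t n (Suc i)) w) \<partial>M) - (\<integral>w. \<Psi> (V (grid t n i) w) (X (grid t n i) w) \<partial>M)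
          - (t / real (Suc n)) * (\<integral>w. G (grid t n i) w \<partial>M)"
      unfolding E_def using \<Psi>int[OF g0] Gint[OF g0] by (simp del: of_nat_Suc add: mult.commute)
    also have "\<bar>\<dots>\<bar> \<le> err (t / real (Suc n))"
      using one_step[OF g0 gm, of n i] unfolding grid_step err_def \<Psi>_def X_def G_def K_def Y_def
      by simp
    finally show ?thesis .
  qed
  have tele: "(\<Sum>i\<le>n. D n i w + E n i w) = K t w * h (Y t w) - h (B 0 w)" if "w \<in> space M" for n w
  proof -
    have "(\<Sum>i\<le>n. D n i w + E n i w) = (\<Sum>i<Suc n. \<Psi> (V (grid t n (Suc i)) w) (X (grid t n (Suc i)) w) - \<Psi> (V (grid t n i) w) (X (grid t n i) w))"
      by (simp add: D_def E_def lessThan_Suc_atMost)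
    also have "\<dots> = \<Psi> (V t w) (X t w) - \<Psi> (V 0 w) (X 0 w)"
      using sum_lessThan_telescope[of "\<lambda>i. \<Psi> (V (grid t n i) w) (X (grid t n i) w)" "Suc n"] by simp
    also have "\<dots> = K t w * h (Y t w) - h (B 0 w)"
      using V_0[OF that] by (simp add: \<Psi>_def K_def Y_def X_def)
    finally show ?thesis .
  qed
  have hint: "integrable M (\<lambda>w. K t w * h (Y t w))" "integrable M (\<lambda>w. h (B 0 w))"
    using \<Psi>int[OF t0, of t] integrable_const_bound[of "\<lambda>w. h (B 0 w)" C] bh by (auto simp: \<Psi>_def K_def Y_def X_def)
  have bnd: "\<bar>(\<integral>w. S n w + U n w \<partial>M) - tot\<bar> \<le> real (Suc n) * err (t / real (Suc n))" for n
  proof -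
    have "tot = (\<integral>w. K t w * h (Y t w) - h (B 0 w) \<partial>M)"
      unfolding tot_def using hint by simp
    also have "\<dots> = (\<integral>w. (\<Sum>i\<le>n. D n i w + E n i w) \<partial>M)"
      by (rule Bochner_Integration.integral_cong) (use tele in auto)
    also have "\<dots> = (\<integral>w. S n w + U n w + (\<Sum>i\<le>n. E n i w - G (grid t n i) w * (t / real (Suc n))) \<partial>M)"
      by (simp add: S_def U_def sum.distrib sum_subtractf del: of_nat_Suc)
    also have "\<dots> = (\<integral>w. S n w + U n w \<partial>M) + (\<Sum>i\<le>n. (\<integral>w. E n i w - G (grid t n i) w * (t / real (Suc n)) \<partial>M))"
    proof -
      have 1: "integrable M (\<lambda>w. E n i w - G (grid t n i) w * (t / real (Suc n)))" for i
        unfolding E_def using \<Psi>int[OF g0] Gint[OF g0] by (simp del: of_nat_Suc)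
      have 2: "integrable M (\<lambda>w. S n w + U n w)"
        unfolding S_def U_def D_def using \<Psi>int[OF g0] Gint[OF g0] by (simp del: of_nat_Suc)
      have "(\<integral>w. (S n w + U n w) + (\<Sum>i\<le>n. E n i w - G (grid t n i) w * (t / real (Suc n))) \<partial>M)
          = (\<integral>w. S n w + U n w \<partial>M) + (\<integral>w. (\<Sum>i\<le>n. E n i w - G (grid t n i) w * (t / real (Suc n))) \<partial>M)"
        by (rule Bochner_Integration.integral_add[OF 2 Bochner_Integration.integrable_sum[OF 1]])
      also have "(\<integral>w. (\<Sum>i\<le>n. E n i w - G (grid t n i) w * (t / real (Suc n))) \<partial>M) = (\<Sum>i\<le>n. (\<integral>w. E n i w - G (grid t n i) w * (t / real (Suc n)) \<partial>M))"
        by (rule Bochner_Integration.integral_sum[OF 1])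
      finally show ?thesis .
    qed
    finally have "\<bar>(\<integral>w. S n w + U n w \<partial>M) - tot\<bar> = \<bar>\<Sum>i\<le>n. (\<integral>w. E n i w - G (grid t n i) w * (t / real (Suc n)) \<partial>M)\<bar>"
      by simp
    also have "\<dots> \<le> (\<Sum>i\<le>n. err (t / real (Suc n)))"
      by (intro order.trans[OF sum_abs] sum_mono step)
    finally show ?thesis by (simp del: of_nat_Suc)
  qed
  have err_lim: "(\<lambda>n. real (Suc n) * err (t / real (Suc n))) \<longlonglongrightarrow> 0"
  proof -
    have eq: "real (Suc n) * err (t / real (Suc n)) =
       C * \<mu>\<^sup>2 * t * (t / real (Suc n)) + 4 * C * (c3 * (t * sqrt (t / real (Suc n))) + \<bar>\<mu>\<bar> ^ 3 * t * (t / real (Suc n))\<^sup>2)" for n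
    proof -
      define \<tau> where "\<tau> = t / real (Suc n)"
      have t': "real (Suc n) * \<tau> = t" by (simp add: \<tau>_def del: of_nat_Suc)
      have "\<tau> \<ge> 0" using t by (simp add: \<tau>_def)
      hence "sqrt \<tau> ^ 3 = \<tau> * sqrt \<tau>" by (simp add: power3_eq_cube)
      hence "real (Suc n) * err \<tau> = C * \<mu>\<^sup>2 * (real (Suc n) * \<tau>) * \<tau> + 4 * C * (c3 * ((real (Suc n) * \<tau>) * sqrt \<tau>) + \<bar>\<mu>\<bar> ^ 3 * (real (Suc n) * \<tau>) * \<tau>\<^sup>2)"
        unfolding err_def by (simp add: power2_eq_square power3_eq_cube algebra_simps del: of_nat_Suc)
      thus ?thesis unfolding t' by (simp add: \<tau>_def)
    qed
    have "(\<lambda>n. C * \<mu>\<^sup>2 * t * (t / real (Suc n)) + 4 * C * (c3 * (t * sqrt (t / real (Suc n))) + \<bar>\<mu>\<bar> ^ 3 * t * (t / real (Suc n))\<^sup>2))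
       \<longlonglongrightarrow> C * \<mu>\<^sup>2 * t * 0 + 4 * C * (c3 * (t * sqrt 0) + \<bar>\<mu>\<bar> ^ 3 * t * 0\<^sup>2)"
      by (intro tendsto_intros grid_step_tendsto)
    thus ?thesis unfolding eq by simp
  qed
  have "(\<lambda>n. (\<integral>w. S n w + U n w \<partial>M) - tot) \<longlonglongrightarrow> 0"
    by (rule Lim_null_comparison[OF always_eventually err_lim]) (simp only: real_norm_def bnd simp_thms)
  hence "(\<lambda>n. (\<integral>w. S n w + U n w \<partial>M)) \<longlonglongrightarrow> tot"
    by (simp add: LIM_zero_iff)
  with lim have "(\<integral>w. P w \<partial>M) = tot" by (rule LIMSEQ_unique)
  thus "(\<integral>w. P w \<partial>M) = (\<integral>w. K t w * h (Y t w) \<partial>M) - (\<integral>w. h (B 0 w) \<partial>M)"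
    by (simp add: tot_def)
qed

end

end

section \<open>The Laplace transform of the hyperbolic Bessel process\<close>

lemma power_mult_exp_minus_le_fact:
  assumes "x \<ge> (0::real)" shows "x ^ k * exp (- x) \<le> fact k"
proof -
  have "(\<Sum>n\<in>{k}. x ^ n /\<^sub>R fact n) \<le> (\<Sum>n. x ^ n /\<^sub>R fact n)"
    by (rule sum_le_suminf[OF summable_exp_generic]) (use assms in auto)
  hence "x ^ k \<le> fact k * exp x" by (simp add: exp_def field_simps)
  thus ?thesis by (simp add: exp_minus field_simps)
qed

lemma borel_measurable_time_integral:
  fixes Q :: "real \<Rightarrow> 'a \<Rightarrow> real"
  assumes [measurable]: "\<And>u. Q u \<in> borel_measurable M"
    and cont: "\<And>w. w \<in> space M \<Longrightarrow> continuous_on {0..t} (\<lambda>u. Q u w)" and t: "t \<ge> 0"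
  shows "(\<lambda>w. LBINT u:{0..t}. Q u w) \<in> borel_measurable M"
proof (rule borel_measurable_LIMSEQ_real)
  show "(\<lambda>n. \<Sum>i\<le>n. Q (grid t n i) w * (t / real (Suc n))) \<longlonglongrightarrow> (LBINT u:{0..t}. Q u w)" if "w \<in> space M" for w
    by (rule riemann_sum_tendsto[OF cont[OF that] t])
qed measurable

lemma AE_good_set:
  assumes "AE w in M. P w"
  obtains G where "G \<in> sets M" "G \<subseteq> space M" "\<And>w. w \<in> G \<Longrightarrow> P w" "AE w in M. w \<in> G"
proof -
  from AE_E[OF assms] obtain N where N: "{w \<in> space M. \<not> P w} \<subseteq> N" "emeasure M N = 0" "N \<in> sets M" by auto
  have "AE w in M. w \<notin> N" using N by (intro AE_not_in) auto
  hence "AE w in M. w \<in> space M - N" by (auto elim!: eventually_mono)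
  thus ?thesis using N by (intro that[of "space M - N"]) auto
qed

lemma normal_increment_moments:
  fixes D :: "'a \<Rightarrow> real"
  assumes D: "distributed M lborel D (normal_density 0 (sqrt \<tau>))" and \<tau>: "\<tau> > 0"
  shows "integrable M D" "(\<integral>w. D w \<partial>M) = 0"
    "integrable M (\<lambda>w. (D w)\<^sup>2)" "(\<integral>w. (D w)\<^sup>2 \<partial>M) = \<tau>"
    "integrable M (\<lambda>w. \<bar>D w\<bar> ^ 3)" "(\<integral>w. \<bar>D w\<bar> ^ 3 \<partial>M) \<le> 2 * sqrt \<tau> ^ 3"
proof -
  have s: "sqrt \<tau> > 0" using \<tau> by simp
  note tr = distributed_integrable[OF D] distributed_integral[OF D]
  have 1: "has_bochner_integral lborel (\<lambda>x. normal_density 0 (sqrt \<tau>) x * x) 0"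
    using normal_moment_odd[OF s, of 0 0] by simp
  have 2: "has_bochner_integral lborel (\<lambda>x. normal_density 0 (sqrt \<tau>) x * x\<^sup>2) \<tau>"
    using normal_moment_even[OF s, of 0 1] \<tau> by (simp add: fact_numeral)
  have 3: "has_bochner_integral lborel (\<lambda>x. normal_density 0 (sqrt \<tau>) x * \<bar>x\<bar> ^ 3) (2 * sqrt \<tau> ^ 3 * sqrt (2 / pi))"
    using normal_moment_abs_odd[OF s, of 0 1] by (simp add: eval_nat_numeral)
  show "integrable M D" using tr(1)[of "\<lambda>x. x"] 1 by (auto simp: has_bochner_integral_iff)
  show "(\<integral>w. D w \<partial>M) = 0" using tr(2)[of "\<lambda>x. x"] 1 by (auto simp: has_bochner_integral_iff)
  show "integrable M (\<lambda>w. (D w)\<^sup>2)" using tr(1)[of "\<lambda>x. x\<^sup>2"] 2 by (auto simp: has_bochner_integral_iff)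
  show "(\<integral>w. (D w)\<^sup>2 \<partial>M) = \<tau>" using tr(2)[of "\<lambda>x. x\<^sup>2"] 2 by (auto simp: has_bochner_integral_iff)
  show "integrable M (\<lambda>w. \<bar>D w\<bar> ^ 3)" using tr(1)[of "\<lambda>x. \<bar>x\<bar> ^ 3"] 3 by (auto simp: has_bochner_integral_iff)
  have "(\<integral>w. \<bar>D w\<bar> ^ 3 \<partial>M) = 2 * sqrt \<tau> ^ 3 * sqrt (2 / pi)"
    using tr(2)[of "\<lambda>x. \<bar>x\<bar> ^ 3"] 3 by (auto simp: has_bochner_integral_iff)
  also have "\<dots> \<le> 2 * sqrt \<tau> ^ 3 * 1"
    using \<tau> pi_ge_two by (intro mult_left_mono) (auto simp: field_simps)
  finally show "(\<integral>w. \<bar>D w\<bar> ^ 3 \<partial>M) \<le> 2 * sqrt \<tau> ^ 3" by simp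
qed

lemma (in prob_space) indep_increment_integral:
  fixes U D :: "'a \<Rightarrow> real"
  assumes sub: "subalgebra M A" and U: "U \<in> borel_measurable A" and D: "D \<in> borel_measurable M"
    and ind: "indep_set (sets A) {D -` S \<inter> space M | S. S \<in> sets borel}"
    and iU: "integrable M U" and f: "f \<in> borel_measurable borel" and iD: "integrable M (\<lambda>w. f (D w) :: real)"
  shows "(\<integral>w. U w * f (D w) \<partial>M) = (\<integral>w. U w \<partial>M) * (\<integral>w. f (D w) \<partial>M)"
proof -
  have UM: "U \<in> borel_measurable M" by (rule measurable_from_subalg[OF sub U])
  have sp: "space A = space M" using sub by (simp add: subalgebra_def)
  have "indep_var borel U borel D"
    unfolding indep_var_eq
  proof (intro conjI indep_set_sigma_sets)
    have "{U -` S \<inter> space M | S. S \<in> sets borel} \<subseteq> sets A" (is "?U \<subseteq> _")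
      using measurable_sets[OF U] sp by auto
    thus "indep_set {U -` S \<inter> space M | S. S \<in> sets borel} {D -` S \<inter> space M | S. S \<in> sets borel}"
      unfolding indep_set_def by (intro indep_sets_mono_sets[OF ind[unfolded indep_set_def]]) (simp split: bool.split)
    have stable: "Int_stable {H -` S \<inter> space M | S. S \<in> sets borel}" for H :: "'a \<Rightarrow> real"
    proof (rule Int_stableI, clarify)
      fix S T :: "real set" assume "S \<in> sets borel" "T \<in> sets borel"
      thus "\<exists>S'. (H -` S \<inter> space M) \<inter> (H -` T \<inter> space M) = H -` S' \<inter> space M \<and> S' \<in> sets borel"
        by (intro exI[of _ "S \<inter> T"]) auto
    qed
    show "Int_stable {U -` S \<inter> space M | S. S \<in> sets borel}" "Int_stable {D -` S \<inter> space M | S. S \<in> sets borel}"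
      by (rule stable)+
  qed (use UM D in auto)
  from indep_var_compose[OF this measurable_ident f]
  have "indep_var borel U borel (\<lambda>w. f (D w))" by (simp add: o_def id_def)
  from indep_var_lebesgue_integral[OF this iU iD] show ?thesis .
qed

text \<open>The generator \<open>z (z + 2) \<partial>\<^sup>2 / 2 + (\<alpha> + 1) (z + 1) \<partial>\<close> of \<open>cosh R - 1\<close>, applied to
\<open>exp (- x z)\<close> as a function of \<open>z\<close>. It is also the operator
\<open>x\<^sup>2 \<partial>\<^sup>2 / 2 + ((\<alpha> + 1) x - x\<^sup>2) \<partial> - (\<alpha> + 1) x\<close> applied to \<open>exp (- x z)\<close> as a function
of \<open>x\<close>, and this coincidence is the duality.\<close>

definition laplace_generator :: "real \<Rightarrow> real \<Rightarrow> real \<Rightarrow> real" where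
  "laplace_generator \<alpha> z x = (z * (z + 2) * x\<^sup>2 / 2 - (\<alpha> + 1) * (z + 1) * x) * exp (- x * z)"

text \<open>The bound is uniform in \<open>z\<close>. It grows linearly in \<open>x\<close> because the value at \<open>z = 0\<close> is
\<open>- (\<alpha> + 1) x\<close>.\<close>

lemma laplace_generator_bound:
  assumes "z \<ge> 0" "x \<ge> 0" "\<alpha> \<ge> - 1"
  shows "\<bar>laplace_generator \<alpha> z x\<bar> \<le> (\<alpha> + 2) * (1 + x)"
proof -
  define q where "q = x * z"
  have q: "q \<ge> 0" using assms by (simp add: q_def)
  have eq: "laplace_generator \<alpha> z x = (q\<^sup>2 * exp (- q)) / 2 + x * (q * exp (- q)) - (\<alpha> + 1) * (q * exp (- q)) - (\<alpha> + 1) * x * exp (- q)"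
    by (simp add: laplace_generator_def q_def power2_eq_square field_simps)
  have le: "q\<^sup>2 * exp (- q) \<le> 2" "q * exp (- q) \<le> 1" "exp (- q) \<le> 1"
    using power_mult_exp_minus_le_fact[OF q, of 2] power_mult_exp_minus_le_fact[OF q, of 1] q by (auto simp: fact_numeral)
  have ge: "0 \<le> q\<^sup>2 * exp (- q)" "0 \<le> x * (q * exp (- q))" "0 \<le> (\<alpha> + 1) * (q * exp (- q))" "0 \<le> (\<alpha> + 1) * x * exp (- q)" "0 \<le> (\<alpha> + 1) * x"
    using assms q by auto
  have le': "x * (q * exp (- q)) \<le> x * 1" "(\<alpha> + 1) * (q * exp (- q)) \<le> (\<alpha> + 1) * 1" "(\<alpha> + 1) * x * exp (- q) \<le> (\<alpha> + 1) * x * 1"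
    by (intro mult_left_mono; use assms le ge in simp)+
  have "\<bar>laplace_generator \<alpha> z x\<bar> \<le> 1 + x + (\<alpha> + 1) + (\<alpha> + 1) * x"
  proof -
    have "\<bar>A / 2 + a - b - d\<bar> \<le> 1 + x + c + k"
      if "A \<le> 2" "0 \<le> A" "0 \<le> a" "a \<le> x" "0 \<le> b" "b \<le> c" "0 \<le> d" "d \<le> k" for A a b d c k :: real
      using that by linarith
    from this[OF le(1) ge(1,2) le'(1)[unfolded mult_1_right] ge(3) le'(2)[unfolded mult_1_right] ge(4) le'(3)[unfolded mult_1_right]]
    show ?thesis unfolding eq .
  qed
  also have "\<dots> \<le> (\<alpha> + 2) * (1 + x)" using assms by (simp add: algebra_simps)
  finally show ?thesis .
qed

lemma coth_nonneg: "r \<ge> 0 \<Longrightarrow> coth r \<ge> 0"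
  by (simp add: coth_def)

text \<open>The test function whose expectation along \<open>R\<close> is the Laplace transform of \<open>cosh R - 1\<close>. It is even, so
it may be evaluated at \<open>B\<close> in place of \<open>\<bar>B\<bar>\<close> when \<open>\<alpha> = - 1 / 2\<close>. The functions with
suffix 1, 2, 3 are its derivatives.\<close>

definition exp_cosh :: "real \<Rightarrow> real \<Rightarrow> real" where
  "exp_cosh l y = exp (- l * (cosh y - 1))"

definition exp_cosh1 :: "real \<Rightarrow> real \<Rightarrow> real" where
  "exp_cosh1 l y = - l * sinh y * exp_cosh l y"

definition exp_cosh2 :: "real \<Rightarrow> real \<Rightarrow> real" where
  "exp_cosh2 l y = (l\<^sup>2 * (sinh y)\<^sup>2 - l * cosh y) * exp_cosh l y"

definition exp_cosh3 :: "real \<Rightarrow> real \<Rightarrow> real" where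
  "exp_cosh3 l y = (3 * l\<^sup>2 * sinh y * cosh y - l * sinh y - l ^ 3 * sinh y ^ 3) * exp_cosh l y"

lemma exp_cosh_deriv: "(exp_cosh l has_real_derivative exp_cosh1 l x) (at x)" "(exp_cosh1 l has_real_derivative exp_cosh2 l x) (at x)"
  "(exp_cosh2 l has_real_derivative exp_cosh3 l x) (at x)"
proof -
  show 1: "(exp_cosh l has_real_derivative exp_cosh1 l x) (at x)"
    unfolding exp_cosh_def exp_cosh1_def by (rule derivative_eq_intros refl | simp)+
  show 2: "(exp_cosh1 l has_real_derivative exp_cosh2 l x) (at x)"
    unfolding exp_cosh1_def[abs_def] exp_cosh2_def by (rule derivative_eq_intros 1 refl | simp add: exp_cosh1_def power2_eq_square algebra_simps)+
  show "(exp_cosh2 l has_real_derivative exp_cosh3 l x) (at x)"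
    unfolding exp_cosh2_def[abs_def] exp_cosh3_def by (rule derivative_eq_intros 1 refl | simp add: exp_cosh1_def power2_eq_square power3_eq_cube algebra_simps)+
qed

lemma exp_cosh_bounds:
  assumes l: "l > 0"
  shows "\<bar>exp_cosh l x\<bar> \<le> 20 * exp l" "\<bar>exp_cosh1 l x\<bar> \<le> 20 * exp l" "\<bar>exp_cosh2 l x\<bar> \<le> 20 * exp l" "\<bar>exp_cosh3 l x\<bar> \<le> 20 * exp l"
proof -
  define q where "q = l * cosh x"
  define p where "p = l * \<bar>sinh x\<bar>"
  have sc: "\<bar>sinh x\<bar> \<le> cosh x"
    by (simp add: abs_le_iff sinh_def cosh_def)
  have q: "0 \<le> q" "l \<le> q" and p: "0 \<le> p" "p \<le> q"
    using l sc cosh_real_ge_1[of x] by (auto simp: p_def q_def)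
  have h: "exp_cosh l x = exp l * exp (- q)" by (simp add: exp_cosh_def q_def exp_add[symmetric] algebra_simps)
  have e: "q ^ k * exp_cosh l x \<le> fact k * exp l" for k
    using mult_right_mono[OF power_mult_exp_minus_le_fact[OF q(1), of k], of "exp l"] by (simp add: h mult_ac)
  have h0: "exp_cosh l x \<ge> 0" by (simp add: exp_cosh_def)
  have e0: "exp_cosh l x \<le> exp l" and e1: "q * exp_cosh l x \<le> exp l" and e2: "q\<^sup>2 * exp_cosh l x \<le> 2 * exp l" and e3: "q ^ 3 * exp_cosh l x \<le> 6 * exp l"
    using e[of 0] e[of 1] e[of 2] e[of 3] by (simp_all add: fact_numeral)
  have pq: "p * exp_cosh l x \<le> q * exp_cosh l x" "p\<^sup>2 * exp_cosh l x \<le> q\<^sup>2 * exp_cosh l x" "p * q * exp_cosh l x \<le> q\<^sup>2 * exp_cosh l x" "p ^ 3 * exp_cosh l x \<le> q ^ 3 * exp_cosh l x"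
    using p h0 by (auto intro!: mult_right_mono power_mono simp: power2_eq_square intro: mult_mono)
  have pos: "exp l > 0" by simp
  show "\<bar>exp_cosh l x\<bar> \<le> 20 * exp l" using e0 h0 pos by linarith
  show "\<bar>exp_cosh1 l x\<bar> \<le> 20 * exp l"
  proof -
    have "\<bar>exp_cosh1 l x\<bar> = p * exp_cosh l x" using h0 l by (simp add: exp_cosh1_def p_def abs_mult)
    thus ?thesis using pq e1 pos by linarith
  qed
  show "\<bar>exp_cosh2 l x\<bar> \<le> 20 * exp l"
  proof -
    have "\<bar>l\<^sup>2 * (sinh x)\<^sup>2 - l * cosh x\<bar> \<le> p\<^sup>2 + q"
      using l by (intro order.trans[OF abs_triangle_ineq4] add_mono) (auto simp: p_def q_def power_mult_distrib abs_mult)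
    from mult_right_mono[OF this h0] have "\<bar>exp_cosh2 l x\<bar> \<le> p\<^sup>2 * exp_cosh l x + q * exp_cosh l x"
      unfolding exp_cosh2_def abs_mult abs_of_nonneg[OF h0] distrib_right .
    thus ?thesis using pq e1 e2 pos by linarith
  qed
  show "\<bar>exp_cosh3 l x\<bar> \<le> 20 * exp l"
  proof -
    have "\<bar>3 * l\<^sup>2 * sinh x * cosh x - l * sinh x - l ^ 3 * sinh x ^ 3\<bar> \<le> 3 * (p * q) + p + p ^ 3"
      using l by (intro order.trans[OF abs_triangle_ineq4] add_mono)
        (auto simp: p_def q_def power_mult_distrib abs_mult power_abs power2_eq_square)
    from mult_right_mono[OF this h0] have "\<bar>exp_cosh3 l x\<bar> \<le> 3 * (p * q * exp_cosh l x) + p * exp_cosh l x + p ^ 3 * exp_cosh l x"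
      unfolding exp_cosh3_def abs_mult abs_of_nonneg[OF h0] distrib_right by (simp only: mult.assoc)
    thus ?thesis using pq e1 e2 e3 pos by linarith
  qed
qed


text \<open>Here \<open>R = B + V\<close> with \<open>V\<close> the integral of \<open>(\<alpha> + 1/2) coth R\<close>; when \<open>\<alpha> = - 1 / 2\<close>, take \<open>V = 0\<close>
and use that \<open>cosh\<close> is even. The derivative of the test function contains the
factor \<open>sinh R\<close>, which cancels the singularity of \<open>coth R\<close> at \<open>0\<close> at almost every time. The weight
\<open>exp (- \<epsilon> V)\<close> in \<open>dynkin\<close> is removed by \<open>\<epsilon> \<rightarrow> 0\<close>: all errors are bounded by
multiples of the expectation of \<open>1 - exp (- \<epsilon> V t)\<close>. The process \<open>Z\<close> is
\<open>cosh R - 1\<close>, modified on a null set.\<close>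

lemma bessel_laplace_equation:
  assumes bes: "hyperbolic_bessel_process M F B \<alpha> 0 R"
  obtains Z :: "real \<Rightarrow> 'a \<Rightarrow> real" where
    "\<And>u. Z u \<in> borel_measurable M"
    "\<And>w. w \<in> space M \<Longrightarrow> continuous_on UNIV (\<lambda>u. Z u w)"
    "\<And>u w. Z u w \<ge> 0"
    "\<And>w. w \<in> space M \<Longrightarrow> Z 0 w = 0"
    "\<And>t. t \<ge> 0 \<Longrightarrow> AE w in M. Z t w = cosh (R t w) - 1"
    "\<And>l t. l > 0 \<Longrightarrow> t > 0 \<Longrightarrow> (\<integral>w. exp (- l * Z t w) \<partial>M) = 1 + (\<integral>w. (LBINT u:{0..t}. laplace_generator \<alpha> (Z u w) l) \<partial>M)"
proof -
  note bes' = bes[unfolded hyperbolic_bessel_process_def]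
  have uc: "usual_conditions M F" and bm: "brownian_motion_wrt M F B" and al: "\<alpha> \<ge> - 1 / 2"
    and RF: "\<And>t. t \<ge> 0 \<Longrightarrow> R t \<in> borel_measurable (F t)"
    and Rc: "AE w in M. continuous_on {0..} (\<lambda>t. R t w) \<and> (\<forall>t\<ge>0. R t w \<ge> 0)"
    using bes' by auto
  have sbm: "standard_brownian_motion M B" and BF: "\<And>t. t \<ge> 0 \<Longrightarrow> B t \<in> borel_measurable (F t)"
    and indF: "\<And>s t. 0 \<le> s \<Longrightarrow> s < t \<Longrightarrow> prob_space.indep_set M (sets (F s))
        {(\<lambda>w. B t w - B s w) -` S \<inter> space M | S. S \<in> sets borel}"
    using bm unfolding brownian_motion_wrt_def by auto
  have sub: "\<And>t. t \<ge> 0 \<Longrightarrow> subalgebra M (F t)" using uc unfolding usual_conditions_def by auto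
  interpret prob_space M using uc unfolding usual_conditions_def by auto
  have Bm: "B t \<in> borel_measurable M" if "t \<ge> 0" for t using measurable_from_subalg[OF sub BF] that by auto
  have Rm: "R t \<in> borel_measurable M" if "t \<ge> 0" for t using measurable_from_subalg[OF sub RF] that by auto
  have Bc: "AE w in M. B 0 w = 0 \<and> continuous_on {0..} (\<lambda>t. B t w)"
    and Bd: "\<And>s t. 0 \<le> s \<Longrightarrow> s < t \<Longrightarrow> distributed M lborel (\<lambda>w. B t w - B s w) (normal_density 0 (sqrt (t - s)))"
    using sbm unfolding standard_brownian_motion_def by auto
  define reflected where "reflected \<longleftrightarrow> \<alpha> = - 1 / 2"
  define c where "c = \<alpha> + 1 / 2"
  have c0: "c \<ge> 0" using al by (simp add: c_def)
  (* the part of the definition of the process that holds on a set of full measure *)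
  define P where "P w \<longleftrightarrow> (if reflected then (\<forall>t\<ge>0. R t w = \<bar>B t w\<bar>)
      else (AE u in lborel. u \<ge> 0 \<longrightarrow> R u w \<noteq> 0) \<and>
              (\<forall>t\<ge>0. set_integrable lborel {0..t} (\<lambda>u. coth (R u w)) \<and>
                R t w = B t w + c * (LBINT u:{0..t}. coth (R u w))))" for w
  have "AE w in M. P w" using bes' unfolding P_def reflected_def c_def by (auto split: if_splits)
  with Rc Bc have "AE w in M. P w \<and> (continuous_on {0..} (\<lambda>t. R t w) \<and> (\<forall>t\<ge>0. R t w \<ge> 0))
      \<and> (B 0 w = 0 \<and> continuous_on {0..} (\<lambda>t. B t w))" by eventually_elim blast
  then obtain G where G [measurable]: "G \<in> sets M" and Gs: "G \<subseteq> space M"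
    and good: "\<And>w. w \<in> G \<Longrightarrow> P w \<and> (continuous_on {0..} (\<lambda>t. R t w) \<and> (\<forall>t\<ge>0. R t w \<ge> 0))
      \<and> (B 0 w = 0 \<and> continuous_on {0..} (\<lambda>t. B t w))" and AEG: "AE w in M. w \<in> G"
    by (rule AE_good_set) blast
  have [measurable]: "B (max 0 t) \<in> borel_measurable M" "R (max 0 t) \<in> borel_measurable M" for t
    using Bm Rm by auto
  (* off the good set G everything vanishes; negative times of B and R are sent to 0 *)
  define B' where "B' u w = (if w \<in> G then B (max 0 u) w else 0)" for u w
  define V where "V u w = (if w \<in> G \<and> \<not> reflected then R (max 0 u) w - B (max 0 u) w else 0)" for u w
  define b where "b u w = (if w \<in> G \<and> \<not> reflected then c * coth (R u w) else 0)" for u w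
  have B'm [measurable]: "B' u \<in> borel_measurable M" for u unfolding B'_def by measurable
  have Vm [measurable]: "V u \<in> borel_measurable M" for u unfolding V_def by measurable
  have contmax: "continuous_on UNIV (\<lambda>u. f (max 0 u))" if "continuous_on {0..} f" for f :: "real \<Rightarrow> real"
    by (rule continuous_on_compose2[OF that]) (auto intro!: continuous_intros)
  have loc: "brownian_with_increasing M B' V b 2"
  proof (unfold_locales)
    fix w assume w: "w \<in> space M"
    show "continuous_on UNIV (\<lambda>t. B' t w)" using good[of w] contmax[of "\<lambda>u. B u w"] by (cases "w \<in> G") (auto simp: B'_def)
    show "continuous_on UNIV (\<lambda>t. V t w)"
      using good[of w] contmax[of "\<lambda>u. B u w"] contmax[of "\<lambda>u. R u w"] by (cases "w \<in> G \<and> \<not> reflected") (auto simp: V_def intro!: continuous_intros)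
    fix t :: real assume t: "t \<ge> 0"
    show "set_integrable lborel {0..t} (\<lambda>u. b u w)"
    proof (cases "w \<in> G \<and> \<not> reflected")
      case True
      hence "set_integrable lborel {0..t} (\<lambda>u. coth (R u w))" using good[of w] t by (auto simp: P_def)
      thus ?thesis using True by (simp add: b_def)
    next
      case False
      thus ?thesis by (auto simp: b_def set_integrable_def)
    qed
    show "V t w = (LBINT u:{0..t}. b u w)"
    proof (cases "w \<in> G \<and> \<not> reflected")
      case True
      hence "R t w = B t w + c * (LBINT u:{0..t}. coth (R u w))" using good[of w] t by (auto simp: P_def)
      thus ?thesis using True t by (simp add: b_def V_def)
    next
      case False
      hence "V t w = 0" "\<And>u. b u w = 0" by (auto simp: V_def b_def)
      thus ?thesis by (simp add: set_lebesgue_integral_def)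
    qed
  next
    fix w and u :: real assume "w \<in> space M" "u \<ge> 0"
    thus "0 \<le> b u w" using good[of w] c0 coth_nonneg[of "R u w"] by (auto simp: b_def)
  next
    fix s t :: real assume st: "0 \<le> s" "s < t"
    define D where "D w = B t w - B s w" for w
    have [measurable]: "B t \<in> borel_measurable M" "B s \<in> borel_measurable M" using Bm st by auto
    have Dm [measurable]: "D \<in> borel_measurable M" unfolding D_def by measurable
    have "distributed M lborel D (normal_density 0 (sqrt (t - s)))" using Bd[OF st] by (simp add: D_def[abs_def])
    note mom = normal_increment_moments[OF this]
    have ts: "t - s > 0" using st by simp
    have B'D: "AE w in M. B' t w - B' s w = D w"
      using AEG by eventually_elim (use st in \<open>auto simp: B'_def D_def\<close>)
    have "AE w in M. \<bar>B' t w - B' s w\<bar> ^ 3 = \<bar>D w\<bar> ^ 3" using B'D by eventually_elim simp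
    note cong3 = integrable_cong_AE[OF _ _ this] integral_cong_AE[OF _ _ this]
    show "integrable M (\<lambda>w. \<bar>B' t w - B' s w\<bar> ^ 3)" using cong3(1) mom(5)[OF ts] by simp
    show "(\<integral>w. \<bar>B' t w - B' s w\<bar> ^ 3 \<partial>M) \<le> 2 * sqrt (t - s) ^ 3" using cong3(2) mom(6)[OF ts] by simp
    fix g :: "real \<times> real \<Rightarrow> real" assume g: "continuous_on UNIV g" "bounded (range g)"
    from g(1) have [measurable]: "g \<in> borel_measurable borel" by (rule borel_measurable_continuous_onI)
    define U where "U w = g ((if reflected then 0 else R s w - B s w), B s w)" for w
    have UF: "U \<in> borel_measurable (F s)"
    proof -
      have [measurable]: "R s \<in> borel_measurable (F s)" "B s \<in> borel_measurable (F s)" using RF BF st by auto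
      show ?thesis unfolding U_def by measurable
    qed
    have [measurable]: "U \<in> borel_measurable M" using measurable_from_subalg[OF sub UF] st by simp
    have UV: "AE w in M. g (V s w, B' s w) = U w"
      using AEG by eventually_elim (use st in \<open>auto simp: U_def V_def B'_def\<close>)
    obtain Cg where Cg: "\<And>p. \<bar>g p\<bar> \<le> Cg" using g(2) unfolding bounded_iff by auto
    have iU: "integrable M U" by (rule integrable_const_bound[where B = Cg]) (auto simp: U_def Cg)
    have ind: "indep_set (sets (F s)) {D -` S \<inter> space M | S. S \<in> sets borel}"
      using indF[OF st] unfolding D_def[abs_def] .
    have 1: "AE w in M. g (V s w, B' s w) * (B' t w - B' s w) = U w * D w" using UV B'D by eventually_elim simp
    have 2: "AE w in M. g (V s w, B' s w) * (B' t w - B' s w)\<^sup>2 = U w * (D w)\<^sup>2" using UV B'D by eventually_elim simp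
    have gm [measurable]: "(\<lambda>w. g (V s w, B' s w)) \<in> borel_measurable M" by measurable
    have "(\<integral>w. g (V s w, B' s w) * (B' t w - B' s w) \<partial>M) = (\<integral>w. U w * D w \<partial>M)"
      by (rule integral_cong_AE[OF _ _ 1]) measurable
    also have "\<dots> = 0"
      using indep_increment_integral[OF sub[OF st(1)] UF Dm ind iU, of "\<lambda>x. x"] mom(1,2)[OF ts] by simp
    finally show "(\<integral>w. g (V s w, B' s w) * (B' t w - B' s w) \<partial>M) = 0" .
    have "(\<integral>w. g (V s w, B' s w) * (B' t w - B' s w)\<^sup>2 \<partial>M) = (\<integral>w. U w * (D w)\<^sup>2 \<partial>M)"
      by (rule integral_cong_AE[OF _ _ 2]) measurable
    also have "\<dots> = (\<integral>w. U w \<partial>M) * (t - s)"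
      using indep_increment_integral[OF sub[OF st(1)] UF Dm ind iU, of "\<lambda>x. x\<^sup>2"] mom(3,4)[OF ts] by simp
    also have "(\<integral>w. U w \<partial>M) = (\<integral>w. g (V s w, B' s w) \<partial>M)"
      by (rule integral_cong_AE[symmetric, OF _ _ UV]) measurable
    finally show "(\<integral>w. g (V s w, B' s w) * (B' t w - B' s w)\<^sup>2 \<partial>M) = (t - s) * (\<integral>w. g (V s w, B' s w) \<partial>M)"
      by (simp add: mult.commute)
  qed measurable
  interpret brownian_with_increasing M B' V b 2 by (rule loc)
  define Y where "Y u w = B' u w + V u w" for u w
  define Z where "Z u w = cosh (Y u w) - 1" for u w
  have Ym [measurable]: "Y u \<in> borel_measurable M" for u unfolding Y_def by measurable
  have ccosh: "continuous_on UNIV (cosh :: real \<Rightarrow> real)" by (intro continuous_intros)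
  have [measurable]: "(cosh :: real \<Rightarrow> real) \<in> borel_measurable borel" by (rule borel_measurable_continuous_onI[OF ccosh])
  have Zm [measurable]: "Z u \<in> borel_measurable M" for u unfolding Z_def by measurable
  have Yc: "continuous_on A (\<lambda>u. Y u w)" if "w \<in> space M" for w A
    unfolding Y_def by (intro continuous_intros continuous_on_subset[OF B_cont[OF that]] continuous_on_subset[OF V_cont[OF that]]) auto
  have Zc: "continuous_on A (\<lambda>u. Z u w)" if "w \<in> space M" for w A
    unfolding Z_def by (intro continuous_intros Yc[OF that])
  have Z0: "Z u w \<ge> 0" for u w using cosh_real_ge_1[of "Y u w"] by (simp add: Z_def)
  have ZR: "Z t w = cosh (R t w) - 1" if "t \<ge> 0" "w \<in> G" for t w
    using that good[of w] by (cases reflected) (auto simp: Z_def Y_def B'_def V_def P_def)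
  (* sinh cancels the pole of coth; for alpha = - 1 / 2 both sides vanish *)
  have bY: "AE u in lborel. u \<in> {0..t} \<longrightarrow> b u w * sinh (Y u w) = c * cosh (Y u w)" if "w \<in> G" for w t
  proof (cases reflected)
    case True
    thus ?thesis by (simp add: b_def c_def reflected_def)
  next
    case False
    have "P w" using good[OF that] by blast
    hence "AE u in lborel. u \<ge> 0 \<longrightarrow> R u w \<noteq> 0" unfolding P_def if_not_P[OF False] by (rule conjunct1)
    thus ?thesis
    proof eventually_elim
      case (elim u)
      thus ?case using False that by (auto simp: b_def Y_def B'_def V_def coth_def)
    qed
  qed
  have main: "(\<integral>w. exp (- l * Z t w) \<partial>M) = 1 + (\<integral>w. (LBINT u:{0..t}. laplace_generator \<alpha> (Z u w) l) \<partial>M)" if l: "l > 0" and t: "t > 0" for l t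
  proof -
    have t0: "t \<ge> 0" using t by simp
    define J where "J w = (LBINT u:{0..t}. laplace_generator \<alpha> (Z u w) l)" for w
    define Cj where "Cj = (\<alpha> + 2) * (1 + l)"
    have Cj0: "Cj \<ge> 0" using al l by (auto simp: Cj_def)
    have jb: "\<bar>laplace_generator \<alpha> (Z u w) l\<bar> \<le> Cj" for u w
      unfolding Cj_def using laplace_generator_bound[OF Z0, of l \<alpha> u w] l al by simp
    have jc: "continuous_on A (\<lambda>u. laplace_generator \<alpha> (Z u w) l)" if "w \<in> space M" for w A
      unfolding laplace_generator_def by (intro continuous_intros Zc[OF that]) auto
    have jm [measurable]: "(\<lambda>w. laplace_generator \<alpha> (Z u w) l) \<in> borel_measurable M" for u unfolding laplace_generator_def by measurable
    have Jm [measurable]: "J \<in> borel_measurable M"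
      unfolding J_def by (rule borel_measurable_time_integral) (auto intro: jc t0)
    have jint: "set_integrable lborel {0..t} (\<lambda>u. laplace_generator \<alpha> (Z u w) l)" if "w \<in> space M" for w
      by (rule borel_integrable_atLeastAtMost'[OF jc[OF that]])
    have int_const: "(LBINT u:{0..t}. k) = k * t" for k :: real using t0 by (simp add: set_lebesgue_integral_def)
    have const_int: "set_integrable lborel {0..t} (\<lambda>u. k)" for k :: real by (rule borel_integrable_atLeastAtMost') auto
    have Jb: "\<bar>J w\<bar> \<le> Cj * t" if "w \<in> space M" for w
      unfolding J_def using set_integral_abs_le_const_mult[OF jint[OF that] const_int[of 1], of Cj] jb int_const[of 1] by simp
    have iJ: "integrable M J" by (rule integrable_const_bound[where B = "Cj * t"]) (use Jb in auto)
    note dyn = dynkin[OF exp_cosh_deriv exp_cosh_bounds[OF l] _ t, where \<sigma> = 1 and \<mu> = 0]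
    have hY: "exp_cosh l (Y u w) = exp (- l * Z u w)" for u w by (simp add: exp_cosh_def Z_def)
    have h01: "0 \<le> exp_cosh l x" "exp_cosh l x \<le> 1" for x using l cosh_real_ge_1[of x] by (auto simp: exp_cosh_def)
    have lhm [measurable]: "exp_cosh l \<in> borel_measurable borel" unfolding exp_cosh_def[abs_def] by measurable
    have est: "\<bar>(\<integral>w. exp (- l * Z t w) \<partial>M) - 1 - (\<integral>w. J w \<partial>M)\<bar> \<le> (2 + Cj * t) * (\<integral>w. 1 - exp (- e * V t w) \<partial>M)" if e: "e > 0" for e
    proof -
      define K where "K u w = exp (- e * V u w)" for u w
      have [measurable]: "K u \<in> borel_measurable M" for u unfolding K_def by measurable
      define Q where "Q w = (LBINT u:{0..t}. K u w * (exp_cosh1 l (Y u w) - e * exp_cosh l (Y u w)) * b u w) + (LBINT u:{0..t}. K u w * (exp_cosh2 l (Y u w) / 2))" for w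
      have iQ: "integrable M Q" and Qeq: "(\<integral>w. Q w \<partial>M) = (\<integral>w. K t w * exp_cosh l (Y t w) \<partial>M) - (\<integral>w. exp_cosh l (B' 0 w) \<partial>M)"
        and Q1: "\<And>w. w \<in> space M \<Longrightarrow> set_integrable lborel {0..t} (\<lambda>u. K u w * (exp_cosh1 l (Y u w) - e * exp_cosh l (Y u w)) * b u w)"
        using dyn[OF e] unfolding Q_def K_def Y_def by (simp_all add: add.commute)
      have B'0: "B' 0 w = 0" for w using good[of w] by (simp add: B'_def)
      have Q0: "(\<integral>w. exp_cosh l (B' 0 w) \<partial>M) = 1" by (simp add: B'0 exp_cosh_def prob_space)
      have K01: "0 \<le> K u w" "K u w \<le> 1" "K t w \<le> K u w" if "w \<in> space M" "0 \<le> u" "u \<le> t" for u w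
        using V_nonneg[OF that(1,2)] V_mono[OF that] e by (auto simp: K_def)
      have Qest: "\<bar>Q w - J w\<bar> \<le> (1 + Cj * t) * (1 - K t w)" if w: "w \<in> G" for w
      proof -
        have sp: "w \<in> space M" using w Gs by auto
        have Kc: "continuous_on {0..t} (\<lambda>u. K u w)"
          unfolding K_def by (intro continuous_intros continuous_on_subset[OF V_cont[OF sp]]) auto
        have hc: "continuous_on {0..t} (\<lambda>u. exp_cosh l (Y u w))" "continuous_on {0..t} (\<lambda>u. exp_cosh2 l (Y u w))"
          unfolding exp_cosh_def exp_cosh2_def by (intro continuous_intros Yc[OF sp])+
        have i2: "set_integrable lborel {0..t} (\<lambda>u. K u w * (exp_cosh2 l (Y u w) / 2))"
          by (rule borel_integrable_atLeastAtMost') (intro continuous_intros Kc hc; simp)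
        have i3: "set_integrable lborel {0..t} (\<lambda>u. K u w * laplace_generator \<alpha> (Z u w) l)"
          by (rule borel_integrable_atLeastAtMost') (intro continuous_intros Kc jc[OF sp])
        note i4 = integral_exp_V[OF sp t0, of e, folded K_def]
        (* the defect of the integrand of Q from K times the generator; it carries the factor e, and
           integral_exp_V makes its integral at most 1 - K t *)
        define E where "E u = K u w * (exp_cosh1 l (Y u w) - e * exp_cosh l (Y u w)) * b u w + K u w * (exp_cosh2 l (Y u w) / 2) - K u w * laplace_generator \<alpha> (Z u w) l" for u
        have iE: "set_integrable lborel {0..t} E" unfolding E_def using Q1[OF sp] i2 i3 by simp
        have Eeq: "AE u in lborel. u \<in> {0..t} \<longrightarrow> E u = - (e * K u w * b u w) * exp_cosh l (Y u w)"
          using bY[OF w, of t]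
        proof eventually_elim
          case (elim u)
          show ?case
          proof
            assume "u \<in> {0..t}"
            with elim have bs: "b u w * sinh (Y u w) = c * cosh (Y u w)" by simp
            have "exp_cosh1 l (Y u w) * b u w = - l * (b u w * sinh (Y u w)) * exp_cosh l (Y u w)"
              by (simp add: exp_cosh1_def)
            also have "\<dots> = - l * c * cosh (Y u w) * exp_cosh l (Y u w)" by (simp add: bs)
            finally have 1: "exp_cosh1 l (Y u w) * b u w = - l * c * cosh (Y u w) * exp_cosh l (Y u w)" .
            have s2: "(sinh (Y u w))\<^sup>2 = (cosh (Y u w))\<^sup>2 - 1" using cosh_square_eq[of "Y u w"] by simp
            have "exp_cosh1 l (Y u w) * b u w + exp_cosh2 l (Y u w) / 2 = laplace_generator \<alpha> (Z u w) l"
              unfolding 1 exp_cosh2_def laplace_generator_def hY s2 by (simp add: Z_def c_def field_simps power2_eq_square)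
            moreover have "E u = K u w * (exp_cosh1 l (Y u w) * b u w + exp_cosh2 l (Y u w) / 2 - laplace_generator \<alpha> (Z u w) l) - e * K u w * b u w * exp_cosh l (Y u w)"
              by (simp add: E_def algebra_simps)
            ultimately show "E u = - (e * K u w * b u w) * exp_cosh l (Y u w)" by simp
          qed
        qed
        have "\<bar>LBINT u:{0..t}. E u\<bar> \<le> (LBINT u:{0..t}. \<bar>E u\<bar>)" using set_integral_norm_bound[OF iE] by simp
        also have "\<dots> \<le> (LBINT u:{0..t}. e * K u w * b u w)"
        proof (rule set_integral_mono_AE)
          show "set_integrable lborel {0..t} (\<lambda>u. \<bar>E u\<bar>)" using iE by (rule set_integrable_abs)
          show "set_integrable lborel {0..t} (\<lambda>u. e * K u w * b u w)" by (rule i4(1))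
          show "AE u\<in>{0..t} in lborel. \<bar>E u\<bar> \<le> e * K u w * b u w"
            using Eeq
          proof eventually_elim
            case (elim u)
            show ?case
            proof
              assume u: "u \<in> {0..t}"
              hence "0 \<le> e * K u w * b u w" using e K01(1)[OF sp, of u] b_nonneg[OF sp, of u] by auto
              from mult_left_mono[OF h01(2)[of "Y u w"] this] mult_nonneg_nonneg[OF this h01(1)[of "Y u w"]]
              have "0 \<le> e * K u w * b u w * exp_cosh l (Y u w)" "e * K u w * b u w * exp_cosh l (Y u w) \<le> e * K u w * b u w"
                by simp_all
              moreover have "E u = - (e * K u w * b u w * exp_cosh l (Y u w))" using elim u by simp
              ultimately show "\<bar>E u\<bar> \<le> e * K u w * b u w" by linarith
            qed
          qed
        qed
        also have "\<dots> = 1 - K t w" by (rule i4(2))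
        finally have A: "\<bar>LBINT u:{0..t}. E u\<bar> \<le> 1 - K t w" .
        have Bd': "\<bar>LBINT u:{0..t}. K u w * laplace_generator \<alpha> (Z u w) l - laplace_generator \<alpha> (Z u w) l\<bar> \<le> (Cj * (1 - K t w)) * (LBINT u:{0..t}. 1)"
        proof (rule set_integral_abs_le_const_mult)
          fix u assume u: "u \<in> {0..t}"
          have "K u w * laplace_generator \<alpha> (Z u w) l - laplace_generator \<alpha> (Z u w) l = - ((1 - K u w) * laplace_generator \<alpha> (Z u w) l)"
            by (simp add: algebra_simps)
          hence "\<bar>K u w * laplace_generator \<alpha> (Z u w) l - laplace_generator \<alpha> (Z u w) l\<bar> = (1 - K u w) * \<bar>laplace_generator \<alpha> (Z u w) l\<bar>"
            using K01(2)[OF sp, of u] u by (simp add: abs_mult)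
          also have "\<dots> \<le> (1 - K t w) * Cj"
            using K01[OF sp, of u] u jb Cj0 by (intro mult_mono) auto
          finally show "\<bar>K u w * laplace_generator \<alpha> (Z u w) l - laplace_generator \<alpha> (Z u w) l\<bar> \<le> (Cj * (1 - K t w)) * 1" by (simp add: mult.commute)
        qed (use i3 jint[OF sp] const_int in auto)
        have "Q w - J w = (LBINT u:{0..t}. E u) + (LBINT u:{0..t}. K u w * laplace_generator \<alpha> (Z u w) l - laplace_generator \<alpha> (Z u w) l)"
          unfolding Q_def J_def E_def using Q1[OF sp] i2 i3 jint[OF sp] by simp
        with A Bd' show ?thesis by (simp add: int_const algebra_simps)
      qed
      have iK: "integrable M (\<lambda>w. 1 - K t w)"
        by (rule integrable_const_bound[where B = 1]) (use K01[OF _ t0] in auto)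
      have iKh: "integrable M (\<lambda>w. K t w * exp_cosh l (Y t w))"
      proof (rule integrable_const_bound[where B = 1])
        show "AE w in M. norm (K t w * exp_cosh l (Y t w)) \<le> 1"
          using K01[OF _ t0] h01 by (auto simp: abs_mult intro!: mult_le_one)
      qed measurable
      have ih: "integrable M (\<lambda>w. exp_cosh l (Y t w))"
        by (rule integrable_const_bound[where B = 1]) (use h01 in auto)
      have "(\<integral>w. exp_cosh l (Y t w) \<partial>M) - 1 - (\<integral>w. J w \<partial>M) = (\<integral>w. exp_cosh l (Y t w) - K t w * exp_cosh l (Y t w) + (Q w - J w) \<partial>M)"
        using iKh ih iQ iJ Qeq Q0 by simp
      also have "\<bar>\<dots>\<bar> \<le> (\<integral>w. \<bar>exp_cosh l (Y t w) - K t w * exp_cosh l (Y t w) + (Q w - J w)\<bar> \<partial>M)" by (rule integral_abs_bound)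
      also have "\<dots> \<le> (\<integral>w. (2 + Cj * t) * (1 - K t w) \<partial>M)"
      proof (rule integral_mono_AE)
        show "integrable M (\<lambda>w. \<bar>exp_cosh l (Y t w) - K t w * exp_cosh l (Y t w) + (Q w - J w)\<bar>)" using iKh ih iQ iJ by simp
        show "integrable M (\<lambda>w. (2 + Cj * t) * (1 - K t w))" using iK by simp
        show "AE w in M. \<bar>exp_cosh l (Y t w) - K t w * exp_cosh l (Y t w) + (Q w - J w)\<bar> \<le> (2 + Cj * t) * (1 - K t w)"
          using AEG
        proof eventually_elim
          case (elim w)
          have sp: "w \<in> space M" using elim Gs by auto
          have "\<bar>exp_cosh l (Y t w) - K t w * exp_cosh l (Y t w)\<bar> = exp_cosh l (Y t w) * (1 - K t w)"
            using h01[of "Y t w"] K01[OF sp t0] by (simp add: algebra_simps mult_left_le_one_le mult_le_cancel_right1)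
          also have "\<dots> \<le> 1 * (1 - K t w)" using h01[of "Y t w"] K01[OF sp t0] by (intro mult_right_mono) auto
          finally have "\<bar>exp_cosh l (Y t w) - K t w * exp_cosh l (Y t w)\<bar> \<le> 1 - K t w" by simp
          with Qest[OF elim] have "\<bar>exp_cosh l (Y t w) - K t w * exp_cosh l (Y t w) + (Q w - J w)\<bar> \<le> (1 - K t w) + (1 + Cj * t) * (1 - K t w)" by linarith
          thus ?case by (simp add: algebra_simps)
        qed
      qed
      finally show ?thesis by (simp add: hY K_def)
    qed
    have lim: "(\<lambda>n. (\<integral>w. 1 - exp (- (1 / real (Suc n)) * V t w) \<partial>M)) \<longlonglongrightarrow> (\<integral>w. 0 \<partial>M)"
    proof (rule integral_dominated_convergence[where w = "\<lambda>_. 1"])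
      show "AE w in M. (\<lambda>n. 1 - exp (- (1 / real (Suc n)) * V t w)) \<longlonglongrightarrow> 0"
      proof (rule AE_I2)
        fix w
        have "(\<lambda>n. 1 - exp (- (1 / real (Suc n)) * V t w)) \<longlonglongrightarrow> 1 - exp (- 0 * V t w)"
          by (intro tendsto_intros grid_step_tendsto)
        thus "(\<lambda>n. 1 - exp (- (1 / real (Suc n)) * V t w)) \<longlonglongrightarrow> 0" by simp
      qed
      show "AE w in M. norm (1 - exp (- (1 / real (Suc n)) * V t w)) \<le> 1" for n
        using V_nonneg[OF _ t0] by (auto simp del: of_nat_Suc)
    qed auto
    have "(\<lambda>n. (2 + Cj * t) * (\<integral>w. 1 - exp (- (1 / real (Suc n)) * V t w) \<partial>M)) \<longlonglongrightarrow> (2 + Cj * t) * 0"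
      using lim by (intro tendsto_intros) simp
    hence "\<bar>(\<integral>w. exp (- l * Z t w) \<partial>M) - 1 - (\<integral>w. J w \<partial>M)\<bar> \<le> (2 + Cj * t) * 0"
      by (rule LIMSEQ_le_const) (intro exI[of _ 0] allI impI est, simp)
    thus ?thesis by (simp add: J_def)
  qed
  have Z00: "Z 0 w = 0" if "w \<in> space M" for w
    using good[of w] V_0[OF that] by (simp add: Z_def Y_def B'_def)
  show ?thesis
  proof (rule that[of Z])
    show "AE w in M. Z t w = cosh (R t w) - 1" if "t \<ge> 0" for t
      using AEG by eventually_elim (use ZR that in auto)
  qed (use Zm Zc Z0 Z00 main in auto)
qed

section \<open>The exponential functional and the dual diffusion\<close>

lemma set_integral_FTC_Icc:
  fixes f F :: "real \<Rightarrow> real"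
  assumes "a \<le> b" "\<And>x. x \<in> {a..b} \<Longrightarrow> (F has_real_derivative f x) (at x within {a..b})" "continuous_on {a..b} f"
  shows "(LBINT x:{a..b}. f x) = F b - F a"
  unfolding set_lebesgue_integral_def
  by (rule integral_FTC_atLeastAtMost) (use assms in \<open>auto simp: has_real_derivative_iff_has_vector_derivative\<close>)

lemma set_integral_Icc_has_derivative:
  fixes f :: "real \<Rightarrow> real"
  assumes "continuous_on {a..b} f" "x \<in> {a..b}"
  shows "((\<lambda>u. LBINT v:{a..u}. f v) has_real_derivative f x) (at x within {a..b})"
proof -
  have "(LBINT v:{a..u}. f v) = integral {a..u} f" if "u \<in> {a..b}" for u
    by (rule set_borel_integral_eq_integral(2), rule borel_integrable_atLeastAtMost', rule continuous_on_subset[OF assms(1)])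
      (use that in auto)
  thus ?thesis
    using integral_has_real_derivative[OF assms] assms(2) unfolding has_field_derivative_def
    by (rule_tac has_derivative_transform) auto
qed

text \<open>With \<open>q = z l\<close> and \<open>y = ln (\<Lambda> / l)\<close> this is \<open>exp (- z \<Lambda>)\<close>. The functions with suffix 1, 2, 3 are
its derivatives.\<close>

definition exp_exp :: "real \<Rightarrow> real \<Rightarrow> real" where
  "exp_exp q y = exp (- q * exp y)"

definition exp_exp1 :: "real \<Rightarrow> real \<Rightarrow> real" where
  "exp_exp1 q y = - (q * exp y) * exp_exp q y"

definition exp_exp2 :: "real \<Rightarrow> real \<Rightarrow> real" where
  "exp_exp2 q y = ((q * exp y)\<^sup>2 - q * exp y) * exp_exp q y"

definition exp_exp3 :: "real \<Rightarrow> real \<Rightarrow> real" where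
  "exp_exp3 q y = (3 * (q * exp y)\<^sup>2 - q * exp y - (q * exp y) ^ 3) * exp_exp q y"

lemma exp_exp_deriv: "(exp_exp q has_real_derivative exp_exp1 q x) (at x)" "(exp_exp1 q has_real_derivative exp_exp2 q x) (at x)"
  "(exp_exp2 q has_real_derivative exp_exp3 q x) (at x)"
proof -
  show 1: "(exp_exp q has_real_derivative exp_exp1 q x) (at x)"
    unfolding exp_exp_def exp_exp1_def by (rule derivative_eq_intros refl | simp)+
  show 2: "(exp_exp1 q has_real_derivative exp_exp2 q x) (at x)"
    unfolding exp_exp1_def[abs_def] exp_exp2_def by (rule derivative_eq_intros 1 refl | simp add: exp_exp1_def power2_eq_square algebra_simps)+
  show "(exp_exp2 q has_real_derivative exp_exp3 q x) (at x)"
    unfolding exp_exp2_def[abs_def] exp_exp3_def by (rule derivative_eq_intros 1 refl | simp add: exp_exp1_def power2_eq_square power3_eq_cube algebra_simps)+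
qed

lemma exp_exp_bounds:
  assumes q: "q \<ge> 0"
  shows "\<bar>exp_exp q x\<bar> \<le> 20" "\<bar>exp_exp1 q x\<bar> \<le> 20" "\<bar>exp_exp2 q x\<bar> \<le> 20" "\<bar>exp_exp3 q x\<bar> \<le> 20"
proof -
  define r where "r = q * exp x"
  have r: "r \<ge> 0" using q by (simp add: r_def)
  have h: "exp_exp q x = exp (- r)" by (simp add: exp_exp_def r_def)
  have e: "r ^ k * exp_exp q x \<le> fact k" "0 \<le> r ^ k * exp_exp q x" for k
    using power_mult_exp_minus_le_fact[OF r, of k] r by (simp_all add: h)
  have e': "exp_exp q x \<le> 1" "0 \<le> exp_exp q x" "r * exp_exp q x \<le> 1" "0 \<le> r * exp_exp q x" "r\<^sup>2 * exp_exp q x \<le> 2" "0 \<le> r\<^sup>2 * exp_exp q x" "r ^ 3 * exp_exp q x \<le> 6" "0 \<le> r ^ 3 * exp_exp q x"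
    using e[of 0] e[of 1] e[of 2] e[of 3] by (simp_all add: fact_numeral)
  show "\<bar>exp_exp q x\<bar> \<le> 20" using e' by linarith
  have "exp_exp1 q x = - (r * exp_exp q x)" by (simp add: exp_exp1_def r_def)
  thus "\<bar>exp_exp1 q x\<bar> \<le> 20" using e' by linarith
  have "exp_exp2 q x = r\<^sup>2 * exp_exp q x - r * exp_exp q x" by (simp add: exp_exp2_def r_def left_diff_distrib)
  thus "\<bar>exp_exp2 q x\<bar> \<le> 20" using e' by linarith
  have "exp_exp3 q x = 3 * (r\<^sup>2 * exp_exp q x) - r * exp_exp q x - r ^ 3 * exp_exp q x" by (simp add: exp_exp3_def r_def left_diff_distrib)
  thus "\<bar>exp_exp3 q x\<bar> \<le> 20" using e' by linarith
qed

text \<open>The formula \<open>dynkin\<close> is applied with \<open>V = ln (1 + l a)\<close>, whose derivative is \<open>\<Lambda>\<close> itself, with sign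
\<open>\<sigma> = - 1\<close>, so that \<open>l exp (X - V) = \<Lambda>\<close>, and with \<open>\<epsilon> = \<alpha> + 1\<close>, so that the weight
\<open>exp (- \<epsilon> V)\<close> is the killing factor \<open>K\<close>. The last clause is \<open>integral_exp_V\<close> for this \<open>\<epsilon>\<close>; it
replaces a moment bound for \<open>\<Lambda>\<close>.\<close>

lemma exponential_functional_equation:
  fixes W :: "real \<Rightarrow> 'a \<Rightarrow> real"
  assumes sbm: "standard_brownian_motion N W" and al: "\<alpha> \<ge> - 1 / 2"
  obtains X a :: "real \<Rightarrow> 'a \<Rightarrow> real" where
    "\<And>u. X u \<in> borel_measurable N" "\<And>u. a u \<in> borel_measurable N"
    "\<And>w. w \<in> space N \<Longrightarrow> continuous_on UNIV (\<lambda>u. X u w)"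
    "\<And>w. w \<in> space N \<Longrightarrow> continuous_on UNIV (\<lambda>u. a u w)"
    "\<And>u w. w \<in> space N \<Longrightarrow> a u w \<ge> 0"
    "\<And>u w. w \<in> space N \<Longrightarrow> u > 0 \<Longrightarrow> a u w > 0"
    "\<And>w. a 0 w = 0" "\<And>w. X 0 w = 0"
    "AE w in N. \<forall>r\<ge>0. a r w = 4 * exp_functional W (2 * \<alpha> + 1) (r / 4) w"
    "\<And>l z t. l > 0 \<Longrightarrow> z \<ge> 0 \<Longrightarrow> t > 0 \<Longrightarrow>
      (\<integral>w. (1 + l * a t w) powr - (\<alpha> + 1) * exp (- z * (l * exp (X t w) / (1 + l * a t w))) \<partial>N)
        = exp (- l * z) + (\<integral>w. (LBINT u:{0..t}. (1 + l * a u w) powr - (\<alpha> + 1) * laplace_generator \<alpha> z (l * exp (X u w) / (1 + l * a u w))) \<partial>N)"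
    "\<And>l t w. l > 0 \<Longrightarrow> t \<ge> 0 \<Longrightarrow> w \<in> space N \<Longrightarrow>
      (LBINT u:{0..t}. (1 + l * a u w) powr - (\<alpha> + 1) * (l * exp (X u w) / (1 + l * a u w))) \<le> 1 / (\<alpha> + 1)"
proof -
  note sbm' = sbm[unfolded standard_brownian_motion_def]
  interpret prob_space N using sbm' by auto
  have Wm: "\<And>t. t \<ge> 0 \<Longrightarrow> W t \<in> borel_measurable N" using sbm' by auto
  have Wc: "AE w in N. W 0 w = 0 \<and> continuous_on {0..} (\<lambda>t. W t w)" using sbm' by auto
  have Wd: "\<And>s t. 0 \<le> s \<Longrightarrow> s < t \<Longrightarrow> distributed N lborel (\<lambda>w. W t w - W s w) (normal_density 0 (sqrt (t - s)))"
    using sbm' by auto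
  have Wi: "\<And>\<tau> n. 0 \<le> \<tau> 0 \<Longrightarrow> mono \<tau> \<Longrightarrow> indep_vars (\<lambda>_. borel) (\<lambda>i w. W (\<tau> (Suc i)) w - W (\<tau> i) w) {..<n::nat}"
    using sbm' by blast
  obtain G where G [measurable]: "G \<in> sets N" and Gs: "G \<subseteq> space N"
    and good: "\<And>w. w \<in> G \<Longrightarrow> W 0 w = 0 \<and> continuous_on {0..} (\<lambda>t. W t w)" and AEG: "AE w in N. w \<in> G"
    using AE_good_set[OF Wc] by blast
  define \<mu> where "\<mu> = \<alpha> + 1 / 2"
  have [measurable]: "W (max 0 t / 4) \<in> borel_measurable N" for t using Wm by auto
  define \<beta> where "\<beta> u w = (if w \<in> G then 2 * W (max 0 u / 4) w else 0)" for u w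
  have \<beta>m [measurable]: "\<beta> u \<in> borel_measurable N" for u unfolding \<beta>_def by measurable
  have \<beta>c: "continuous_on A (\<lambda>u. \<beta> u w)" for w A
  proof (cases "w \<in> G")
    case True
    have "continuous_on A (\<lambda>u. W (max 0 u / 4) w)"
      by (rule continuous_on_compose2[of "{0..}" "\<lambda>u. W u w"]) (use good[OF True] in \<open>auto intro!: continuous_intros\<close>)
    thus ?thesis using True by (auto simp: \<beta>_def intro!: continuous_intros)
  qed (simp add: \<beta>_def)
  have \<beta>0: "\<beta> 0 w = 0" for w using good[of w] by (simp add: \<beta>_def)
  define X where "X u w = \<beta> u w + \<mu> * u" for u w
  have X0: "X 0 w = 0" for w by (simp add: X_def \<beta>0)
  have Xm [measurable]: "X u \<in> borel_measurable N" for u unfolding X_def by measurable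
  have Xc: "continuous_on A (\<lambda>u. X u w)" for w A unfolding X_def by (intro continuous_intros \<beta>c)
  have eXc: "continuous_on A (\<lambda>u. exp (X u w))" for w A by (intro continuous_intros Xc)
  define a where "a u w = (LBINT v:{0..u}. exp (X v w))" for u w
  have aneg: "a u w = 0" if "u < 0" for u w using that by (simp add: a_def set_lebesgue_integral_def)
  have da: "((\<lambda>u. a u w) has_real_derivative exp (X x w)) (at x within {0..b})" if "x \<in> {0..b}" for x b w
    unfolding a_def by (rule set_integral_Icc_has_derivative[OF eXc that])
  have a0: "a 0 w = 0" for w by (simp add: a_def set_integral_singleton)
  have ac0: "continuous_on {0..b} (\<lambda>u. a u w)" for b w
    by (rule DERIV_continuous_on[OF da])
  have acUNIV: "continuous_on UNIV (\<lambda>u. a u w)" for w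
  proof -
    have "isCont (\<lambda>u. a (max 0 u) w) x" for x
    proof -
      have "continuous_on {..<\<bar>x\<bar> + 1} (\<lambda>u. a (max 0 u) w)"
        by (rule continuous_on_compose2[OF ac0[of "\<bar>x\<bar> + 1"]]) (auto intro!: continuous_intros)
      thus ?thesis by (rule continuous_on_interior) (simp add: interior_open)
    qed
    hence "continuous_on UNIV (\<lambda>u. a (max 0 u) w)" by (simp add: continuous_at_imp_continuous_on)
    moreover have "a (max 0 u) w = a u w" for u by (cases "u < 0") (auto simp: aneg a0 max_def)
    ultimately show ?thesis by simp
  qed
  have apos: "a u w > 0" if u0: "u > 0" for u w
  proof -
    have "\<exists>y. a u w - a 0 w = (u - 0) * y \<and> y > 0"
    proof -
      obtain z where "0 < z" "z < u" "a u w - a 0 w = (\<lambda>h. exp (X z w) * h) (u - 0)"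
      proof (rule mvt[OF u0 ac0])
        fix x assume x: "0 < x" "x < u"
        have "((\<lambda>u. a u w) has_real_derivative exp (X x w)) (at x)"
          using da[of x u w] x at_within_Icc_at[of 0 x u] by simp
        thus "((\<lambda>u. a u w) has_derivative (\<lambda>h. exp (X x w) * h)) (at x)"
          by (simp add: has_field_derivative_def)
      qed auto
      thus ?thesis by (auto simp: mult.commute)
    qed
    thus ?thesis using u0 by (auto simp: a0)
  qed
  have anonneg: "a u w \<ge> 0" for u w
    using apos[of u w] a0[of w] aneg[of u w] by (cases "u > 0"; cases "u = 0") (auto simp: less_imp_le)
  have am [measurable]: "a u \<in> borel_measurable N" for u
  proof (cases "u \<ge> 0")
    case True
    show ?thesis unfolding a_def
      by (rule borel_measurable_time_integral[OF _ eXc True]) measurable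
  next
    case False
    hence "a u = (\<lambda>_. 0)" using aneg by auto
    thus ?thesis by simp
  qed
  (* time change by the factor 4, i.e. Brownian scaling *)
  have aA: "a r w = 4 * exp_functional W (2 * \<alpha> + 1) (r / 4) w" if "w \<in> G" "r \<ge> 0" for r w
  proof -
    have "a r w = (\<integral>u. indicator {0..r} u *\<^sub>R exp (X u w) \<partial>lborel)"
      by (simp add: a_def set_lebesgue_integral_def)
    also have "\<dots> = \<bar>4\<bar> *\<^sub>R (\<integral>u. indicator {0..r} (0 + 4 * u) *\<^sub>R exp (X (0 + 4 * u) w) \<partial>lborel)"
      by (rule lborel_integral_real_affine) simp
    also have "(\<lambda>u. indicator {0..r} (0 + 4 * u) *\<^sub>R exp (X (0 + 4 * u) w)) = (\<lambda>u. indicator {0..r / 4} u *\<^sub>R exp (2 * (W u w + (2 * \<alpha> + 1) * u)))"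
      using that by (auto simp: fun_eq_iff indicator_def X_def \<beta>_def \<mu>_def algebra_simps)
    finally show ?thesis by (simp add: exp_functional_def set_lebesgue_integral_def)
  qed
  {
    fix l :: real assume l: "l > 0"
    define b where "b u w = l * exp (X u w) / (1 + l * a u w)" for u w
    define V where "V u w = ln (1 + l * a u w)" for u w
    have pos: "1 + l * a u w > 0" for u w using anonneg[of u w] l by (simp add: add_pos_nonneg)
    have ne: "1 + l * a u w \<noteq> 0" for u w using pos[of u w] by simp
    have Vm [measurable]: "V u \<in> borel_measurable N" for u unfolding V_def by measurable
    have bc: "continuous_on {0..t} (\<lambda>u. b u w)" for t w
      unfolding b_def by (intro continuous_intros Xc ac0) (use ne in auto)
    have loc: "brownian_with_increasing N \<beta> V b 16"
    proof (unfold_locales)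
      fix w assume "w \<in> space N"
      show "continuous_on UNIV (\<lambda>t. \<beta> t w)" by (rule \<beta>c)
      show "continuous_on UNIV (\<lambda>t. V t w)" unfolding V_def
        by (intro continuous_intros acUNIV) (simp add: ne)
      fix t :: real assume t: "t \<ge> 0"
      show "set_integrable lborel {0..t} (\<lambda>u. b u w)" by (rule borel_integrable_atLeastAtMost'[OF bc])
      have "(LBINT u:{0..t}. b u w) = V t w - V 0 w"
      proof (rule set_integral_FTC_Icc[OF t _ bc])
        fix x assume x: "x \<in> {0..t}"
        show "((\<lambda>t. V t w) has_real_derivative b x w) (at x within {0..t})"
          unfolding V_def b_def
          by (rule derivative_eq_intros da[OF x] refl pos | simp)+
      qed
      thus "V t w = (LBINT u:{0..t}. b u w)" by (simp add: V_def a0)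
    next
      fix w and u :: real
      show "0 \<le> b u w" using l pos[of u w] by (simp add: b_def)
    next
      fix s t :: real assume st: "0 \<le> s" "s < t"
      define D where "D w = W (t / 4) w - W (s / 4) w" for w
      have st4: "0 \<le> s / 4" "s / 4 < t / 4" "t / 4 - s / 4 > 0" using st by auto
      have [measurable]: "W (t / 4) \<in> borel_measurable N" "W (s / 4) \<in> borel_measurable N" using Wm st by auto
      have Dm [measurable]: "D \<in> borel_measurable N" unfolding D_def by measurable
      have "distributed N lborel D (normal_density 0 (sqrt (t / 4 - s / 4)))" using Wd[OF st4(1,2)] by (simp add: D_def[abs_def])
      note mom = normal_increment_moments[OF this st4(3)]
      have \<beta>D: "AE w in N. \<beta> t w - \<beta> s w = 2 * D w"
        using AEG by eventually_elim (use st in \<open>auto simp: \<beta>_def D_def\<close>)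
      have "AE w in N. \<bar>\<beta> t w - \<beta> s w\<bar> ^ 3 = 8 * \<bar>D w\<bar> ^ 3" using \<beta>D by eventually_elim (simp add: abs_mult power_mult_distrib)
      note cong3 = integrable_cong_AE[OF _ _ this] integral_cong_AE[OF _ _ this]
      show "integrable N (\<lambda>w. \<bar>\<beta> t w - \<beta> s w\<bar> ^ 3)" using cong3(1) mom(5) by simp
      have "sqrt (t / 4 - s / 4) \<le> sqrt (t - s)" using st by simp
      hence "sqrt (t / 4 - s / 4) ^ 3 \<le> sqrt (t - s) ^ 3" using st by (intro power_mono) auto
      thus "(\<integral>w. \<bar>\<beta> t w - \<beta> s w\<bar> ^ 3 \<partial>N) \<le> 16 * sqrt (t - s) ^ 3" using cong3(2) mom(6) by simp
      fix g :: "real \<times> real \<Rightarrow> real" assume g: "continuous_on UNIV g" "bounded (range g)"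
      from g(1) have gm [measurable]: "g \<in> borel_measurable borel" by (rule borel_measurable_continuous_onI)
      obtain Cg where Cg: "\<And>p. \<bar>g p\<bar> \<le> Cg" using g(2) unfolding bounded_iff by auto
      have key: "(\<integral>w. g (V s w, \<beta> s w) * f (\<beta> t w - \<beta> s w) \<partial>N) = (\<integral>w. g (V s w, \<beta> s w) \<partial>N) * (\<integral>w. f (2 * D w) \<partial>N)"
        if fm [measurable]: "f \<in> borel_measurable borel" and fi: "integrable N (\<lambda>w. f (2 * D w))" for f :: "real \<Rightarrow> real"
      proof -
        define S where "S n w = (\<Sum>i\<le>n. exp (X (grid s n i) w) * (s / real (Suc n)))" for n w
        define U where "U n w = g (ln (1 + l * S n w), \<beta> s w)" for n w
        have [measurable]: "S n \<in> borel_measurable N" for n unfolding S_def by measurable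
        have Um [measurable]: "U n \<in> borel_measurable N" for n unfolding U_def by measurable
        have Slim: "(\<lambda>n. S n w) \<longlonglongrightarrow> a s w" for w
          unfolding S_def a_def by (rule riemann_sum_tendsto[OF eXc st(1)])
        have Ulim: "(\<lambda>n. U n w) \<longlonglongrightarrow> g (V s w, \<beta> s w)" for w
        proof -
          have "(\<lambda>n. (ln (1 + l * S n w), \<beta> s w)) \<longlonglongrightarrow> (ln (1 + l * a s w), \<beta> s w)"
            by (intro tendsto_intros Slim) (rule ne)
          from continuous_on_tendsto_compose[OF g(1) this] show ?thesis by (simp add: U_def V_def)
        qed
        (* the n-th Riemann sum depends on W through finitely many increments before time s/4 *)
        have indep: "(\<integral>w. U n w * f (2 * D w) \<partial>N) = (\<integral>w. U n w \<partial>N) * (\<integral>w. f (2 * D w) \<partial>N)" for n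
        proof -
          define \<tau> where "\<tau> i = (if i \<le> Suc n then grid s n i / 4 else t / 4)" for i
          have \<tau>0: "0 \<le> \<tau> 0" by (simp add: \<tau>_def)
          have "mono \<tau>"
          proof (rule monoI)
            fix i j :: nat assume "i \<le> j"
            thus "\<tau> i \<le> \<tau> j" using grid_mono[OF st(1), of i j n] grid_le[OF st(1), of i n] st by (auto simp: \<tau>_def)
          qed
          define I where "I i w = W (\<tau> (Suc i)) w - W (\<tau> i) w" for i w
          have ind: "indep_vars (\<lambda>_. borel) I {..<Suc (Suc n)}"
            using Wi[OF \<tau>0 \<open>mono \<tau>\<close>, of "Suc (Suc n)"] unfolding I_def[abs_def] .
          define \<Phi> where "\<Phi> d = g (ln (1 + l * (\<Sum>i\<le>n. exp (2 * (\<Sum>k<i. d k) + \<mu> * grid s n i) * (s / real (Suc n)))), 2 * (\<Sum>k<Suc n. d k))" for d :: "nat \<Rightarrow> real"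
          have \<Phi>m: "\<Phi> \<in> borel_measurable (PiM {..n} (\<lambda>_. borel))"
          proof -
            have [measurable]: "(\<lambda>d. \<Sum>k<i. d k) \<in> borel_measurable (PiM {..n} (\<lambda>_. borel :: real measure))" if "i \<le> Suc n" for i
              using that by (intro borel_measurable_sum measurable_component_singleton) auto
            have [measurable]: "(\<lambda>d. \<Sum>i\<le>n. exp (2 * (\<Sum>k<i. d k) + \<mu> * grid s n i) * (s / real (Suc n))) \<in> borel_measurable (PiM {..n} (\<lambda>_. borel :: real measure))"
              by (intro borel_measurable_sum) measurable
            show ?thesis unfolding \<Phi>_def by measurable
          qed
          have \<Psi>m: "(\<lambda>d. f (2 * d (Suc n))) \<in> borel_measurable (PiM {Suc n} (\<lambda>_. borel :: real measure))" by measurable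
          have 1: "indep_var borel (\<lambda>w. \<Phi> (restrict (\<lambda>i. I i w) {..n})) borel (\<lambda>w. f (2 * restrict (\<lambda>i. I i w) {Suc n} (Suc n)))"
          proof -
            have "{..n} \<inter> {Suc n} = {}" "{..n} \<subseteq> {..<Suc (Suc n)}" "{Suc n} \<subseteq> {..<Suc (Suc n)}" by auto
            from indep_var_compose[OF indep_var_restrict[OF ind this] \<Phi>m \<Psi>m]
            show ?thesis by (simp add: o_def)
          qed
          have D: "I (Suc n) w = D w" for w by (simp add: I_def D_def \<tau>_def)
          have W\<tau>: "(\<Sum>k<i. restrict (\<lambda>i. I i w) {..n} k) = W (\<tau> i) w" if "i \<le> Suc n" "w \<in> G" for i w
          proof -
            have "(\<Sum>k<i. restrict (\<lambda>i. I i w) {..n} k) = (\<Sum>k<i. W (\<tau> (Suc k)) w - W (\<tau> k) w)"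
              using that by (intro sum.cong) (auto simp: I_def)
            also have "\<dots> = W (\<tau> i) w"
              using sum_lessThan_telescope[of "\<lambda>k. W (\<tau> k) w" i] good[OF that(2)] by (simp add: \<tau>_def)
            finally show ?thesis .
          qed
          have \<Phi>U: "\<Phi> (restrict (\<lambda>i. I i w) {..n}) = U n w" if w: "w \<in> G" for w
          proof -
            have "2 * W (\<tau> i) w = \<beta> (grid s n i) w" if "i \<le> Suc n" for i
              using that w grid_nonneg[OF st(1), of n i] by (simp add: \<tau>_def \<beta>_def)
            note * = this this[of "Suc n", simplified]
            have "(\<Sum>i\<le>n. exp (2 * (\<Sum>k<i. restrict (\<lambda>i. I i w) {..n} k) + \<mu> * grid s n i) * (s / real (Suc n))) = S n w"
              unfolding S_def X_def by (intro sum.cong refl) (use W\<tau>[OF _ w] * in simp)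
            moreover have "2 * (\<Sum>k<Suc n. restrict (\<lambda>i. I i w) {..n} k) = \<beta> s w"
              unfolding W\<tau>[OF order_refl w] by (rule *(2))
            ultimately show ?thesis by (simp only: \<Phi>_def U_def)
          qed
          have 2: "AE w in N. \<Phi> (restrict (\<lambda>i. I i w) {..n}) = U n w"
            using AEG by eventually_elim (rule \<Phi>U)
          have m1 [measurable]: "(\<lambda>w. \<Phi> (restrict (\<lambda>i. I i w) {..n})) \<in> borel_measurable N"
            using 1 by (simp add: indep_var_eq)
          have i1: "integrable N (\<lambda>w. \<Phi> (restrict (\<lambda>i. I i w) {..n}))"
            by (rule integrable_const_bound[OF AE_I2 m1, where B = Cg]) (simp only: \<Phi>_def real_norm_def Cg)
          have i2: "integrable N (\<lambda>w. f (2 * restrict (\<lambda>i. I i w) {Suc n} (Suc n)))"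
            using fi by (simp add: D)
          have "(\<integral>w. U n w * f (2 * D w) \<partial>N) = (\<integral>w. \<Phi> (restrict (\<lambda>i. I i w) {..n}) * f (2 * D w) \<partial>N)"
          proof (rule integral_cong_AE)
            show "AE w in N. U n w * f (2 * D w) = \<Phi> (restrict (\<lambda>i. I i w) {..n}) * f (2 * D w)"
              using 2 by eventually_elim simp
            have fD: "(\<lambda>w. f (2 * D w)) \<in> borel_measurable N" by measurable
            show "(\<lambda>w. U n w * f (2 * D w)) \<in> borel_measurable N"
              by (rule borel_measurable_times[OF Um fD])
            show "(\<lambda>w. \<Phi> (restrict (\<lambda>i. I i w) {..n}) * f (2 * D w)) \<in> borel_measurable N"
              by (rule borel_measurable_times[OF m1 fD])
          qed
          also have "\<dots> = (\<integral>w. \<Phi> (restrict (\<lambda>i. I i w) {..n}) \<partial>N) * (\<integral>w. f (2 * D w) \<partial>N)"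
            using indep_var_lebesgue_integral[OF 1 i1 i2] by (simp add: D)
          also have "(\<integral>w. \<Phi> (restrict (\<lambda>i. I i w) {..n}) \<partial>N) = (\<integral>w. U n w \<partial>N)"
            by (rule integral_cong_AE[OF m1 Um 2])
          finally show ?thesis .
        qed
        have gVm [measurable]: "(\<lambda>w. g (V s w, \<beta> s w)) \<in> borel_measurable N" by measurable
        have L1: "(\<lambda>n. \<integral>w. U n w \<partial>N) \<longlonglongrightarrow> (\<integral>w. g (V s w, \<beta> s w) \<partial>N)"
          by (rule integral_dominated_convergence[where w = "\<lambda>_. Cg"]) (use Ulim in \<open>auto simp: U_def Cg\<close>)
        have L2: "(\<lambda>n. \<integral>w. U n w * f (2 * D w) \<partial>N) \<longlonglongrightarrow> (\<integral>w. g (V s w, \<beta> s w) * f (2 * D w) \<partial>N)"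
        proof (rule integral_dominated_convergence[where w = "\<lambda>w. Cg * \<bar>f (2 * D w)\<bar>"])
          show "integrable N (\<lambda>w. Cg * \<bar>f (2 * D w)\<bar>)" using fi by simp
          show "AE w in N. (\<lambda>n. U n w * f (2 * D w)) \<longlonglongrightarrow> g (V s w, \<beta> s w) * f (2 * D w)"
            by (intro AE_I2 tendsto_mult_right Ulim)
          show "AE w in N. norm (U n w * f (2 * D w)) \<le> Cg * \<bar>f (2 * D w)\<bar>" for n
            by (auto simp: abs_mult U_def intro!: mult_right_mono Cg)
        qed measurable
        have "(\<integral>w. g (V s w, \<beta> s w) * f (\<beta> t w - \<beta> s w) \<partial>N) = (\<integral>w. g (V s w, \<beta> s w) * f (2 * D w) \<partial>N)"
          by (rule integral_cong_AE) (use \<beta>D in \<open>auto elim!: eventually_mono\<close>)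
        also have "\<dots> = (\<integral>w. g (V s w, \<beta> s w) \<partial>N) * (\<integral>w. f (2 * D w) \<partial>N)"
          by (rule LIMSEQ_unique[OF L2]) (unfold indep, intro tendsto_mult_right L1)
        finally show ?thesis .
      qed
      show "(\<integral>w. g (V s w, \<beta> s w) * (\<beta> t w - \<beta> s w) \<partial>N) = 0"
        using key[of "\<lambda>x. x"] mom(1,2) by simp
      show "(\<integral>w. g (V s w, \<beta> s w) * (\<beta> t w - \<beta> s w)\<^sup>2 \<partial>N) = (t - s) * (\<integral>w. g (V s w, \<beta> s w) \<partial>N)"
        using key[of "\<lambda>x. x\<^sup>2"] mom(3,4) by (simp add: power_mult_distrib)
    qed measurable
    interpret brownian_with_increasing N \<beta> V b 16 by (rule loc)
    have al0: "\<alpha> + 1 > 0" using al by simp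
    have K: "(1 + l * a u w) powr - (\<alpha> + 1) = exp (- (\<alpha> + 1) * V u w)" for u w
      using ne[of u w] by (simp add: powr_def V_def)
    have eY: "exp (X u w - V u w) = b u w / l" for u w
      using pos[of u w] l by (simp add: exp_diff V_def b_def)
    have eq: "(\<integral>w. (1 + l * a t w) powr - (\<alpha> + 1) * exp (- z * b t w) \<partial>N)
        = exp (- l * z) + (\<integral>w. (LBINT u:{0..t}. (1 + l * a u w) powr - (\<alpha> + 1) * laplace_generator \<alpha> z (b u w)) \<partial>N)"
      if z: "z \<ge> 0" and t: "t > 0" for z t
    proof -
      define q where "q = z * l"
      have q: "q \<ge> 0" using z l by (simp add: q_def)
      define Kf where "Kf u w = exp (- (\<alpha> + 1) * V u w)" for u w
      define Y where "Y u w = X u w - V u w" for u w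
      have qe: "q * exp (Y u w) = z * b u w" for u w
        using l by (simp add: Y_def eY q_def)
      have h: "exp_exp q (Y u w) = exp (- z * b u w)" for u w
        by (simp add: exp_exp_def qe)
      note dyn = dynkin[OF exp_exp_deriv exp_exp_bounds[OF q] al0 t, where \<sigma> = "-1" and \<mu> = \<mu>]
      have Yeq: "\<beta> u w + \<mu> * u + - 1 * V u w = Y u w" for u w by (simp add: Y_def X_def)
      note dyn' = dyn[unfolded Yeq, folded Kf_def]
      have c2: "continuous_on {0..t} (\<lambda>u. Kf u w * (\<mu> * exp_exp1 q (Y u w) + exp_exp2 q (Y u w) / 2))" if "w \<in> space N" for w
        unfolding Kf_def Y_def exp_exp_def exp_exp1_def exp_exp2_def
        by (intro continuous_intros Xc continuous_on_subset[OF V_cont[OF that]]) auto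
      have "(LBINT u:{0..t}. Kf u w * (- 1 * exp_exp1 q (Y u w) - (\<alpha> + 1) * exp_exp q (Y u w)) * b u w)
                   + (LBINT u:{0..t}. Kf u w * (\<mu> * exp_exp1 q (Y u w) + exp_exp2 q (Y u w) / 2))
            = (LBINT u:{0..t}. Kf u w * laplace_generator \<alpha> z (b u w))" if "w \<in> space N" for w
      proof -
        have "(LBINT u:{0..t}. Kf u w * (- 1 * exp_exp1 q (Y u w) - (\<alpha> + 1) * exp_exp q (Y u w)) * b u w)
                   + (LBINT u:{0..t}. Kf u w * (\<mu> * exp_exp1 q (Y u w) + exp_exp2 q (Y u w) / 2))
             = (LBINT u:{0..t}. Kf u w * (- 1 * exp_exp1 q (Y u w) - (\<alpha> + 1) * exp_exp q (Y u w)) * b u w + Kf u w * (\<mu> * exp_exp1 q (Y u w) + exp_exp2 q (Y u w) / 2))"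
          by (rule set_integral_add(2)[symmetric, OF dyn'(3)[OF that] borel_integrable_atLeastAtMost'[OF c2[OF that]]])
        also have "(\<lambda>u. Kf u w * (- 1 * exp_exp1 q (Y u w) - (\<alpha> + 1) * exp_exp q (Y u w)) * b u w + Kf u w * (\<mu> * exp_exp1 q (Y u w) + exp_exp2 q (Y u w) / 2))
             = (\<lambda>u. Kf u w * laplace_generator \<alpha> z (b u w))"
          unfolding exp_exp1_def exp_exp2_def qe h laplace_generator_def \<mu>_def
          by (simp add: fun_eq_iff field_simps power2_eq_square)
        finally show ?thesis .
      qed
      hence "(\<integral>w. (LBINT u:{0..t}. Kf u w * laplace_generator \<alpha> z (b u w)) \<partial>N) = (\<integral>w. Kf t w * exp_exp q (Y t w) \<partial>N) - (\<integral>w. exp_exp q (\<beta> 0 w) \<partial>N)"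
        using dyn'(2) by (simp cong: Bochner_Integration.integral_cong)
      moreover have "(\<integral>w. exp_exp q (\<beta> 0 w) \<partial>N) = exp (- l * z)"
        by (simp add: \<beta>0 exp_exp_def prob_space) (simp add: q_def mult.commute)
      ultimately show ?thesis unfolding h Kf_def K by simp
    qed
    have bd: "(LBINT u:{0..t}. (1 + l * a u w) powr - (\<alpha> + 1) * b u w) \<le> 1 / (\<alpha> + 1)" if t: "t \<ge> 0" and w: "w \<in> space N" for t w
    proof -
      have "(\<alpha> + 1) * (LBINT u:{0..t}. (1 + l * a u w) powr - (\<alpha> + 1) * b u w) = (LBINT u:{0..t}. (\<alpha> + 1) * exp (- (\<alpha> + 1) * V u w) * b u w)"
        unfolding K set_integral_mult_right[symmetric] by (simp only: mult.assoc)
      also have "\<dots> \<le> 1" using integral_exp_V(2)[OF w t, of "\<alpha> + 1"] by simp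
      finally show ?thesis using al0 by (simp add: field_simps)
    qed
    note eq bd b_def
  } note res = this
  show ?thesis
  proof (rule that[of X a])
    show "AE w in N. \<forall>r\<ge>0. a r w = 4 * exp_functional W (2 * \<alpha> + 1) (r / 4) w"
      using AEG by eventually_elim (use aA in auto)
  qed (use Xm am Xc acUNIV anonneg apos a0 X0 res(1)[unfolded res(3)] res(2)[unfolded res(3)] in auto)
qed

section \<open>Duality\<close>

text \<open>A process with continuous paths is the limit of the processes that are constant on the intervals
of length \<open>1 / (n + 1)\<close>.\<close>

lemma borel_measurable_process:
  fixes Q :: "real \<Rightarrow> 'a \<Rightarrow> real"
  assumes [measurable]: "\<And>u. Q u \<in> borel_measurable M"
    and cont: "\<And>w. w \<in> space M \<Longrightarrow> continuous_on UNIV (\<lambda>u. Q u w)"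
  shows "(\<lambda>p. Q (snd p) (fst p)) \<in> borel_measurable (M \<Otimes>\<^sub>M lborel)"
proof (rule borel_measurable_LIMSEQ_real)
  define d where "d n u = real_of_int \<lfloor>u * real (Suc n)\<rfloor> / real (Suc n)" for n u
  fix p :: "'a \<times> real" assume p: "p \<in> space (M \<Otimes>\<^sub>M lborel)"
  have "(\<lambda>n. d n (snd p)) \<longlonglongrightarrow> snd p"
  proof -
    have "\<bar>d n u - u\<bar> \<le> 1 / real (Suc n)" for n u
    proof -
      have "\<bar>real_of_int \<lfloor>u * real (Suc n)\<rfloor> - u * real (Suc n)\<bar> \<le> 1" by linarith
      hence "\<bar>real_of_int \<lfloor>u * real (Suc n)\<rfloor> - u * real (Suc n)\<bar> / real (Suc n) \<le> 1 / real (Suc n)"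
        by (rule divide_right_mono) simp
      moreover have "d n u - u = (real_of_int \<lfloor>u * real (Suc n)\<rfloor> - u * real (Suc n)) / real (Suc n)"
        unfolding d_def diff_divide_distrib by (simp del: of_nat_Suc)
      ultimately show ?thesis by (simp add: abs_divide del: of_nat_Suc)
    qed
    hence "(\<lambda>n. d n (snd p) - snd p) \<longlonglongrightarrow> 0"
      by (intro Lim_null_comparison[OF always_eventually grid_step_tendsto[of 1]]) (simp del: of_nat_Suc)
    thus ?thesis by (rule LIM_zero_cancel)
  qed
  moreover have "isCont (\<lambda>u. Q u (fst p)) (snd p)"
    using cont[of "fst p"] p by (auto simp: space_pair_measure continuous_on_eq_continuous_at)
  ultimately show "(\<lambda>n. Q (d n (snd p)) (fst p)) \<longlonglongrightarrow> Q (snd p) (fst p)"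
    by (rule isCont_tendsto_compose[rotated])
next
  fix n :: nat
  have "(\<lambda>p. Q (real_of_int i / real (Suc n)) (fst p)) \<in> borel_measurable (M \<Otimes>\<^sub>M lborel)" for i by measurable
  moreover have "(\<lambda>p. \<lfloor>snd p * real (Suc n)\<rfloor>) \<in> measurable (M \<Otimes>\<^sub>M lborel) (count_space UNIV)" by measurable
  ultimately show "(\<lambda>p. Q (real_of_int \<lfloor>snd p * real (Suc n)\<rfloor> / real (Suc n)) (fst p)) \<in> borel_measurable (M \<Otimes>\<^sub>M lborel)"
    by (rule measurable_compose_countable)
qed

lemma (in prob_space) continuous_on_expectation:
  fixes Q :: "real \<Rightarrow> 'a \<Rightarrow> real"
  assumes Qm [measurable]: "\<And>u. Q u \<in> borel_measurable M" and Qc: "\<And>w. w \<in> space M \<Longrightarrow> continuous_on UNIV (\<lambda>u. Q u w)"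
    and Qb: "\<And>u w. w \<in> space M \<Longrightarrow> \<bar>Q u w\<bar> \<le> 1"
  shows "continuous_on UNIV (\<lambda>u. \<integral>w. Q u w \<partial>M)"
  unfolding continuous_on_sequentially
proof (intro ballI allI impI, elim conjE)
  fix x :: real and s :: "nat \<Rightarrow> real" assume s: "s \<longlonglongrightarrow> x"
  show "((\<lambda>u. \<integral>w. Q u w \<partial>M) \<circ> s) \<longlonglongrightarrow> (\<integral>w. Q x w \<partial>M)"
    unfolding o_def
  proof (rule integral_dominated_convergence[where w = "\<lambda>_. 1"])
    show "AE w in M. (\<lambda>n. Q (s n) w) \<longlonglongrightarrow> Q x w"
      by (intro AE_I2 continuous_on_tendsto_compose[OF Qc s]) auto
  qed (use Qb in auto)
qed

text \<open>To avoid differentiating \<open>G s r = E (K r exp (- \<Lambda> r Z s))\<close>, integrate the generator term over the triangle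
\<open>u + r \<le> T\<close> in both orders. One order gives the integral of \<open>G u (T - u) - G u 0\<close>, the other that of
\<open>G (T - r) r - G 0 r\<close>, and the contributions of the hypotenuse agree. So \<open>G u 0\<close> and \<open>G 0 u\<close> have
the same integral over \<open>0 \<le> u \<le> T\<close> for every \<open>T\<close>; both are continuous in \<open>u\<close>, hence equal.\<close>

lemma laplace_duality:
  fixes Z :: "real \<Rightarrow> 'a \<Rightarrow> real" and K \<Lambda> :: "real \<Rightarrow> 'b \<Rightarrow> real"
  assumes "prob_space M" "prob_space N" and al: "\<alpha> \<ge> - 1"
    and Zm [measurable]: "\<And>u. Z u \<in> borel_measurable M"
    and Zc: "\<And>w. w \<in> space M \<Longrightarrow> continuous_on UNIV (\<lambda>u. Z u w)"
    and Z0: "\<And>u w. Z u w \<ge> 0" and Z00: "\<And>w. w \<in> space M \<Longrightarrow> Z 0 w = 0"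
    and Zeq: "\<And>x t. x > 0 \<Longrightarrow> t > 0 \<Longrightarrow> (\<integral>w. exp (- x * Z t w) \<partial>M) = 1 + (\<integral>w. (LBINT u:{0..t}. laplace_generator \<alpha> (Z u w) x) \<partial>M)"
    and Km [measurable]: "\<And>u. K u \<in> borel_measurable N" and Lm [measurable]: "\<And>u. \<Lambda> u \<in> borel_measurable N"
    and Kc: "\<And>w. w \<in> space N \<Longrightarrow> continuous_on UNIV (\<lambda>u. K u w)"
    and Lc: "\<And>w. w \<in> space N \<Longrightarrow> continuous_on UNIV (\<lambda>u. \<Lambda> u w)"
    and K01: "\<And>u w. w \<in> space N \<Longrightarrow> 0 \<le> K u w" "\<And>u w. w \<in> space N \<Longrightarrow> K u w \<le> 1"
    and L0: "\<And>u w. w \<in> space N \<Longrightarrow> \<Lambda> u w > 0"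
    and K00: "\<And>w. w \<in> space N \<Longrightarrow> K 0 w = 1" and L00: "\<And>w. w \<in> space N \<Longrightarrow> \<Lambda> 0 w = l"
    and Keq: "\<And>z t. z \<ge> 0 \<Longrightarrow> t > 0 \<Longrightarrow> (\<integral>w. K t w * exp (- z * \<Lambda> t w) \<partial>N)
        = exp (- l * z) + (\<integral>w. (LBINT u:{0..t}. K u w * laplace_generator \<alpha> z (\<Lambda> u w)) \<partial>N)"
    and Kbd: "\<And>t w. t \<ge> 0 \<Longrightarrow> w \<in> space N \<Longrightarrow> (LBINT u:{0..t}. K u w * \<Lambda> u w) \<le> c"
    and l: "l > 0" and t: "t > 0"
  shows "(\<integral>w. exp (- l * Z t w) \<partial>M) = (\<integral>w. K t w \<partial>N)"
proof -
  interpret M: prob_space M by fact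
  interpret N: prob_space N by fact
  interpret MT: pair_sigma_finite M lborel ..
  interpret NT: pair_sigma_finite N lborel ..
  interpret LM: sigma_finite_measure "M \<Otimes>\<^sub>M lborel" by (rule sigma_finite_pair_measure) unfold_locales
  interpret LN: sigma_finite_measure "N \<Otimes>\<^sub>M lborel" by (rule sigma_finite_pair_measure) unfold_locales
  interpret P: pair_sigma_finite "M \<Otimes>\<^sub>M lborel" "N \<Otimes>\<^sub>M lborel" ..
  interpret MN: pair_prob_space M N ..
  let ?P = "M \<Otimes>\<^sub>M lborel"
  let ?Q = "N \<Otimes>\<^sub>M lborel"
  note Zj [measurable] = borel_measurable_process[OF Zm Zc]
  note Kj [measurable] = borel_measurable_process[OF Km Kc]
  note Lj [measurable] = borel_measurable_process[OF Lm Lc]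
  define \<phi> where "\<phi> s x = (\<integral>w. exp (- x * Z s w) \<partial>M)" for s x
  define \<psi> where "\<psi> r z = (\<integral>w. K r w * exp (- z * \<Lambda> r w) \<partial>N)" for r z
  define k where "k r = (\<integral>w. K r w \<partial>N)" for r
  have \<phi>eq: "\<phi> s x = 1 + (\<integral>w. (LBINT u:{0..s}. laplace_generator \<alpha> (Z u w) x) \<partial>M)" if "x > 0" "s \<ge> 0" for s x
  proof (cases "s = 0")
    case True
    thus ?thesis by (simp add: \<phi>_def set_integral_singleton Z00 M.prob_space cong: Bochner_Integration.integral_cong)
  qed (use Zeq that in \<open>auto simp: \<phi>_def\<close>)
  have \<psi>eq: "\<psi> r z = exp (- l * z) + (\<integral>w. (LBINT u:{0..r}. K u w * laplace_generator \<alpha> z (\<Lambda> u w)) \<partial>N)" if "z \<ge> 0" "r \<ge> 0" for r z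
  proof (cases "r = 0")
    case True
    thus ?thesis by (simp add: \<psi>_def set_integral_singleton K00 L00 N.prob_space mult.commute cong: Bochner_Integration.integral_cong)
  qed (use Keq that in \<open>auto simp: \<psi>_def\<close>)
  define C where "C = \<alpha> + 2"
  have C: "C \<ge> 0" using al by (simp add: C_def)
  have jb: "\<bar>laplace_generator \<alpha> z x\<bar> \<le> C * (1 + x)" if "z \<ge> 0" "x \<ge> 0" for z x
    using laplace_generator_bound[OF that al] by (simp add: C_def)
  have T: "(LBINT u:{0..T}. \<phi> u l) = (LBINT u:{0..T}. k u)" if T: "T \<ge> 0" for T
  proof -
    define i where "i u = indicat_real {0..T} u" for u
    have i_meas [measurable]: "i \<in> borel_measurable borel" unfolding i_def by measurable
    have i01: "0 \<le> i u" "i u \<le> 1" "\<bar>i u\<bar> = i u" for u by (auto simp: i_def indicator_def)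
    have iI: "integrable lborel i" unfolding i_def using T by simp
    have iL: "integrable ?P (\<lambda>p. i (snd p))"
      by (rule MT.Fubini_integrable) (use iI i01 in auto)
    have iLN: "integrable ?Q (\<lambda>p. i (snd p))"
      by (rule NT.Fubini_integrable) (use iI i01 in auto)
    define g where "g q = i (snd q) * (K (snd q) (fst q) * (1 + \<Lambda> (snd q) (fst q)))" for q
    have g0: "g q \<ge> 0" if "q \<in> space ?Q" for q
      using that i01[of "snd q"] K01(1)[of "fst q" "snd q"] L0[of "fst q" "snd q"] unfolding g_def space_pair_measure
      by (intro mult_nonneg_nonneg) auto
    have gm [measurable]: "g \<in> borel_measurable ?Q" unfolding g_def by measurable
    have gc: "continuous_on {0..T} (\<lambda>r. K r w * (1 + \<Lambda> r w))" if "w \<in> space N" for w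
      by (intro continuous_intros continuous_on_subset[OF Kc[OF that]] continuous_on_subset[OF Lc[OF that]]) auto
    have gi: "integrable lborel (\<lambda>r. g (w, r))" if "w \<in> space N" for w
      using borel_integrable_atLeastAtMost'[OF gc[OF that]] unfolding g_def i_def set_integrable_def by simp
    have gI: "integrable ?Q g"
    proof (rule NT.Fubini_integrable[OF gm])
      show "AE w in N. integrable lborel (\<lambda>r. g (w, r))" using gi by auto
      have n: "(\<integral>r. norm (g (w, r)) \<partial>lborel) = (LBINT r:{0..T}. K r w * (1 + \<Lambda> r w))" if "w \<in> space N" for w
      proof -
        have "norm (g (w, r)) = indicator {0..T} r *\<^sub>R (K r w * (1 + \<Lambda> r w))" for r
          using g0[of "(w, r)"] that by (simp add: space_pair_measure g_def i_def)
        thus ?thesis by (simp add: set_lebesgue_integral_def)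
      qed
      have b: "norm (\<integral>r. norm (g (w, r)) \<partial>lborel) \<le> T + c" if w: "w \<in> space N" for w
      proof -
        have Kc': "continuous_on {0..T} (\<lambda>r. K r w)" by (rule continuous_on_subset[OF Kc[OF w]]) simp
        have Lc': "continuous_on {0..T} (\<lambda>r. K r w * \<Lambda> r w)"
          by (intro continuous_intros Kc' continuous_on_subset[OF Lc[OF w]]) auto
        note int = borel_integrable_atLeastAtMost'[OF Kc'] borel_integrable_atLeastAtMost'[OF Lc']
        have c1: "set_integrable lborel {0..T} (\<lambda>_. 1 :: real)" by (rule borel_integrable_atLeastAtMost') auto
        have "(LBINT r:{0..T}. K r w * (1 + \<Lambda> r w)) = (LBINT r:{0..T}. K r w) + (LBINT r:{0..T}. K r w * \<Lambda> r w)"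
          using set_integral_add(2)[OF int] by (simp add: distrib_left)
        also have "(LBINT r:{0..T}. K r w) \<le> (LBINT r:{0..T}. 1)"
          by (rule set_integral_mono[OF int(1) c1]) (rule K01(2)[OF w])
        also have "(LBINT r:{0..T}. 1) = T" using T by (simp add: set_lebesgue_integral_def)
        finally have "(LBINT r:{0..T}. K r w * (1 + \<Lambda> r w)) \<le> T + c" using Kbd[OF T w] by simp
        hence "(\<integral>r. norm (g (w, r)) \<partial>lborel) \<le> T + c" by (simp only: n[OF w])
        moreover have "0 \<le> (\<integral>r. norm (g (w, r)) \<partial>lborel)" by (rule Bochner_Integration.integral_nonneg) simp
        ultimately show ?thesis by (simp only: real_norm_def abs_of_nonneg)
      qed
      show "integrable N (\<lambda>w. \<integral>r. norm (g (w, r)) \<partial>lborel)"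
      proof (rule N.integrable_const_bound[where B = "T + c"])
        show "AE w in N. norm (\<integral>r. norm (g (w, r)) \<partial>lborel) \<le> T + c" by (rule AE_I2[OF b])
      qed measurable
    qed
    (* indicator of the triangle, bounded by that of the square to separate the variables *)
    define tri where "tri u r = (if 0 \<le> u \<and> 0 \<le> r \<and> u + r \<le> T then 1 else 0 :: real)" for u r
    have tri_meas [measurable]: "(\<lambda>p. tri (fst p) (snd p)) \<in> borel_measurable (borel \<Otimes>\<^sub>M borel)"
      unfolding tri_def by measurable
    have tri_le: "0 \<le> tri u r" "tri u r \<le> i u * i r" for u r by (auto simp: tri_def i_def)
    define H where "H p q = tri (snd p) (snd q) * (K (snd q) (fst q) * laplace_generator \<alpha> (Z (snd p) (fst p)) (\<Lambda> (snd q) (fst q)))" for p :: "'a \<times> real" and q :: "'b \<times> real"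
    have Hm [measurable]: "(\<lambda>(p, q). H p q) \<in> borel_measurable (?P \<Otimes>\<^sub>M ?Q)"
    proof -
      have [measurable]: "(\<lambda>x. tri (snd (fst x)) (snd (snd x))) \<in> borel_measurable (?P \<Otimes>\<^sub>M ?Q)"
        unfolding tri_def by measurable
      have [measurable]: "(\<lambda>x. Z (snd (fst x)) (fst (fst x))) \<in> borel_measurable (?P \<Otimes>\<^sub>M ?Q)"
        by (rule measurable_compose[OF measurable_fst Zj])
      have [measurable]: "(\<lambda>x. K (snd (snd x)) (fst (snd x))) \<in> borel_measurable (?P \<Otimes>\<^sub>M ?Q)"
        by (rule measurable_compose[OF measurable_snd Kj])
      have [measurable]: "(\<lambda>x. \<Lambda> (snd (snd x)) (fst (snd x))) \<in> borel_measurable (?P \<Otimes>\<^sub>M ?Q)"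
        by (rule measurable_compose[OF measurable_snd Lj])
      show ?thesis unfolding H_def laplace_generator_def case_prod_beta by measurable
    qed
    have Hb: "\<bar>H p q\<bar> \<le> i (snd p) * (C * g q)" if q: "q \<in> space ?Q" for p q
    proof -
      from q have q': "fst q \<in> space N" by (auto simp: space_pair_measure)
      have "\<bar>laplace_generator \<alpha> (Z (snd p) (fst p)) (\<Lambda> (snd q) (fst q))\<bar> \<le> C * (1 + \<Lambda> (snd q) (fst q))"
        using L0[OF q', of "snd q"] by (intro jb Z0) auto
      hence "\<bar>K (snd q) (fst q) * laplace_generator \<alpha> (Z (snd p) (fst p)) (\<Lambda> (snd q) (fst q))\<bar> \<le> K (snd q) (fst q) * (C * (1 + \<Lambda> (snd q) (fst q)))"
        using K01(1)[OF q', of "snd q"] by (auto simp: abs_mult intro!: mult_left_mono)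
      with tri_le have "\<bar>H p q\<bar> \<le> (i (snd p) * i (snd q)) * (K (snd q) (fst q) * (C * (1 + \<Lambda> (snd q) (fst q))))"
        unfolding H_def abs_mult[of "tri _ _"] using i01 by (intro mult_mono) auto
      thus ?thesis by (simp add: g_def mult_ac)
    qed
    have HI: "integrable (?P \<Otimes>\<^sub>M ?Q) (\<lambda>(p, q). H p q)"
    proof (rule Bochner_Integration.integrable_bound)
      show "integrable (?P \<Otimes>\<^sub>M ?Q) (\<lambda>x. i (snd (fst x)) * (C * g (snd x)))"
      proof (rule P.Fubini_integrable)
        show "(\<lambda>x. i (snd (fst x)) * (C * g (snd x))) \<in> borel_measurable (?P \<Otimes>\<^sub>M ?Q)" by measurable
        show "integrable ?P (\<lambda>p. \<integral>q. norm (i (snd (fst (p, q))) * (C * g (snd (p, q)))) \<partial>?Q)"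
          using iL by (simp add: abs_mult i01)
        show "AE p in ?P. integrable ?Q (\<lambda>q. i (snd (fst (p, q))) * (C * g (snd (p, q))))"
          using gI by simp
      qed
      show "AE x in ?P \<Otimes>\<^sub>M ?Q. norm (case x of (p, q) \<Rightarrow> H p q) \<le> norm (i (snd (fst x)) * (C * g (snd x)))"
      proof (rule AE_I2)
        fix x :: "('a \<times> real) \<times> ('b \<times> real)" assume "x \<in> space (?P \<Otimes>\<^sub>M ?Q)"
        hence "snd x \<in> space ?Q" by (auto simp: space_pair_measure)
        from order.trans[OF Hb[OF this, of "fst x"] abs_ge_self]
        show "norm (case x of (p, q) \<Rightarrow> H p q) \<le> norm (i (snd (fst x)) * (C * g (snd x)))" by (simp add: case_prod_beta)
      qed
    qed (rule Hm)
    have HIq: "integrable ?Q (H p)" if p: "p \<in> space ?P" for p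
    proof (rule Bochner_Integration.integrable_bound)
      show "integrable ?Q (\<lambda>q. i (snd p) * (C * g q))" using gI by simp
      show "H p \<in> borel_measurable ?Q" using measurable_Pair2[OF Hm p] by simp
      show "AE q in ?Q. norm (H p q) \<le> norm (i (snd p) * (C * g q))"
        using order.trans[OF Hb abs_ge_self] by auto
    qed
    have HIp: "integrable ?P (\<lambda>p. H p q)" if q: "q \<in> space ?Q" for q
    proof (rule Bochner_Integration.integrable_bound)
      show "integrable ?P (\<lambda>p. i (snd p) * (C * g q))" using iL by simp
      show "(\<lambda>p. H p q) \<in> borel_measurable ?P" using measurable_Pair1[OF Hm q] by simp
      show "AE p in ?P. norm (H p q) \<le> norm (i (snd p) * (C * g q))"
        using order.trans[OF Hb[OF q] abs_ge_self] by auto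
    qed
    have inner1: "(\<integral>q. H p q \<partial>?Q) = i (snd p) * \<psi> (T - snd p) (Z (snd p) (fst p)) - i (snd p) * exp (- l * Z (snd p) (fst p))"
      if p: "p \<in> space ?P" for p
    proof -
      have "(\<integral>q. H p q \<partial>?Q) = (\<integral>w. (\<integral>r. H p (w, r) \<partial>lborel) \<partial>N)"
        by (rule NT.integral_fst'[symmetric, OF HIq[OF p]])
      also have "\<dots> = (\<integral>w. i (snd p) * (LBINT r:{0..T - snd p}. K r w * laplace_generator \<alpha> (Z (snd p) (fst p)) (\<Lambda> r w)) \<partial>N)"
      proof (rule Bochner_Integration.integral_cong[OF refl])
        fix w
        have "H p (w, r) = i (snd p) * (indicator {0..T - snd p} r *\<^sub>R (K r w * laplace_generator \<alpha> (Z (snd p) (fst p)) (\<Lambda> r w)))" for r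
          by (auto simp: H_def tri_def i_def indicator_def)
        thus "(\<integral>r. H p (w, r) \<partial>lborel) = i (snd p) * (LBINT r:{0..T - snd p}. K r w * laplace_generator \<alpha> (Z (snd p) (fst p)) (\<Lambda> r w))"
          by (simp add: set_lebesgue_integral_def)
      qed
      also have "\<dots> = i (snd p) * (\<integral>w. (LBINT r:{0..T - snd p}. K r w * laplace_generator \<alpha> (Z (snd p) (fst p)) (\<Lambda> r w)) \<partial>N)" by simp
      also have "\<dots> = i (snd p) * (\<psi> (T - snd p) (Z (snd p) (fst p)) - exp (- l * Z (snd p) (fst p)))"
      proof (cases "snd p \<in> {0..T}")
        case True
        thus ?thesis using \<psi>eq[OF Z0[of "snd p" "fst p"], of "T - snd p"] by simp
      qed (simp add: i_def)
      finally show ?thesis by (simp add: right_diff_distrib)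
    qed
    have inner2: "(\<integral>p. H p q \<partial>?P) = i (snd q) * (K (snd q) (fst q) * \<phi> (T - snd q) (\<Lambda> (snd q) (fst q))) - i (snd q) * K (snd q) (fst q)"
      if q: "q \<in> space ?Q" for q
    proof -
      from q have q': "fst q \<in> space N" by (auto simp: space_pair_measure)
      have "(\<integral>p. H p q \<partial>?P) = (\<integral>w. (\<integral>u. H (w, u) q \<partial>lborel) \<partial>M)"
        by (rule MT.integral_fst'[symmetric, OF HIp[OF q]])
      also have "\<dots> = (\<integral>w. i (snd q) * K (snd q) (fst q) * (LBINT u:{0..T - snd q}. laplace_generator \<alpha> (Z u w) (\<Lambda> (snd q) (fst q))) \<partial>M)"
      proof (rule Bochner_Integration.integral_cong[OF refl])
        fix w
        have "H (w, u) q = i (snd q) * K (snd q) (fst q) * (indicator {0..T - snd q} u *\<^sub>R (laplace_generator \<alpha> (Z u w) (\<Lambda> (snd q) (fst q))))" for u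
          by (auto simp: H_def tri_def i_def indicator_def)
        thus "(\<integral>u. H (w, u) q \<partial>lborel) = i (snd q) * K (snd q) (fst q) * (LBINT u:{0..T - snd q}. laplace_generator \<alpha> (Z u w) (\<Lambda> (snd q) (fst q)))"
          by (simp add: set_lebesgue_integral_def)
      qed
      also have "\<dots> = i (snd q) * K (snd q) (fst q) * (\<integral>w. (LBINT u:{0..T - snd q}. laplace_generator \<alpha> (Z u w) (\<Lambda> (snd q) (fst q))) \<partial>M)" by simp
      also have "\<dots> = i (snd q) * K (snd q) (fst q) * (\<phi> (T - snd q) (\<Lambda> (snd q) (fst q)) - 1)"
      proof (cases "snd q \<in> {0..T}")
        case True
        thus ?thesis using \<phi>eq[OF L0[OF q', of "snd q"], of "T - snd q"] by simp
      qed (simp add: i_def)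
      finally show ?thesis by (simp add: right_diff_distrib)
    qed
    have E1: "integrable ?P (\<lambda>p. i (snd p) * exp (- l * Z (snd p) (fst p)))"
    proof (rule Bochner_Integration.integrable_bound[OF iL])
      show "AE p in ?P. norm (i (snd p) * exp (- l * Z (snd p) (fst p))) \<le> norm (i (snd p))"
        using l Z0 i01 by (auto simp: abs_mult intro!: mult_left_le)
    qed measurable
    have E2: "integrable ?Q (\<lambda>q. i (snd q) * K (snd q) (fst q))"
    proof (rule Bochner_Integration.integrable_bound[OF iLN])
      show "AE q in ?Q. norm (i (snd q) * K (snd q) (fst q)) \<le> norm (i (snd q))"
        using K01 i01 by (auto simp: abs_mult space_pair_measure intro!: mult_left_le)
    qed measurable
    have F1: "integrable ?P (\<lambda>p. i (snd p) * \<psi> (T - snd p) (Z (snd p) (fst p)))"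
    proof -
      have "integrable ?P (\<lambda>p. (\<integral>q. H p q \<partial>?Q) + i (snd p) * exp (- l * Z (snd p) (fst p)))"
        using P.integrable_fst'[OF HI] E1 by simp
      thus ?thesis by (rule Bochner_Integration.integrable_cong[THEN iffD1, OF refl, rotated]) (simp add: inner1)
    qed
    have F2: "integrable ?Q (\<lambda>q. i (snd q) * (K (snd q) (fst q) * \<phi> (T - snd q) (\<Lambda> (snd q) (fst q))))"
    proof -
      have "integrable ?Q (\<lambda>q. (\<integral>p. H p q \<partial>?P) + i (snd q) * K (snd q) (fst q))"
        using P.integrable_snd[OF HI] E2 by simp
      thus ?thesis by (rule Bochner_Integration.integrable_cong[THEN iffD1, OF refl, rotated]) (simp add: inner2)
    qed
    define A1 where "A1 u = (\<integral>w. \<psi> (T - u) (Z u w) \<partial>M)" for u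
    define A2 where "A2 r = (\<integral>w. K r w * \<phi> (T - r) (\<Lambda> r w) \<partial>N)" for r
    (* both are G at a point of the hypotenuse *)
    have A12: "A1 (T - r) = A2 r" for r
    proof -
      have int: "integrable (M \<Otimes>\<^sub>M N) (\<lambda>(x, y). K r y * exp (- Z (T - r) x * \<Lambda> r y))"
      proof (rule MN.integrable_const_bound[where B = 1])
        show "AE p in M \<Otimes>\<^sub>M N. norm (case p of (x, y) \<Rightarrow> K r y * exp (- Z (T - r) x * \<Lambda> r y)) \<le> 1"
        proof (rule AE_I2, clarsimp simp: space_pair_measure abs_mult)
          fix x y assume "y \<in> space N"
          note y = K01[OF this, of r] L0[OF this, of r]
          have "exp (- (Z (T - r) x * \<Lambda> r y)) \<le> 1" using y Z0[of "T - r" x] by auto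
          thus "\<bar>K r y\<bar> * exp (- (Z (T - r) x * \<Lambda> r y)) \<le> 1" using y by (auto intro!: mult_le_one)
        qed
      qed measurable
      have "A1 (T - r) = (\<integral>x. (\<integral>y. K r y * exp (- Z (T - r) x * \<Lambda> r y) \<partial>N) \<partial>M)"
        by (simp add: A1_def \<psi>_def)
      also have "\<dots> = (\<integral>y. (\<integral>x. K r y * exp (- Z (T - r) x * \<Lambda> r y) \<partial>M) \<partial>N)"
        by (rule MN.Fubini_integral[symmetric, OF int])
      also have "\<dots> = A2 r" by (simp add: A2_def \<phi>_def mult.commute)
      finally show ?thesis .
    qed
    have S1: "(\<integral>p. (\<integral>q. H p q \<partial>?Q) \<partial>?P) = (\<integral>u. i u * A1 u \<partial>lborel) - (LBINT u:{0..T}. \<phi> u l)"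
    proof -
      have "(\<integral>p. (\<integral>q. H p q \<partial>?Q) \<partial>?P)
          = (\<integral>p. i (snd p) * \<psi> (T - snd p) (Z (snd p) (fst p)) \<partial>?P) - (\<integral>p. i (snd p) * exp (- l * Z (snd p) (fst p)) \<partial>?P)"
        using F1 E1 by (simp add: inner1 cong: Bochner_Integration.integral_cong)
      also have "(\<integral>p. i (snd p) * \<psi> (T - snd p) (Z (snd p) (fst p)) \<partial>?P) = (\<integral>u. i u * A1 u \<partial>lborel)"
        using MT.integral_snd[of "\<lambda>w u. i u * \<psi> (T - u) (Z u w)"] F1 by (simp add: case_prod_beta' A1_def)
      also have "(\<integral>p. i (snd p) * exp (- l * Z (snd p) (fst p)) \<partial>?P) = (LBINT u:{0..T}. \<phi> u l)"
        using MT.integral_snd[of "\<lambda>w u. i u * exp (- l * Z u w)"] E1 by (simp add: case_prod_beta' \<phi>_def set_lebesgue_integral_def i_def)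
      finally show ?thesis .
    qed
    have S2: "(\<integral>q. (\<integral>p. H p q \<partial>?P) \<partial>?Q) = (\<integral>r. i r * A2 r \<partial>lborel) - (LBINT u:{0..T}. k u)"
    proof -
      have "(\<integral>q. (\<integral>p. H p q \<partial>?P) \<partial>?Q)
          = (\<integral>q. i (snd q) * (K (snd q) (fst q) * \<phi> (T - snd q) (\<Lambda> (snd q) (fst q))) \<partial>?Q) - (\<integral>q. i (snd q) * K (snd q) (fst q) \<partial>?Q)"
        using F2 E2 by (simp add: inner2 cong: Bochner_Integration.integral_cong)
      also have "(\<integral>q. i (snd q) * (K (snd q) (fst q) * \<phi> (T - snd q) (\<Lambda> (snd q) (fst q))) \<partial>?Q) = (\<integral>r. i r * A2 r \<partial>lborel)"
        using NT.integral_snd[of "\<lambda>w r. i r * (K r w * \<phi> (T - r) (\<Lambda> r w))"] F2 by (simp add: case_prod_beta' A2_def)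
      also have "(\<integral>q. i (snd q) * K (snd q) (fst q) \<partial>?Q) = (LBINT u:{0..T}. k u)"
        using NT.integral_snd[of "\<lambda>w u. i u * K u w"] E2 by (simp add: case_prod_beta' k_def set_lebesgue_integral_def i_def)
      finally show ?thesis .
    qed
    have "(\<integral>u. i u * A1 u \<partial>lborel) = (\<integral>r. i (T - r) * A1 (T - r) \<partial>lborel)"
      using lborel_integral_real_affine[of "-1" "\<lambda>u. i u * A1 u" T] by simp
    also have "\<dots> = (\<integral>r. i r * A2 r \<partial>lborel)"
      by (rule Bochner_Integration.integral_cong[OF refl]) (auto simp: A12 i_def indicator_def)
    finally have "(\<integral>u. i u * A1 u \<partial>lborel) = (\<integral>r. i r * A2 r \<partial>lborel)" .
    moreover have "(\<integral>q. (\<integral>p. H p q \<partial>?P) \<partial>?Q) = (\<integral>p. (\<integral>q. H p q \<partial>?Q) \<partial>?P)"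
      by (rule P.Fubini_integral[OF HI])
    ultimately show ?thesis using S1 S2 by simp
  qed
  have \<phi>c: "continuous_on UNIV (\<lambda>u. \<phi> u l)" unfolding \<phi>_def
    by (rule M.continuous_on_expectation) (use Zc Z0 l in \<open>auto intro!: continuous_intros\<close>)
  have kc: "continuous_on UNIV k" unfolding k_def
    by (rule N.continuous_on_expectation) (use Kc K01 in auto)
  have d: "((\<lambda>u. LBINT v:{0..u}. f v) has_real_derivative f t) (at t)" if "continuous_on UNIV f" for f :: "real \<Rightarrow> real"
    using set_integral_Icc_has_derivative[OF continuous_on_subset[OF that], of 0 "t + 1" t] t at_within_Icc_at[of 0 t "t + 1"] by simp
  have ev: "\<forall>\<^sub>F u in nhds t. (LBINT v:{0..u}. \<phi> v l) = (LBINT v:{0..u}. k v)"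
  proof -
    have "\<forall>\<^sub>F u in nhds t. u > 0" using t by (intro order_tendstoD(1)[OF filterlim_ident])
    thus ?thesis by eventually_elim (auto intro!: T)
  qed
  have "((\<lambda>u. LBINT v:{0..u}. k v) has_real_derivative \<phi> t l) (at t)"
    using DERIV_cong_ev[OF refl ev refl] d[OF \<phi>c] by simp
  with d[OF kc] have "\<phi> t l = k t" by (rule DERIV_unique[rotated])
  thus ?thesis by (simp add: \<phi>_def k_def)
qed

section \<open>From Laplace transforms to densities\<close>

text \<open>The hypothesis says that the images of \<open>P\<close> and \<open>Q\<close> under \<open>x \<mapsto> exp (- (x - c))\<close> have the same
moments. These are laws on \<open>[0, 1]\<close>, so their characteristic functions are the sums of their moment
series and agree.\<close>

lemma laplace_transform_unique:
  fixes P Q :: "real measure"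
  assumes P: "real_distribution P" and Q: "real_distribution Q"
    and P1: "AE x in P. c \<le> x" and Q1: "AE x in Q. c \<le> x"
    and eq: "\<And>k::nat. (\<integral>\<^sup>+x. ennreal (exp (- real k * (x - c))) \<partial>P) = (\<integral>\<^sup>+x. ennreal (exp (- real k * (x - c))) \<partial>Q)"
  shows "P = Q"
proof -
  define e where "e x = exp (- (x - c))" for x :: real
  have [measurable]: "e \<in> borel_measurable borel" unfolding e_def by measurable
  have distr: "real_distribution (distr R borel e)"
    and inv: "distr (distr R borel e) borel (\<lambda>y. c - ln y) = R"
    and mom: "(\<integral>y. y ^ k \<partial>distr R borel e) = enn2real (\<integral>\<^sup>+x. ennreal (exp (- real k * (x - c))) \<partial>R)"
    and int: "integrable (distr R borel e) (\<lambda>y. y ^ k)"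
    and le1: "(\<integral>y. \<bar>y\<bar> ^ k \<partial>distr R borel e) \<le> 1"
    if R: "real_distribution R" and R1: "AE x in R. c \<le> x" for R k
  proof -
    interpret real_distribution R by fact
    have em: "e \<in> measurable R borel" by simp
    show "real_distribution (distr R borel e)" by (rule real_distribution_distr) simp
    have "distr (distr R borel e) borel (\<lambda>y. c - ln y) = distr R borel (\<lambda>x. x)"
      by (subst distr_distr) (auto simp: o_def e_def)
    also have "\<dots> = R" by (rule distr_id2) simp
    finally show "distr (distr R borel e) borel (\<lambda>y. c - ln y) = R" .
    have pow: "e x ^ k = exp (- real k * (x - c))" for x by (simp add: e_def exp_of_nat_mult[symmetric] algebra_simps)
    have "(\<integral>y. y ^ k \<partial>distr R borel e) = (\<integral>x. exp (- real k * (x - c)) \<partial>R)"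
      by (subst integral_distr) (auto simp: pow)
    also have "\<dots> = enn2real (\<integral>\<^sup>+x. ennreal (exp (- real k * (x - c))) \<partial>R)"
      by (rule integral_eq_nn_integral) auto
    finally show "(\<integral>y. y ^ k \<partial>distr R borel e) = enn2real (\<integral>\<^sup>+x. ennreal (exp (- real k * (x - c))) \<partial>R)" .
    have b: "AE x in R. norm (e x ^ k) \<le> 1"
      using R1 by eventually_elim (auto simp: e_def intro!: power_le_one)
    have i: "integrable R (\<lambda>x. e x ^ k)" by (rule integrable_const_bound[OF b]) simp
    show "integrable (distr R borel e) (\<lambda>y. y ^ k)" by (subst integrable_distr_eq) (use i in auto)
    have "(\<integral>y. \<bar>y\<bar> ^ k \<partial>distr R borel e) = (\<integral>x. \<bar>e x\<bar> ^ k \<partial>R)" by (subst integral_distr) auto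
    also have "\<dots> \<le> (\<integral>x. 1 \<partial>R)"
    proof (rule integral_mono_AE)
      show "integrable R (\<lambda>x. \<bar>e x\<bar> ^ k)" using i by (simp add: e_def)
      show "AE x in R. \<bar>e x\<bar> ^ k \<le> 1" using b by (simp add: power_abs)
    qed simp
    finally show "(\<integral>y. \<bar>y\<bar> ^ k \<partial>distr R borel e) \<le> 1" using prob_space by simp
  qed
  interpret P': real_distribution "distr P borel e" by (rule distr[OF P P1])
  interpret Q': real_distribution "distr Q borel e" by (rule distr[OF Q Q1])
  have "distr P borel e = distr Q borel e"
  proof (rule Levy_uniqueness)
    show "char (distr P borel e) = char (distr Q borel e)"
    proof
      fix t :: real
      define d where "d = cmod (char (distr P borel e) t - char (distr Q borel e) t)"
      have le: "d \<le> 4 * (\<bar>t\<bar> ^ n / fact n)" for n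
      proof -
        define S where "S = (\<Sum>k\<le>n. ((\<i> * t) ^ k / fact k) * complex_of_real (\<integral>y. y ^ k \<partial>distr P borel e))"
        have S: "S = (\<Sum>k\<le>n. ((\<i> * t) ^ k / fact k) * complex_of_real (\<integral>y. y ^ k \<partial>distr Q borel e))"
          unfolding S_def mom[OF P P1] mom[OF Q Q1] eq ..
        have "cmod (char (distr P borel e) t - S) \<le> 2 * \<bar>t\<bar> ^ n / fact n * (\<integral>y. \<bar>y\<bar> ^ n \<partial>distr P borel e)"
          unfolding S_def by (rule P'.char_approx1) (rule int[OF P P1])
        also have "\<dots> \<le> 2 * \<bar>t\<bar> ^ n / fact n * 1" by (intro mult_left_mono le1[OF P P1]) auto
        finally have 1: "cmod (char (distr P borel e) t - S) \<le> 2 * \<bar>t\<bar> ^ n / fact n" by simp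
        have "cmod (char (distr Q borel e) t - S) \<le> 2 * \<bar>t\<bar> ^ n / fact n * (\<integral>y. \<bar>y\<bar> ^ n \<partial>distr Q borel e)"
          unfolding S by (rule Q'.char_approx1) (rule int[OF Q Q1])
        also have "\<dots> \<le> 2 * \<bar>t\<bar> ^ n / fact n * 1" by (intro mult_left_mono le1[OF Q Q1]) auto
        finally have 2: "cmod (char (distr Q borel e) t - S) \<le> 2 * \<bar>t\<bar> ^ n / fact n" by simp
        have "d \<le> cmod (char (distr P borel e) t - S) + cmod (char (distr Q borel e) t - S)"
          unfolding d_def by (metis norm_minus_commute norm_triangle_sub dist_norm dist_triangle2)
        with 1 2 show ?thesis by simp
      qed
      have "(\<lambda>n. 4 * (\<bar>t\<bar> ^ n / fact n)) \<longlonglongrightarrow> 4 * 0"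
        using summable_LIMSEQ_zero[OF summable_exp[of "\<bar>t\<bar>"]] by (intro tendsto_mult_left) (simp add: field_simps)
      hence "d \<le> 4 * 0" by (rule LIMSEQ_le_const) (intro exI[of _ 0] allI impI le)
      thus "char (distr P borel e) t = char (distr Q borel e) t" by (simp add: d_def)
    qed
  qed unfold_locales
  hence "distr (distr P borel e) borel (\<lambda>y. c - ln y) = distr (distr Q borel e) borel (\<lambda>y. c - ln y)"
    by (rule arg_cong)
  thus ?thesis unfolding inv[OF P P1] inv[OF Q Q1] .
qed

lemma nn_integral_Gamma_shift:
  fixes s r :: real
  assumes s: "s > 0" and r: "r > 0"
  shows "(\<integral>\<^sup>+z. ennreal (indicator {c..} z * ((z - c) powr (s - 1) * exp (- r * (z - c)))) \<partial>lborel) = ennreal (Gamma s / r powr s)"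
proof -
  have "ennreal (Gamma s) = (\<integral>\<^sup>+t. ennreal (indicator {0..} t * t powr (s - 1) / exp t) \<partial>lborel)"
    using Gamma_conv_nn_integral_real[OF s] by simp
  also have "\<dots> = ennreal \<bar>r\<bar> * (\<integral>\<^sup>+z. ennreal (indicator {0..} (- r * c + r * z) * (- r * c + r * z) powr (s - 1) / exp (- r * c + r * z)) \<partial>lborel)"
    by (rule nn_integral_real_affine) (use r in auto)
  also have "(\<lambda>z. ennreal (indicator {0..} (- r * c + r * z) * (- r * c + r * z) powr (s - 1) / exp (- r * c + r * z)))
      = (\<lambda>z. ennreal (r powr (s - 1)) * ennreal (indicator {c..} z * ((z - c) powr (s - 1) * exp (- r * (z - c)))))"
  proof
    fix z
    have e: "- r * c + r * z = r * (z - c)" by (simp add: algebra_simps)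
    have "indicator {0..} (r * (z - c)) * (r * (z - c)) powr (s - 1) / exp (r * (z - c))
        = r powr (s - 1) * (indicator {c..} z * ((z - c) powr (s - 1) * exp (- r * (z - c))))"
      using r by (auto simp: indicator_def powr_mult exp_minus divide_inverse zero_le_mult_iff)
    thus "ennreal (indicator {0..} (- r * c + r * z) * (- r * c + r * z) powr (s - 1) / exp (- r * c + r * z))
      = ennreal (r powr (s - 1)) * ennreal (indicator {c..} z * ((z - c) powr (s - 1) * exp (- r * (z - c))))"
      unfolding e by (simp add: ennreal_mult')
  qed
  also have "ennreal \<bar>r\<bar> * (\<integral>\<^sup>+z. ennreal (r powr (s - 1)) * ennreal (indicator {c..} z * ((z - c) powr (s - 1) * exp (- r * (z - c)))) \<partial>lborel)
     = ennreal (r powr s) * (\<integral>\<^sup>+z. ennreal (indicator {c..} z * ((z - c) powr (s - 1) * exp (- r * (z - c)))) \<partial>lborel)" (is "_ = _ * ?I")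
  proof -
    have "\<bar>r\<bar> * r powr (s - 1) = r powr s" using r by (simp add: powr_diff)
    moreover have "(\<integral>\<^sup>+z. ennreal (r powr (s - 1)) * ennreal (indicator {c..} z * ((z - c) powr (s - 1) * exp (- r * (z - c)))) \<partial>lborel)
        = ennreal (r powr (s - 1)) * ?I"
      by (rule nn_integral_cmult) measurable
    ultimately show ?thesis by (simp only: mult.assoc[symmetric] ennreal_mult'[symmetric] abs_ge_zero)
  qed
  finally have "ennreal (1 / r powr s) * ennreal (Gamma s) = (ennreal (1 / r powr s) * ennreal (r powr s)) * ?I"
    by (simp only: mult.assoc)
  moreover have "ennreal (1 / r powr s) * ennreal (r powr s) = 1" using r by (simp flip: ennreal_mult')
  moreover have "ennreal (1 / r powr s) * ennreal (Gamma s) = ennreal (Gamma s / r powr s)" by (simp flip: ennreal_mult')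
  ultimately show ?thesis by (simp only: mult_1)
qed

text \<open>It suffices to compare compact intervals, on each of which this is the substitution
\<open>z \<mapsto> cosh z\<close>.\<close>

lemma (in prob_space) distributed_of_cosh:
  fixes R :: "'a \<Rightarrow> real"
  assumes Rm [measurable]: "R \<in> borel_measurable M" and R0: "AE w in M. R w \<ge> 0"
    and D: "distributed M lborel (\<lambda>w. cosh (R w)) f"
  shows "distributed M lborel R (\<lambda>z. indicator {0..} z * f (cosh z) * ennreal (sinh z))"
proof -
  have fm [measurable]: "f \<in> borel_measurable borel" using distributed_borel_measurable[OF D] by simp
  have "continuous_on UNIV (cosh :: real \<Rightarrow> real)" "continuous_on UNIV (sinh :: real \<Rightarrow> real)" by (intro continuous_intros)+
  hence [measurable]: "(cosh :: real \<Rightarrow> real) \<in> borel_measurable borel" "(sinh :: real \<Rightarrow> real) \<in> borel_measurable borel"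
    by (auto intro: borel_measurable_continuous_onI)
  define g where "g z = indicator {0..} z * f (cosh z) * ennreal (sinh z)" for z
  have gm [measurable]: "g \<in> borel_measurable borel" unfolding g_def by measurable
  have main: "emeasure (distr M lborel R) {a..b} = emeasure (density lborel g) {a..b}" for a b
  proof -
    define a' where "a' = max 0 a"
    have "emeasure (distr M lborel R) {a..b} = emeasure M {w \<in> space M. R w \<in> {a..b}}"
      by (subst emeasure_distr) (auto intro!: arg_cong[where f = "emeasure M"])
    also have "\<dots> = emeasure M {w \<in> space M. R w \<in> {a'..b}}"
      by (rule emeasure_eq_AE) (use R0 in \<open>auto simp: a'_def elim!: eventually_mono\<close>)
    finally have 1: "emeasure (distr M lborel R) {a..b} = emeasure M {w \<in> space M. R w \<in> {a'..b}}" .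
    have "emeasure (density lborel g) {a..b} = (\<integral>\<^sup>+z. g z * indicator {a..b} z \<partial>lborel)"
      by (rule emeasure_density) auto
    also have "\<dots> = (\<integral>\<^sup>+z. f (cosh z) * ennreal (sinh z) * indicator {a'..b} z \<partial>lborel)"
      by (rule nn_integral_cong) (auto simp: g_def a'_def indicator_def)
    finally have 2: "emeasure (density lborel g) {a..b} = (\<integral>\<^sup>+z. f (cosh z) * ennreal (sinh z) * indicator {a'..b} z \<partial>lborel)" .
    show ?thesis
    proof (cases "a' \<le> b")
      case False
      thus ?thesis unfolding 1 2 by simp
    next
      case True
      have a'0: "a' \<ge> 0" by (simp add: a'_def)
      have "emeasure M {w \<in> space M. R w \<in> {a'..b}} = emeasure M {w \<in> space M. cosh (R w) \<in> {cosh a'..cosh b}}"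
      proof (rule emeasure_eq_AE)
        show "AE w in M. w \<in> {w \<in> space M. R w \<in> {a'..b}} \<longleftrightarrow> w \<in> {w \<in> space M. cosh (R w) \<in> {cosh a'..cosh b}}"
          using R0
        proof eventually_elim
          case (elim w)
          have "cosh a' \<le> cosh (R w) \<longleftrightarrow> a' \<le> R w" "cosh (R w) \<le> cosh b \<longleftrightarrow> R w \<le> b"
            using elim a'0 True by (auto simp: cosh_real_nonneg_le_iff)
          thus ?case by auto
        qed
      qed auto
      also have "\<dots> = emeasure (distr M lborel (\<lambda>w. cosh (R w))) {cosh a'..cosh b}"
        by (subst emeasure_distr) (auto intro!: arg_cong[where f = "emeasure M"])
      also have "distr M lborel (\<lambda>w. cosh (R w)) = density lborel f"
        by (rule distributed_distr_eq_density[OF D])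
      also have "emeasure (density lborel f) {cosh a'..cosh b} = (\<integral>\<^sup>+z. f z * indicator {cosh a'..cosh b} z \<partial>lborel)"
        by (rule emeasure_density) auto
      also have "\<dots> = (\<integral>\<^sup>+z. f (cosh z) * ennreal (sinh z) * indicator {a'..b} z \<partial>lborel)"
      proof (cases "a' = b")
        case True
        have *: "(\<integral>\<^sup>+z. h z * indicator {d..d} z \<partial>lborel) = 0" for h :: "real \<Rightarrow> ennreal" and d
        proof -
          have "AE z in lborel. z \<noteq> d" by (rule AE_lborel_singleton)
          hence "AE z in lborel. h z * indicator {d..d} z = 0" by eventually_elim auto
          from nn_integral_cong_AE[OF this] show ?thesis by simp
        qed
        show ?thesis unfolding True * ..
      next
        case False
        with \<open>a' \<le> b\<close> have "a' < b" by simp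
        show ?thesis
          by (rule nn_integral_substitution_aux[OF fm _ _ _ _ \<open>a' < b\<close>])
            (use a'0 in \<open>auto intro!: derivative_eq_intros continuous_intros\<close>)
      qed
      finally show ?thesis unfolding 1 2 .
    qed
  qed
  have "distr M lborel R = density lborel g"
  proof (rule measure_eqI_generator_eq[where E = "range (\<lambda>(a, b). {a..b::real})" and \<Omega> = UNIV and A = "\<lambda>n::nat. {- real n..real n}"])
    show "Int_stable (range (\<lambda>(a, b). {a..b::real}))"
    proof (rule Int_stableI)
      fix A B assume "A \<in> range (\<lambda>(a, b). {a..b::real})" "B \<in> range (\<lambda>(a, b). {a..b::real})"
      then obtain a b c d where "A = {a..b}" "B = {c..d}" by auto
      hence "A \<inter> B = (\<lambda>(a, b). {a..b}) (max a c, min b d)" by auto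
      thus "A \<inter> B \<in> range (\<lambda>(a, b). {a..b::real})" by blast
    qed
    show "sets (distr M lborel R) = sigma_sets UNIV (range (\<lambda>(a, b). {a..b::real}))"
      "sets (density lborel g) = sigma_sets UNIV (range (\<lambda>(a, b). {a..b::real}))"
      by (simp_all add: borel_eq_atLeastAtMost)
    show "(\<Union>n. {- real n..real n}) = UNIV"
    proof -
      have "\<exists>n::nat. - real n \<le> x \<and> x \<le> real n" for x
      proof -
        obtain n :: nat where "\<bar>x\<bar> \<le> real n" using real_arch_simple by blast
        thus ?thesis by (intro exI[of _ n]) auto
      qed
      thus ?thesis by auto
    qed
    show "emeasure (distr M lborel R) {- real n..real n} \<noteq> \<infinity>" for n
    proof -
      interpret D: prob_space "distr M lborel R" by (rule prob_space_distr) simp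
      show ?thesis by simp
    qed
  qed (use main in auto)
  thus ?thesis unfolding distributed_def g_def[abs_def, symmetric] by simp
qed

theorem proposition2p16:
  fixes M :: "'a measure" and F :: "real \<Rightarrow> 'a measure" and B R :: "real \<Rightarrow> 'a \<Rightarrow> real"
    and N :: "'b measure" and W :: "real \<Rightarrow> 'b \<Rightarrow> real"
    and \<alpha> t :: real
  assumes "\<alpha> \<ge> - 1 / 2"
    and "hyperbolic_bessel_process M F B \<alpha> 0 R"
    and "standard_brownian_motion N W"
    and "t > 0"
  shows
    "distributed M lborel (\<lambda>\<omega>. cosh (R t \<omega>))
       (\<lambda>z. indicator {1..} z *
          ennreal (1 / 4 powr (\<alpha> + 1) * ((z - 1) powr \<alpha> / Gamma (\<alpha> + 1))) *
          (\<integral>\<^sup>+ \<omega>. ennreal (exp (- (z - 1) / (4 * exp_functional W (2 * \<alpha> + 1) (t / 4) \<omega>)) *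
                     (1 / exp_functional W (2 * \<alpha> + 1) (t / 4) \<omega> powr (\<alpha> + 1))) \<partial>N))
     \<and>
     distributed M lborel (R t)
       (\<lambda>z. indicator {0..} z *
          ennreal (1 / 4 powr (\<alpha> + 1) * ((cosh z - 1) powr \<alpha> * sinh z / Gamma (\<alpha> + 1))) *
          (\<integral>\<^sup>+ \<omega>. ennreal (exp (- (cosh z - 1) / (4 * exp_functional W (2 * \<alpha> + 1) (t / 4) \<omega>)) *
                     (1 / exp_functional W (2 * \<alpha> + 1) (t / 4) \<omega> powr (\<alpha> + 1))) \<partial>N))"
proof -
  let ?A = "exp_functional W (2 * \<alpha> + 1) (t / 4)"
  let ?J = "\<lambda>z. \<integral>\<^sup>+ w. ennreal (exp (- (z - 1) / (4 * ?A w)) * (1 / ?A w powr (\<alpha> + 1))) \<partial>N"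
  have al: "\<alpha> \<ge> - 1 / 2" and al1: "\<alpha> + 1 > 0" and t: "t > 0" "t \<ge> 0" using assms by auto
  have bes: "usual_conditions M F" "R t \<in> borel_measurable (F t)"
      "AE w in M. continuous_on {0..} (\<lambda>t. R t w) \<and> (\<forall>t\<ge>0. R t w \<ge> 0)"
    using assms(2) t unfolding hyperbolic_bessel_process_def by auto
  interpret M: prob_space M using bes(1) by (auto simp: usual_conditions_def)
  interpret N: prob_space N using assms(3) by (auto simp: standard_brownian_motion_def)
  have sub: "subalgebra M (F t)" using bes(1) t by (auto simp: usual_conditions_def)
  have Rm [measurable]: "R t \<in> borel_measurable M" by (rule measurable_from_subalg[OF sub bes(2)])
  have R0: "AE w in M. R t w \<ge> 0" using bes(3) by eventually_elim (use t in auto)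
  obtain Z where Z: "\<And>u. Z u \<in> borel_measurable M"
    "\<And>w. w \<in> space M \<Longrightarrow> continuous_on UNIV (\<lambda>u. Z u w)"
    "\<And>u w. Z u w \<ge> 0"
    "\<And>w. w \<in> space M \<Longrightarrow> Z 0 w = 0"
    and ZR: "\<And>t. t \<ge> 0 \<Longrightarrow> AE w in M. Z t w = cosh (R t w) - 1"
    and Zeq: "\<And>l t. l > 0 \<Longrightarrow> t > 0 \<Longrightarrow> (\<integral>w. exp (- l * Z t w) \<partial>M) = 1 + (\<integral>w. (LBINT u:{0..t}. laplace_generator \<alpha> (Z u w) l) \<partial>M)"
    by (rule bessel_laplace_equation[OF assms(2)], rule that; assumption)
  obtain X a where Xm [measurable]: "\<And>u. X u \<in> borel_measurable N" and am [measurable]: "\<And>u. a u \<in> borel_measurable N"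
    and Xc: "\<And>w. w \<in> space N \<Longrightarrow> continuous_on UNIV (\<lambda>u. X u w)"
    and ac: "\<And>w. w \<in> space N \<Longrightarrow> continuous_on UNIV (\<lambda>u. a u w)"
    and a0: "\<And>u w. w \<in> space N \<Longrightarrow> a u w \<ge> 0"
    and apos: "\<And>u w. w \<in> space N \<Longrightarrow> u > 0 \<Longrightarrow> a u w > 0"
    and a00: "\<And>w. a 0 w = 0" "\<And>w. X 0 w = 0"
    and aA: "AE w in N. \<forall>r\<ge>0. a r w = 4 * exp_functional W (2 * \<alpha> + 1) (r / 4) w"
    and aeq: "\<And>l z t. l > 0 \<Longrightarrow> z \<ge> 0 \<Longrightarrow> t > 0 \<Longrightarrow>
      (\<integral>w. (1 + l * a t w) powr - (\<alpha> + 1) * exp (- z * (l * exp (X t w) / (1 + l * a t w))) \<partial>N)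
        = exp (- l * z) + (\<integral>w. (LBINT u:{0..t}. (1 + l * a u w) powr - (\<alpha> + 1) * laplace_generator \<alpha> z (l * exp (X u w) / (1 + l * a u w))) \<partial>N)"
    and abd: "\<And>l t w. l > 0 \<Longrightarrow> t \<ge> 0 \<Longrightarrow> w \<in> space N \<Longrightarrow>
      (LBINT u:{0..t}. (1 + l * a u w) powr - (\<alpha> + 1) * (l * exp (X u w) / (1 + l * a u w))) \<le> 1 / (\<alpha> + 1)"
    by (rule exponential_functional_equation[OF assms(3) al], rule that; assumption)
  have dual: "(\<integral>w. exp (- l * Z t w) \<partial>M) = (\<integral>w. (1 + l * a t w) powr - (\<alpha> + 1) \<partial>N)" if l: "l > 0" for l
  proof (rule laplace_duality[where K = "\<lambda>u w. (1 + l * a u w) powr - (\<alpha> + 1)" and \<Lambda> = "\<lambda>u w. l * exp (X u w) / (1 + l * a u w)" and \<alpha> = \<alpha> and c = "1 / (\<alpha> + 1)"])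
    have pos: "1 + l * a u w \<ge> 1" if "w \<in> space N" for u w using a0[OF that] l by simp
    fix w assume w: "w \<in> space N"
    have ne: "1 + l * a u w \<noteq> 0" for u using pos[OF w, of u] by linarith
    show "continuous_on UNIV (\<lambda>u. (1 + l * a u w) powr - (\<alpha> + 1))"
      by (intro continuous_intros ac[OF w]) (use ne in auto)
    show "continuous_on UNIV (\<lambda>u. l * exp (X u w) / (1 + l * a u w))"
      by (intro continuous_intros ac[OF w] Xc[OF w]) (use ne in auto)
    fix u
    have "(1 + l * a u w) powr - (\<alpha> + 1) \<le> (1 + l * a u w) powr 0"
      using pos[OF w, of u] al1 by (intro powr_mono) auto
    thus "(1 + l * a u w) powr - (\<alpha> + 1) \<le> 1" using ne[of u] by simp
    show "0 < l * exp (X u w) / (1 + l * a u w)" using pos[OF w, of u] l by (intro divide_pos_pos) auto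
  qed (use M.prob_space_axioms N.prob_space_axioms al t l Z Zeq aeq abd a00 in auto)
  (* the density in terms of a t; the powers of 4 come from a t being four times the functional *)
  define q where "q z w = exp (- (z - 1) / a t w) / a t w powr (\<alpha> + 1)" for z w
  define f where "f z = indicator {1..} z * ennreal ((z - 1) powr \<alpha> / Gamma (\<alpha> + 1)) * (\<integral>\<^sup>+w. ennreal (q z w) \<partial>N)" for z :: real
  have G: "Gamma (\<alpha> + 1) > 0" by (rule Gamma_real_pos[OF al1])
  have fz: "(\<lambda>z. indicator {1..} z *
          ennreal (1 / 4 powr (\<alpha> + 1) * ((z - 1) powr \<alpha> / Gamma (\<alpha> + 1))) *
          ?J z) = f"
  proof
    fix z :: real
    have "?J z = (\<integral>\<^sup>+w. ennreal (4 powr (\<alpha> + 1)) * ennreal (q z w) \<partial>N)"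
    proof (rule nn_integral_cong_AE)
      show "AE w in N. ennreal (exp (- (z - 1) / (4 * ?A w)) *
                     (1 / ?A w powr (\<alpha> + 1))) = ennreal (4 powr (\<alpha> + 1)) * ennreal (q z w)"
        using aA AE_space
      proof eventually_elim
        case (elim w)
        define A where "A = ?A w"
        have A: "a t w = 4 * A" using elim t by (simp add: A_def)
        hence "A > 0" using apos[of w t] elim t by simp
        hence "exp (- (z - 1) / (4 * A)) * (1 / A powr (\<alpha> + 1)) = 4 powr (\<alpha> + 1) * q z w"
          by (simp add: q_def A powr_mult)
        thus ?case by (simp add: A_def ennreal_mult')
      qed
    qed
    also have "\<dots> = ennreal (4 powr (\<alpha> + 1)) * (\<integral>\<^sup>+w. ennreal (q z w) \<partial>N)"
      by (rule nn_integral_cmult) (unfold q_def, measurable)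
    finally have I: "?J z = ennreal (4 powr (\<alpha> + 1)) * (\<integral>\<^sup>+w. ennreal (q z w) \<partial>N)" .
    have "ennreal (1 / 4 powr (\<alpha> + 1) * ((z - 1) powr \<alpha> / Gamma (\<alpha> + 1))) * ennreal (4 powr (\<alpha> + 1)) = ennreal ((z - 1) powr \<alpha> / Gamma (\<alpha> + 1))"
      using G by (simp flip: ennreal_mult')
    thus "indicator {1..} z *
          ennreal (1 / 4 powr (\<alpha> + 1) * ((z - 1) powr \<alpha> / Gamma (\<alpha> + 1))) *
          ?J z = f z"
      unfolding I f_def by (metis mult.assoc)
  qed
  have fm [measurable]: "f \<in> borel_measurable borel" unfolding f_def q_def by measurable
  (* conditionally on W the density is that of a Gamma law with scale a t *)
  have tr: "(\<integral>\<^sup>+z. ennreal (exp (- real k * (z - 1))) \<partial>density lborel f) = (\<integral>\<^sup>+w. ennreal ((1 + real k * a t w) powr - (\<alpha> + 1)) \<partial>N)" for k :: nat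
  proof -
    define p where "p z w = indicator {1..} z * ((z - 1) powr \<alpha> / Gamma (\<alpha> + 1)) * q z w * exp (- real k * (z - 1))" for z w
    have pm: "(\<lambda>(w, z). ennreal (p z w)) \<in> borel_measurable (N \<Otimes>\<^sub>M lborel)" unfolding p_def q_def by measurable
    have qm [measurable]: "q z \<in> borel_measurable N" for z unfolding q_def by measurable
    have q0: "q z w \<ge> 0" for z w by (simp add: q_def)
    interpret NL: pair_sigma_finite N lborel ..
    have "(\<integral>\<^sup>+z. ennreal (exp (- real k * (z - 1))) \<partial>density lborel f) = (\<integral>\<^sup>+z. f z * ennreal (exp (- real k * (z - 1))) \<partial>lborel)"
      by (rule nn_integral_density) auto
    also have "\<dots> = (\<integral>\<^sup>+z. (\<integral>\<^sup>+w. ennreal (p z w) \<partial>N) \<partial>lborel)"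
    proof (rule nn_integral_cong)
      fix z :: real
      define C where "C = indicator {1..} z * ((z - 1) powr \<alpha> / Gamma (\<alpha> + 1)) * exp (- real k * (z - 1))"
      have C0: "C \<ge> 0" using G by (simp add: C_def)
      have "p z w = C * q z w" for w by (simp add: p_def C_def)
      hence "(\<integral>\<^sup>+w. ennreal (p z w) \<partial>N) = ennreal C * (\<integral>\<^sup>+w. ennreal (q z w) \<partial>N)"
        using C0 by (simp add: ennreal_mult' nn_integral_cmult)
      moreover have "f z * ennreal (exp (- real k * (z - 1))) = ennreal C * (\<integral>\<^sup>+w. ennreal (q z w) \<partial>N)"
        by (cases "z \<in> {1..}") (use G in \<open>auto simp: f_def C_def mult_ac simp flip: ennreal_mult'\<close>)
      ultimately show "f z * ennreal (exp (- real k * (z - 1))) = (\<integral>\<^sup>+w. ennreal (p z w) \<partial>N)" by simp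
    qed
    also have "\<dots> = (\<integral>\<^sup>+w. (\<integral>\<^sup>+z. ennreal (p z w) \<partial>lborel) \<partial>N)"
      by (rule NL.Fubini'[OF pm])
    also have "\<dots> = (\<integral>\<^sup>+w. ennreal ((1 + real k * a t w) powr - (\<alpha> + 1)) \<partial>N)"
    proof (rule nn_integral_cong)
      fix w assume w: "w \<in> space N"
      define A where "A = a t w"
      have A: "A > 0" using apos[OF w t(1)] by (simp add: A_def)
      define r where "r = 1 / A + real k"
      have r: "r > 0" using A by (simp add: r_def add_pos_nonneg)
      have rA: "r * A = 1 + real k * A" using A by (simp add: r_def field_simps)
      have "p z w = (1 / (Gamma (\<alpha> + 1) * A powr (\<alpha> + 1))) * (indicator {1..} z * ((z - 1) powr (\<alpha> + 1 - 1) * exp (- r * (z - 1))))" for z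
      proof -
        have "exp (- r * (z - 1)) = exp (- (z - 1) / A) * exp (- real k * (z - 1))"
          unfolding exp_add[symmetric] r_def by (simp add: algebra_simps diff_divide_distrib)
        thus ?thesis by (simp add: p_def q_def A_def)
      qed
      hence "(\<integral>\<^sup>+z. ennreal (p z w) \<partial>lborel) = (\<integral>\<^sup>+z. ennreal (1 / (Gamma (\<alpha> + 1) * A powr (\<alpha> + 1))) *
            ennreal (indicator {1..} z * ((z - 1) powr (\<alpha> + 1 - 1) * exp (- r * (z - 1)))) \<partial>lborel)"
        using G by (simp only: ennreal_mult'[symmetric] divide_nonneg_nonneg mult_nonneg_nonneg less_imp_le zero_le_one powr_ge_zero)
      also have "\<dots> = ennreal (1 / (Gamma (\<alpha> + 1) * A powr (\<alpha> + 1))) *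
            (\<integral>\<^sup>+z. ennreal (indicator {1..} z * ((z - 1) powr (\<alpha> + 1 - 1) * exp (- r * (z - 1)))) \<partial>lborel)"
        by (rule nn_integral_cmult) measurable
      also have "\<dots> = ennreal (1 / (Gamma (\<alpha> + 1) * A powr (\<alpha> + 1))) * ennreal (Gamma (\<alpha> + 1) / r powr (\<alpha> + 1))"
        unfolding nn_integral_Gamma_shift[OF al1 r] ..
      also have "\<dots> = ennreal (1 / (r * A) powr (\<alpha> + 1))"
        using G r A by (simp add: powr_mult flip: ennreal_mult')
      also have "1 / (r * A) powr (\<alpha> + 1) = (1 + real k * a t w) powr - (\<alpha> + 1)"
        unfolding rA unfolding A_def by (rule powr_minus_divide[symmetric])
      finally show "(\<integral>\<^sup>+z. ennreal (p z w) \<partial>lborel) = ennreal ((1 + real k * a t w) powr - (\<alpha> + 1))" .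
    qed
    finally show ?thesis .
  qed
  have cosh_m [measurable]: "(cosh :: real \<Rightarrow> real) \<in> borel_measurable borel"
    by (rule borel_measurable_continuous_onI) (intro continuous_intros)
  have trM: "(\<integral>\<^sup>+z. ennreal (exp (- real k * (z - 1))) \<partial>distr M lborel (\<lambda>w. cosh (R t w))) = (\<integral>\<^sup>+w. ennreal ((1 + real k * a t w) powr - (\<alpha> + 1)) \<partial>N)" for k :: nat
  proof -
    have [measurable]: "Z t \<in> borel_measurable M" by (rule Z(1))
    have le: "(1 + real k * a t w) powr - (\<alpha> + 1) \<le> 1" if "w \<in> space N" for w
    proof -
      have "1 + real k * a t w \<ge> 1" using a0[OF that, of t] by simp
      hence "(1 + real k * a t w) powr - (\<alpha> + 1) \<le> (1 + real k * a t w) powr 0" using al1 by (intro powr_mono) auto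
      thus ?thesis using \<open>1 + real k * a t w \<ge> 1\<close> by simp
    qed
    have "(\<integral>\<^sup>+z. ennreal (exp (- real k * (z - 1))) \<partial>distr M lborel (\<lambda>w. cosh (R t w))) = (\<integral>\<^sup>+w. ennreal (exp (- real k * (cosh (R t w) - 1))) \<partial>M)"
      by (subst nn_integral_distr) auto
    also have "\<dots> = (\<integral>\<^sup>+w. ennreal (exp (- real k * Z t w)) \<partial>M)"
    proof (rule nn_integral_cong_AE)
      show "AE w in M. ennreal (exp (- real k * (cosh (R t w) - 1))) = ennreal (exp (- real k * Z t w))"
        using ZR[OF t(2)] by eventually_elim simp
    qed
    also have "\<dots> = ennreal (\<integral>w. exp (- real k * Z t w) \<partial>M)"
      by (rule nn_integral_eq_integral) (auto intro!: M.integrable_const_bound[where B = 1] simp: Z(3))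
    also have "(\<integral>w. exp (- real k * Z t w) \<partial>M) = (\<integral>w. (1 + real k * a t w) powr - (\<alpha> + 1) \<partial>N)"
      by (cases "k = 0") (use dual[of "real k"] in \<open>auto simp: M.prob_space N.prob_space\<close>)
    also have "ennreal \<dots> = (\<integral>\<^sup>+w. ennreal ((1 + real k * a t w) powr - (\<alpha> + 1)) \<partial>N)"
      by (rule nn_integral_eq_integral[symmetric]) (use le in \<open>auto intro!: N.integrable_const_bound[where B = 1]\<close>)
    finally show ?thesis .
  qed
  have D: "distr M borel (\<lambda>w. cosh (R t w)) = density lborel f"
  proof (rule laplace_transform_unique[where c = 1])
    show "real_distribution (distr M borel (\<lambda>w. cosh (R t w)))" by (rule M.real_distribution_distr) simp
    have "emeasure (density lborel f) (space (density lborel f)) = 1"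
      using tr[of 0] by (simp add: N.emeasure_space_1)
    thus "real_distribution (density lborel f)"
      by (intro real_distribution.intro prob_spaceI) (auto simp: real_distribution_axioms_def)
    show "AE x in distr M borel (\<lambda>w. cosh (R t w)). 1 \<le> x"
      by (subst AE_distr_iff) (auto simp: cosh_real_ge_1)
    show "AE x in density lborel f. 1 \<le> x"
      by (subst AE_density) (auto simp: f_def indicator_def)
    have "distr M borel (\<lambda>w. cosh (R t w)) = distr M lborel (\<lambda>w. cosh (R t w))"
      by (rule distr_cong) auto
    thus "(\<integral>\<^sup>+x. ennreal (exp (- real k * (x - 1))) \<partial>distr M borel (\<lambda>w. cosh (R t w))) = (\<integral>\<^sup>+x. ennreal (exp (- real k * (x - 1))) \<partial>density lborel f)" for k :: nat
      using tr trM by simp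
  qed
  have D1: "distributed M lborel (\<lambda>w. cosh (R t w)) f"
  proof -
    have "distr M borel (\<lambda>w. cosh (R t w)) = distr M lborel (\<lambda>w. cosh (R t w))"
      by (rule distr_cong) auto
    with D show ?thesis by (simp add: distributed_def)
  qed
  have D2: "(\<lambda>z. indicator {0..} z * f (cosh z) * ennreal (sinh z)) = (\<lambda>z. indicator {0..} z *
          ennreal (1 / 4 powr (\<alpha> + 1) * ((cosh z - 1) powr \<alpha> * sinh z / Gamma (\<alpha> + 1))) *
          ?J (cosh z))"
  proof
    fix z :: real
    define I where "I = ?J (cosh z)"
    have fc: "f (cosh z) = ennreal (1 / 4 powr (\<alpha> + 1) * ((cosh z - 1) powr \<alpha> / Gamma (\<alpha> + 1))) * I"
      unfolding fz[symmetric] I_def using cosh_real_ge_1[of z] by simp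
    have "f (cosh z) * ennreal (sinh z) = ennreal (1 / 4 powr (\<alpha> + 1) * ((cosh z - 1) powr \<alpha> * sinh z / Gamma (\<alpha> + 1))) * I" if "z \<ge> 0"
    proof -
      define C where "C = 1 / 4 powr (\<alpha> + 1) * ((cosh z - 1) powr \<alpha> / Gamma (\<alpha> + 1))"
      have C: "0 \<le> C" using G by (simp add: C_def)
      have "1 / 4 powr (\<alpha> + 1) * ((cosh z - 1) powr \<alpha> * sinh z / Gamma (\<alpha> + 1)) = C * sinh z"
        by (simp add: C_def)
      thus ?thesis unfolding fc C_def[symmetric] using ennreal_mult'[OF C, of "sinh z"] by (simp add: mult_ac)
    qed
    thus "indicator {0..} z * f (cosh z) * ennreal (sinh z) = indicator {0..} z *
          ennreal (1 / 4 powr (\<alpha> + 1) * ((cosh z - 1) powr \<alpha> * sinh z / Gamma (\<alpha> + 1))) *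
          ?J (cosh z)"
      unfolding I_def[symmetric] by (cases "z \<ge> 0") auto
  qed
  show ?thesis
    unfolding fz using D1 M.distributed_of_cosh[OF Rm R0 D1] unfolding D2 by blast
qed

end
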